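(* Let $S^1=\mathbb R/\mathbb Z$, $I=[0,1]$, and let $f:S^1\times I\to S^1\times I$ be the $C^\infty$ map $$f(x,z)=\Bigl(3x,\;z+\cos(2\pi x)\,\tfrac{z}{32}(1-z)\Bigr),$$ where the first coordinate is taken modulo $1$. For every real $\alpha>0$ and every real $k\ge 1+\alpha$ there is a $C^k$ neighborhood $\mathcal U$ of $f$ in the space of $C^k$ maps of the annulus $S^1\times I$ to itself which send the boundary to the boundary, such that for every $g\in\mathcal U$: the two boundary circles $A=S^1\times\{0\}$ and $B=S^1\times\{1\}$ are each attractors of $g$; the union $\mathcal B(A)\cup\mathcal B(B)$ of their basins has full $2$-dimensional Lebesgue measure; and their basins are intermingled.
   Context: Let $M$ be a smooth compact $n$-dimensional manifold (possibly with boundary) and $g:M\to M$ a continuous map. The $\omega$-limit set of $\mathbf x\in M$ is $\omega(\mathbf x)=\bigcap_{k}\overline{\bigcup_{l\ge k}\{g^l(\mathbf x)\}}$. A compact set $A\subset M$ is an attractor of $g$ if $\{\mathbf x\in M:\omega(\mathbf x)=A\}$ has positive $n$-dimensional Lebesgue measure. The basin of attraction of $A$ is $\mathcal B(A)=\{\mathbf x\in M:\omega(\mathbf x)\subset A\}$. Basins are called intermingled if any open set which intersects one of the basins in a set of positive measure also intersects each of the other basins in a set of positive measure. For non-integer $k=r+\beta$ with $r$ an integer and $0<\beta<1$, $C^k$ means $C^r$ with $\beta$-Hölder $r$-th derivatives. The maps are not required to be invertible. *)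

theory Defs
  imports "HOL-Analysis.Analysis"
begin

quotient_type circle = real / "\<lambda>x y :: real. x - y \<in> \<int>"
  morphisms rep_circle to_circle
proof (rule equivpI)
  show "reflp (\<lambda>x y :: real. x - y \<in> \<int>)"
    by (rule reflpI) simp
  show "symp (\<lambda>x y :: real. x - y \<in> \<int>)"
    by (rule sympI) (metis Ints_minus minus_diff_eq)
  show "transp (\<lambda>x y :: real. x - y \<in> \<int>)"
    by (rule transpI) (metis Ints_add diff_add_cancel add_diff_eq)
qed

(* the quotient topology of the reals modulo the integers *)
instantiation circle :: topological_space
begin

definition open_circle :: "circle set \<Rightarrow> bool"
  where "open_circle U \<longleftrightarrow> open (to_circle -` U)"

instance
proof
  show "open (UNIV :: circle set)"
    by (simp add: open_circle_def)
  show "open (S \<inter> T)" if "open S" "open T" for S T :: "circle set"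
    using that by (simp add: open_circle_def vimage_Int open_Int)
  show "open (\<Union>K)" if "\<forall>S\<in>K. open S" for K :: "circle set set"
    using that by (auto simp: open_circle_def vimage_Union)
qed

end

lift_definition triple :: "circle \<Rightarrow> circle" is "\<lambda>x. 3 * x"
proof -
  fix x y :: real
  assume "x - y \<in> \<int>"
  then have "3 * (x - y) \<in> \<int>"
    by (intro Ints_mult) auto
  then show "3 * x - 3 * y \<in> \<int>"
    by (simp add: right_diff_distrib)
qed

lift_definition cos_circle :: "circle \<Rightarrow> real" is "\<lambda>x. cos (2 * pi * x)"
proof -
  fix x y :: real
  assume "x - y \<in> \<int>"
  then obtain n where "x - y = of_int n"
    by (auto elim: Ints_cases)
  then have "x = y + of_int n"
    by simp
  then have "2 * pi * x = 2 * pi * y + 2 * pi * of_int n"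
    by (simp only: distrib_left)
  then show "cos (2 * pi * x) = cos (2 * pi * y)"
    by (simp add: cos_add)
qed

(* The annulus is modelled as a subset of the product of the circle with the whole real line.
   It is closed there, so closures taken in the annulus and in the product agree. *)
definition annulus :: "(circle \<times> real) set"
  where "annulus = UNIV \<times> {0..1}"

definition annulus_boundary :: "(circle \<times> real) set"
  where "annulus_boundary = UNIV \<times> {0, 1}"

definition kan_map :: "circle \<times> real \<Rightarrow> circle \<times> real"
  where "kan_map = (\<lambda>(x, z). (triple x, z + cos_circle x * (z / 32) * (1 - z)))"

definition strip :: "(real \<times> real) set"
  where "strip = UNIV \<times> {0..1}"

definition covering :: "real \<times> real \<Rightarrow> circle \<times> real"
  where "covering = (\<lambda>(x, z). (to_circle x, z))"

(* Two-dimensional Lebesgue measure on the annulus, computed in the fundamental domain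
   of the covering; the part of the product outside the annulus is a null set. *)
definition annulus_lebesgue :: "(circle \<times> real) measure"
  where "annulus_lebesgue =
    completion (distr (restrict_space lborel ({0..<1} \<times> {0..1})) borel covering)"

definition omega_limit :: "('a::topological_space \<Rightarrow> 'a) \<Rightarrow> 'a \<Rightarrow> 'a set"
  where "omega_limit g x = (\<Inter>k. closure (\<Union>l\<in>{k..}. {(g ^^ l) x}))"

(* In the next three definitions M is the phase space and \<mu> is Lebesgue measure on it. *)
definition attractor ::
    "'a::topological_space measure \<Rightarrow> 'a set \<Rightarrow> ('a \<Rightarrow> 'a) \<Rightarrow> 'a set \<Rightarrow> bool"
  where "attractor \<mu> M g A \<longleftrightarrow>
    compact A \<and> A \<subseteq> M \<and> emeasure \<mu> {x \<in> M. omega_limit g x = A} > 0"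

definition basin :: "'a::topological_space set \<Rightarrow> ('a \<Rightarrow> 'a) \<Rightarrow> 'a set \<Rightarrow> 'a set"
  where "basin M g A = {x \<in> M. omega_limit g x \<subseteq> A}"

definition intermingled :: "'a::topological_space measure \<Rightarrow> 'a set set \<Rightarrow> bool"
  where "intermingled \<mu> \<B> \<longleftrightarrow>
    (\<forall>V. open V \<longrightarrow> (\<forall>B\<in>\<B>. emeasure \<mu> (V \<inter> B) > 0 \<longrightarrow>
      (\<forall>B'\<in>\<B>. emeasure \<mu> (V \<inter> B') > 0)))"

(* Partial derivatives relative to S: one-sided at boundary points of S. *)
definition partial_within ::
    "'a::real_normed_vector set \<Rightarrow> 'a \<Rightarrow> ('a \<Rightarrow> 'b::real_normed_vector) \<Rightarrow> 'a \<Rightarrow> 'b"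
  where "partial_within S b u p =
    vector_derivative (\<lambda>t. u (p + t *\<^sub>R b)) (at 0 within {t. p + t *\<^sub>R b \<in> S})"

abbreviation partials_within ::
    "'a::real_normed_vector set \<Rightarrow> 'a list \<Rightarrow> ('a \<Rightarrow> 'b::real_normed_vector) \<Rightarrow> 'a \<Rightarrow> 'b"
  where "partials_within S bs u \<equiv> foldr (partial_within S) bs u"

definition Cr_on ::
    "nat \<Rightarrow> 'a::euclidean_space set \<Rightarrow> ('a \<Rightarrow> 'b::real_normed_vector) \<Rightarrow> bool"
  where "Cr_on r S u \<longleftrightarrow>
    (\<forall>bs\<in>lists Basis. length bs < r \<longrightarrow> (\<forall>b\<in>Basis. \<forall>p\<in>S.
      (\<lambda>t. partials_within S bs u (p + t *\<^sub>R b)) differentiable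
        (at 0 within {t. p + t *\<^sub>R b \<in> S}))) \<and>
    (\<forall>bs\<in>lists Basis. length bs \<le> r \<longrightarrow> continuous_on S (partials_within S bs u))"

definition holder_on ::
    "real \<Rightarrow> real \<Rightarrow> 'a::metric_space set \<Rightarrow> ('a \<Rightarrow> 'b::metric_space) \<Rightarrow> bool"
  where "holder_on \<beta> C S u \<longleftrightarrow> (\<forall>p\<in>S. \<forall>q\<in>S. dist (u p) (u q) \<le> C * dist p q powr \<beta>)"

(* Meant for real k \<ge> 0; for an integer k there is no Hoelder condition. *)
definition Ck_on ::
    "real \<Rightarrow> 'a::euclidean_space set \<Rightarrow> ('a \<Rightarrow> 'b::real_normed_vector) \<Rightarrow> bool"
  where "Ck_on k S u \<longleftrightarrow>
    Cr_on (nat \<lfloor>k\<rfloor>) S u \<and>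
    (k \<notin> \<int> \<longrightarrow> (\<forall>bs\<in>lists Basis. length bs = nat \<lfloor>k\<rfloor> \<longrightarrow>
      (\<exists>C. holder_on (frac k) C S (partials_within S bs u))))"

(* The C^k norm of u on S is small: all partial derivatives up to the integer part of k,
   and the Hoelder seminorms of the top ones. *)
definition Ck_small ::
    "real \<Rightarrow> real \<Rightarrow> 'a::euclidean_space set \<Rightarrow> ('a \<Rightarrow> 'b::real_normed_vector) \<Rightarrow> bool"
  where "Ck_small k \<epsilon> S u \<longleftrightarrow>
    (\<forall>bs\<in>lists Basis. length bs \<le> nat \<lfloor>k\<rfloor> \<longrightarrow>
      (\<forall>p\<in>S. norm (partials_within S bs u p) < \<epsilon>)) \<and>
    (k \<notin> \<int> \<longrightarrow> (\<forall>bs\<in>lists Basis. length bs = nat \<lfloor>k\<rfloor> \<longrightarrow>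
      holder_on (frac k) \<epsilon> S (partials_within S bs u)))"

(* The strip is the universal cover of the annulus and the covering is a local isometry whose
   local inverses are the charts, so regularity of a map of the annulus is that of its lifts.
   Lifts are unique up to integer translations.  For k > 1 the derivatives concerned by the
   Hoelder condition are periodic, so it may be imposed globally on the strip. *)
definition Ck_lift ::
    "real \<Rightarrow> (circle \<times> real \<Rightarrow> circle \<times> real) \<Rightarrow> (real \<times> real \<Rightarrow> real \<times> real) \<Rightarrow> bool"
  where "Ck_lift k g G \<longleftrightarrow> Ck_on k strip G \<and> (\<forall>p\<in>strip. covering (G p) = g (covering p))"

(* Values outside the annulus are irrelevant, also for the topology below. *)
definition Ck_maps :: "real \<Rightarrow> (circle \<times> real \<Rightarrow> circle \<times> real) set"
  where "Ck_maps k = {g. g ` annulus \<subseteq> annulus \<and> g ` annulus_boundary \<subseteq> annulus_boundary \<and>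
    (\<exists>G. Ck_lift k g G)}"

definition Ck_close ::
    "real \<Rightarrow> real \<Rightarrow> (circle \<times> real \<Rightarrow> circle \<times> real) \<Rightarrow> (circle \<times> real \<Rightarrow> circle \<times> real) \<Rightarrow> bool"
  where "Ck_close k \<epsilon> g h \<longleftrightarrow>
    (\<exists>G H. Ck_lift k g G \<and> Ck_lift k h H \<and> Ck_small k \<epsilon> strip (\<lambda>p. G p - H p))"

definition Ck_topology :: "real \<Rightarrow> (circle \<times> real \<Rightarrow> circle \<times> real) topology"
  where "Ck_topology k = topology (\<lambda>U. U \<subseteq> Ck_maps k \<and>
    (\<forall>g\<in>U. \<exists>\<epsilon>>0. \<forall>h\<in>Ck_maps k. Ck_close k \<epsilon> g h \<longrightarrow> h \<in> U))"

lemma Ck_small_mono: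
  assumes "Ck_small k \<epsilon> S u" "\<epsilon> \<le> \<delta>"
  shows "Ck_small k \<delta> S u"
proof -
  have "holder_on \<beta> \<delta> S v" if "holder_on \<beta> \<epsilon> S v" for \<beta> and v :: "'a \<Rightarrow> 'b"
    using that assms(2) unfolding holder_on_def
    by (meson mult_right_mono order_trans powr_ge_zero)
  then show ?thesis
    using assms unfolding Ck_small_def by (meson less_le_trans)
qed

lemma openin_Ck_topology:
  "openin (Ck_topology k) U \<longleftrightarrow> U \<subseteq> Ck_maps k \<and>
    (\<forall>g\<in>U. \<exists>\<epsilon>>0. \<forall>h\<in>Ck_maps k. Ck_close k \<epsilon> g h \<longrightarrow> h \<in> U)"
proof -
  let ?op = "\<lambda>U. U \<subseteq> Ck_maps k \<and>
    (\<forall>g\<in>U. \<exists>\<epsilon>>0. \<forall>h\<in>Ck_maps k. Ck_close k \<epsilon> g h \<longrightarrow> h \<in> U)"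
  have mono: "Ck_close k \<delta> g h" if "Ck_close k \<epsilon> g h" "\<epsilon> \<le> \<delta>" for \<epsilon> \<delta> g h
    using that Ck_small_mono unfolding Ck_close_def by blast
  have "istopology ?op"
    unfolding istopology_def
  proof (intro conjI allI impI)
    fix S T
    assume S: "?op S" and T: "?op T"
    show "S \<inter> T \<subseteq> Ck_maps k"
      using S by blast
    show "\<forall>g\<in>S \<inter> T. \<exists>\<epsilon>>0. \<forall>h\<in>Ck_maps k. Ck_close k \<epsilon> g h \<longrightarrow> h \<in> S \<inter> T"
    proof
      fix g
      assume "g \<in> S \<inter> T"
      then obtain d e where "d > 0" "e > 0"
        and d: "\<forall>h\<in>Ck_maps k. Ck_close k d g h \<longrightarrow> h \<in> S"
        and e: "\<forall>h\<in>Ck_maps k. Ck_close k e g h \<longrightarrow> h \<in> T"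
        using S T by blast
      then show "\<exists>\<epsilon>>0. \<forall>h\<in>Ck_maps k. Ck_close k \<epsilon> g h \<longrightarrow> h \<in> S \<inter> T"
        by (intro exI[of _ "min d e"]) (metis IntI min.cobounded1 min.cobounded2 min_less_iff_conj mono)
    qed
  next
    fix K
    assume K: "\<forall>S\<in>K. ?op S"
    show "\<Union>K \<subseteq> Ck_maps k"
      using K by blast
    show "\<forall>g\<in>\<Union>K. \<exists>\<epsilon>>0. \<forall>h\<in>Ck_maps k. Ck_close k \<epsilon> g h \<longrightarrow> h \<in> \<Union>K"
      using K by (meson Union_iff)
  qed
  then show ?thesis
    unfolding Ck_topology_def by (simp only: topology_inverse')
qed

end

theory Submission
  imports Defs
begin

text \<open>
  The proof follows horizontal lines.  On the universal cover let $G = (P, Q)$ be a lift of a map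
  close to $f$.  The image of a line $z = z_0$ under $G^n$ is a graph over $x$ of slope at most
  $1/8$, and $G$ stretches it by a factor close to $3$.  Call a segment of the line a standard
  piece of generation $n$ if its image under $G^n$ has horizontal length between $2$ and $4$.

  Distortion.  Since the first derivatives are Hoelder with exponent $\beta > 0$, and with a small
  constant $\epsilon$ in the first coordinate, the density of $G^n$ along a standard piece is
  constant up to a factor $\exp(C \epsilon)$ (\<open>distortion\<close>).  Moreover the logarithm of $z$
  oscillates by a bounded amount along the image (\<open>Z_variation\<close>), although its slope need not be
  bounded.  A set whose proportion in all standard pieces of late generations is bounded away from $1$ is
  therefore a null set, because standard pieces shrink and can fill any open set
  (\<open>null_if_never_dense\<close>).  This zero-one principle turns every lower bound on proportions
  into an almost sure statement.

  Drift.  Near $z = 0$ one step changes $\ln z$ by about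
  $\ln (1 + \cos (2 \pi x) / 32) \le \cos (2 \pi x) / 32 - \cos^2 (2 \pi x) / 3072$.
  Under iterated tripling the cosines integrate to a bounded total, whereas the squares contribute
  a negative multiple of the number of steps.  Hence for a large number $N$ of steps and a small
  exponent $\theta$, both depending on $\beta$ only, the mean of $z^\theta$ over a standard piece
  contracts by $\exp(- \theta)$ (\<open>drift\<close>).  Being a statement about finitely many steps, it is
  stable under small perturbations.  Markov's inequality then shows that half of a standard piece
  close enough to $z = 0$ converges to $z = 0$ (\<open>escape_bound\<close>, \<open>trapped\<close>).

  Steering.  Where $\cos (2 \pi x) \le - 1/2$, that is around the fixed point $x = 1/2$ of the tripling map,
  the odds $z / (1 - z)$ contract.  Following this fixed point for a fixed time brings a
  definite proportion of any standard piece that stays away from $z = 1$ close to $z = 0$, so a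
  definite proportion is attracted to $z = 0$ (\<open>lower_proportion\<close>).  The substitution
  $(x, z) \mapsto (x + 1/2, 1 - z)$ exchanges the two boundary circles (\<open>flip\<close>) and gives the same for
  $z = 1$.  Every standard piece stays away from one of the two circles, so almost every point converges to one
  of them (\<open>lower_or_upper\<close>); and every segment contains pieces from which both are reached
  (\<open>lower_everywhere\<close>, \<open>upper_everywhere\<close>).  The zero-one principle also shows
  that almost every orbit visits every arc infinitely often (\<open>visits_infinitely_often\<close>), so the
  limit set is a whole boundary circle.  Fubini's theorem over $z_0$ transfers this to the annulus.

  It remains to see that being $C^k$ close to $f$ with $k > 1$ yields such estimates for a lift
  (\<open>perturbation_is_kan_lift\<close>) and that the maps at distance below the threshold form an open
  set (\<open>kan_neighborhood_open\<close>); the latter holds because lifts are unique up to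
  integer translations (\<open>lift_unique\<close>).
\<close>

section \<open>Constants and a chain rule along curves\<close>

lemma curve_chain_rule:
  fixes R Rx Rz :: "real \<Rightarrow> real \<Rightarrow> real"
  assumes Rx: "\<And>x z. z \<in> {0..1} \<Longrightarrow> ((\<lambda>x. R x z) has_real_derivative Rx x z) (at x)"
    and Rz: "\<And>x z. z \<in> {0..1} \<Longrightarrow> (R x has_real_derivative Rz x z) (at z within {0..1})"
    and cont: "continuous_on (UNIV \<times> {0..1}) (\<lambda>(x, z). Rz x z)"
    and x: "(x has_real_derivative dx) (at t)" and z: "(z has_real_derivative dz) (at t)"
    and range: "\<And>s. z s \<in> {0..1}"
  shows "((\<lambda>t. R (x t) (z t)) has_real_derivative Rx (x t) (z t) * dx + Rz (x t) (z t) * dz) (at t)"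
proof -
  have "continuous_on (UNIV \<times> {0..1}) (\<lambda>p. blinfun_mult_left (case p of (x, z) \<Rightarrow> Rz x z))"
    by (rule bounded_linear.continuous_on[OF bounded_linear_blinfun_mult_left cont])
  then have "continuous (at (x t, z t) within UNIV \<times> {0..1}) (\<lambda>(x, z). blinfun_mult_left (Rz x z))"
    using range by (auto simp: continuous_on_eq_continuous_within split_def)
  then have "((\<lambda>(x, z). R x z) has_derivative
      (\<lambda>(h, k). Rx (x t) (z t) * h + blinfun_apply (blinfun_mult_left (Rz (x t) (z t))) k))
      (at (x t, z t) within UNIV \<times> {0..1})"
    using Rx[OF range] Rz range
    by (intro has_derivative_partialsI) (auto simp: has_field_derivative_def mult_commute_abs)
  then have 1: "((\<lambda>(x, z). R x z) has_derivative (\<lambda>(h, k). Rx (x t) (z t) * h + Rz (x t) (z t) * k))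
      (at (x t, z t) within UNIV \<times> {0..1})"
    by (simp add: mult.commute)
  have 2: "((\<lambda>s. (x s, z s)) has_derivative (\<lambda>h. (dx * h, dz * h))) (at t)"
    using x z by (intro has_derivative_Pair) (auto simp: has_field_derivative_def)
  have 3: "((\<lambda>(x, z). R x z) has_derivative (\<lambda>(h, k). Rx (x t) (z t) * h + Rz (x t) (z t) * k))
      (at (x t, z t) within range (\<lambda>s. (x s, z s)))"
    by (rule has_derivative_subset[OF 1]) (use range in auto)
  have "(\<lambda>h. Rx (x t) (z t) * (dx * h) + Rz (x t) (z t) * (dz * h))
      = (*) (Rx (x t) (z t) * dx + Rz (x t) (z t) * dz)"
    by (auto simp: algebra_simps)
  with has_derivative_in_compose[OF 2 3] show ?thesis
    by (simp add: has_field_derivative_def)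
qed

lemma nonneg_deriv_imp_le:
  fixes f :: "real \<Rightarrow> real"
  assumes "s \<le> t" "\<And>u. (f has_real_derivative f' u) (at u)" "\<And>u. 0 \<le> f' u"
  shows "f s \<le> f t"
  by (rule DERIV_nonneg_imp_nondecreasing[OF assms(1)]) (use assms(2,3) in blast)

text \<open>
  The following constants depend on the Hoelder exponent only.  Hoelder estimates grow by the factor
  $1 + $ \<open>holder_gain\<close> in each step, which sums the errors along an orbit to a geometric series;
  \<open>log_variation\<close> bounds the oscillation of $\ln z$ along a standard piece; the drift over
  \<open>drift_steps\<close> steps beats this oscillation; and raising $z$ to the power \<open>drift_exponent\<close>
  makes the second order term of the exponential negligible.
\<close>

definition holder_gain :: "real \<Rightarrow> real" where
  "holder_gain \<beta> = (29/10) powr \<beta> - 1"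

definition log_variation :: "real \<Rightarrow> real" where
  "log_variation \<beta> = 80 / holder_gain \<beta>"

definition drift_steps :: "real \<Rightarrow> nat" where
  "drift_steps \<beta> = nat \<lceil>6144 * (log_variation \<beta> + 4)\<rceil> + 1"

definition drift_exponent :: "real \<Rightarrow> real" where
  "drift_exponent \<beta> = 1 / (real (drift_steps \<beta>))\<^sup>2"

text \<open>
  The three entries serve the crude one-step bounds, the shadowing of the tripling map during
  \<open>drift_steps\<close> steps, and a distortion of at most $\exp(\theta / 2)$, where
  $\theta$ is the drift exponent.
\<close>

definition max_perturbation :: "real \<Rightarrow> real" where
  "max_perturbation \<beta> = Min {1/1000,
     1 / (8 * real (drift_steps \<beta>) * (1 + 3 ^ drift_steps \<beta>)),
     drift_exponent \<beta> * holder_gain \<beta> / 48}"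

text \<open>
  The functions $P$, $Q$ are the coordinates of a lift, followed by their partial derivatives.  The
  integer $p$ is the ambiguity of the lift; it changes when the boundary circles are exchanged.
  The constant of the Hoelder condition has to be small for the derivatives of $P$, which control
  distortion, but not for those of $Q$.
\<close>

locale kan_perturbation =
  fixes P Q Px Pz Qx Qz :: "real \<Rightarrow> real \<Rightarrow> real" and \<beta> \<epsilon> :: real and p :: int
  assumes \<beta>: "0 < \<beta>" "\<beta> \<le> 1" and \<epsilon>_pos: "0 < \<epsilon>" and \<epsilon>_le: "\<epsilon> \<le> max_perturbation \<beta>"
    and P_x: "\<And>x z. z \<in> {0..1} \<Longrightarrow> ((\<lambda>x. P x z) has_real_derivative Px x z) (at x)"
    and P_z: "\<And>x z. z \<in> {0..1} \<Longrightarrow> (P x has_real_derivative Pz x z) (at z within {0..1})"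
    and Q_x: "\<And>x z. z \<in> {0..1} \<Longrightarrow> ((\<lambda>x. Q x z) has_real_derivative Qx x z) (at x)"
    and Q_z: "\<And>x z. z \<in> {0..1} \<Longrightarrow> (Q x has_real_derivative Qz x z) (at z within {0..1})"
    and P_close: "\<And>x z. z \<in> {0..1} \<Longrightarrow> \<bar>P x z - (3 * x + p)\<bar> \<le> \<epsilon>"
    and Px_close: "\<And>x z. z \<in> {0..1} \<Longrightarrow> \<bar>Px x z - 3\<bar> \<le> \<epsilon>"
    and Pz_close: "\<And>x z. z \<in> {0..1} \<Longrightarrow> \<bar>Pz x z\<bar> \<le> \<epsilon>"
    and Qx_close: "\<And>x z. z \<in> {0..1} \<Longrightarrow> \<bar>Qx x z + 2 * pi * sin (2 * pi * x) * (z * (1 - z) / 32)\<bar> \<le> \<epsilon>"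
    and Qz_close: "\<And>x z. z \<in> {0..1} \<Longrightarrow> \<bar>Qz x z - (1 + cos (2 * pi * x) * ((1 - 2 * z) / 32))\<bar> \<le> \<epsilon>"
    and Px_holder: "\<And>x z x' z'. z \<in> {0..1} \<Longrightarrow> z' \<in> {0..1} \<Longrightarrow>
        \<bar>Px x z - Px x' z'\<bar> \<le> \<epsilon> * (\<bar>x - x'\<bar> + \<bar>z - z'\<bar>) powr \<beta>"
    and Pz_holder: "\<And>x z x' z'. z \<in> {0..1} \<Longrightarrow> z' \<in> {0..1} \<Longrightarrow>
        \<bar>Pz x z - Pz x' z'\<bar> \<le> \<epsilon> * (\<bar>x - x'\<bar> + \<bar>z - z'\<bar>) powr \<beta>"
    and Qx_holder: "\<And>x z x' z'. z \<in> {0..1} \<Longrightarrow> z' \<in> {0..1} \<Longrightarrow> \<bar>x - x'\<bar> + \<bar>z - z'\<bar> \<le> 8 \<Longrightarrow>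
        \<bar>Qx x z - Qx x' z'\<bar> \<le> 9 * (\<bar>x - x'\<bar> + \<bar>z - z'\<bar>) powr \<beta>"
    and Qz_holder: "\<And>x z x' z'. z \<in> {0..1} \<Longrightarrow> z' \<in> {0..1} \<Longrightarrow> \<bar>x - x'\<bar> + \<bar>z - z'\<bar> \<le> 8 \<Longrightarrow>
        \<bar>Qz x z - Qz x' z'\<bar> \<le> 9 * (\<bar>x - x'\<bar> + \<bar>z - z'\<bar>) powr \<beta>"
    and Q_0: "\<And>x. Q x 0 = 0" and Q_1: "\<And>x. Q x 1 = 1"
begin

lemma \<epsilon>: "0 < \<epsilon>" "\<epsilon> \<le> 1/1000"
  using \<epsilon>_pos \<epsilon>_le by (auto simp: max_perturbation_def)

abbreviation "\<gamma> \<equiv> holder_gain \<beta>"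
abbreviation "V \<equiv> log_variation \<beta>"
abbreviation "N \<equiv> drift_steps \<beta>"
abbreviation "\<theta> \<equiv> drift_exponent \<beta>"

lemma continuous_on_if_holder:
  fixes R :: "real \<Rightarrow> real \<Rightarrow> real"
  assumes h: "\<And>x z x' z'. z \<in> {0..1} \<Longrightarrow> z' \<in> {0..1} \<Longrightarrow> \<bar>x - x'\<bar> + \<bar>z - z'\<bar> \<le> 8 \<Longrightarrow>
        \<bar>R x z - R x' z'\<bar> \<le> 9 * (\<bar>x - x'\<bar> + \<bar>z - z'\<bar>) powr \<beta>"
  shows "continuous_on (UNIV \<times> {0..1}) (\<lambda>(x, z). R x z)"
proof (clarsimp simp: continuous_on)
  fix x z :: real assume z: "0 \<le> z" "z \<le> 1"
  let ?F = "at (x, z) within UNIV \<times> {0..1}"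
  let ?d = "\<lambda>p. \<bar>fst p - x\<bar> + \<bar>snd p - z\<bar>"
  have "(?d \<longlongrightarrow> ?d (x, z)) ?F" by (intro tendsto_intros)
  then have d: "(?d \<longlongrightarrow> 0) ?F" by simp
  then have "((\<lambda>p. 9 * ?d p powr \<beta>) \<longlongrightarrow> 9 * 0 powr \<beta>) ?F"
    using \<beta> by (intro tendsto_intros) auto
  then have lim: "((\<lambda>p. 9 * ?d p powr \<beta>) \<longlongrightarrow> 0) ?F" by simp
  have in_strip: "eventually (\<lambda>p. snd p \<in> {0..1}) ?F"
    by (auto simp: eventually_at_topological)
  have "eventually (\<lambda>p. ?d p < 8) ?F" using d by (rule order_tendstoD) simp
  with in_strip have "eventually (\<lambda>p. norm ((case p of (x, z) \<Rightarrow> R x z) - R x z) \<le> 9 * ?d p powr \<beta>) ?F"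
  proof (rule eventually_elim2)
    fix p assume "snd p \<in> {0..1}" "?d p < 8"
    then show "norm ((case p of (x, z) \<Rightarrow> R x z) - R x z) \<le> 9 * ?d p powr \<beta>"
      using h[of "snd p" z "fst p" x] z by (simp add: split_def)
  qed
  then have "((\<lambda>p. (case p of (x, z) \<Rightarrow> R x z) - R x z) \<longlongrightarrow> 0) ?F"
    by (rule Lim_null_comparison) (rule lim)
  then show "((\<lambda>(x, z). R x z) \<longlongrightarrow> R x z) ?F"
    by (rule Lim_transform[rotated]) simp_all
qed

lemma Pz_cont: "continuous_on (UNIV \<times> {0..1}) (\<lambda>(x, z). Pz x z)"
proof (rule continuous_on_if_holder)
  fix x z x' z' :: real assume "z \<in> {0..1}" "z' \<in> {0..1}"
  from Pz_holder[OF this, of x x']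
  show "\<bar>Pz x z - Pz x' z'\<bar> \<le> 9 * (\<bar>x - x'\<bar> + \<bar>z - z'\<bar>) powr \<beta>"
    by (rule order_trans) (use \<epsilon> in \<open>intro mult_right_mono, auto\<close>)
qed

lemma Qz_cont: "continuous_on (UNIV \<times> {0..1}) (\<lambda>(x, z). Qz x z)"
  by (rule continuous_on_if_holder) (rule Qz_holder)

lemma Qx_bound: assumes "z \<in> {0..1}" shows "\<bar>Qx x z\<bar> \<le> 3/50"
proof -
  have zz: "\<bar>z * (1 - z) / 32\<bar> \<le> 1/128"
    using assms zero_le_power2[of "z - 1/2"] mult_nonneg_nonneg[of z "1 - z"]
    by (simp add: power2_eq_square algebra_simps)
  have "\<bar>2 * pi\<bar> * \<bar>sin (2 * pi * x)\<bar> \<le> 2 * 3.2 * 1"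
    using pi_approx abs_sin_le_one[of "2*pi*x"] by (intro mult_mono) auto
  then have "\<bar>2 * pi * sin (2 * pi * x)\<bar> \<le> 2 * 3.2" by (simp add: abs_mult)
  from mult_mono[OF this zz]
  have "\<bar>2 * pi * sin (2 * pi * x) * (z * (1 - z) / 32)\<bar> \<le> 2 * 3.2 * (1/128)"
    by (simp add: abs_mult)
  then show ?thesis using Qx_close[OF assms, of x] \<epsilon> by linarith
qed

lemma Qz_bound: assumes "z \<in> {0..1}" shows "\<bar>Qz x z - 1\<bar> \<le> 33/1000"
proof -
  have "\<bar>cos (2 * pi * x) * ((1 - 2 * z) / 32)\<bar> \<le> 1 * (1/32)"
    unfolding abs_mult by (rule mult_mono) (use assms in auto)
  then show ?thesis using Qz_close[OF assms, of x] \<epsilon> by linarith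
qed

text \<open>
  The error is proportional to the distance from each boundary circle because both circles are
  invariant: the difference vanishes there and its derivative in $z$ is small.
\<close>

lemma Q_close:
  assumes "z \<in> {0..1}"
  shows "\<bar>Q x z - (z + cos (2 * pi * x) * (z * (1 - z) / 32))\<bar> \<le> \<epsilon> * min z (1 - z)"
proof -
  define w where "w y = Q x y - (y + cos (2 * pi * x) * (y * (1 - y) / 32))" for y
  have w: "(w has_real_derivative Qz x y - (1 + cos (2 * pi * x) * ((1 - 2 * y) / 32))) (at y within {0..1})"
    if "y \<in> {0..1}" for y
    unfolding w_def
    by (rule derivative_eq_intros Q_z that refl | simp)+
  have "\<bar>w y - w y'\<bar> \<le> \<epsilon> * \<bar>y - y'\<bar>" if "y \<in> {0..1}" "y' \<in> {0..1}" for y y'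
    using field_differentiable_bound[of "{0..1}" w _ \<epsilon> y y', OF _ w] Qz_close that
    by (simp add: real_norm_def)
  from this[of z 0] this[of z 1] assms show ?thesis
    by (auto simp: w_def Q_0 Q_1 min_def)
qed

lemma Q_bounds:
  assumes "0 < z" "z < 1"
  shows "9/10 * z < Q x z" "Q x z < 11/10 * z" "Q x z < 1" "9/10 * (1 - z) < 1 - Q x z"
proof -
  have "\<bar>cos (2 * pi * x) * (z * (1 - z) / 32)\<bar> \<le> 1 * (z * (1 - z) / 32)"
    unfolding abs_mult using assms by (intro mult_mono) auto
  then have 1: "\<bar>Q x z - z\<bar> \<le> z * (1 - z) / 32 + \<epsilon> * min z (1 - z)"
    using Q_close[of z x] assms by auto
  have 2: "\<epsilon> * min z (1 - z) \<le> min z (1 - z) / 1000"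
    using mult_right_mono[OF \<epsilon>(2), of "min z (1 - z)"] assms by auto
  have "z * (1 - z) \<le> z * 1" "z * (1 - z) \<le> 1 * (1 - z)"
    by (rule mult_left_mono mult_right_mono; use assms in simp)+
  then have "z * (1 - z) \<le> min z (1 - z)" by simp
  moreover define m where "m = min z (1 - z)"
  moreover have "0 < m" using assms by (simp add: m_def)
  ultimately have "\<bar>Q x z - z\<bar> \<le> m / 20"
    using 1 2 unfolding m_def[symmetric] by linarith
  moreover have "0 < m" "m \<le> z" "m \<le> 1 - z" using assms by (auto simp: m_def)
  ultimately have "Q x z - z \<le> m / 20" "z - Q x z \<le> m / 20" "0 < m" "m \<le> z" "m \<le> 1 - z"
    by linarith+
  then show "9/10 * z < Q x z" "Q x z < 11/10 * z" "Q x z < 1" "9/10 * (1 - z) < 1 - Q x z"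
    using assms by auto
qed

definition G :: "real \<times> real \<Rightarrow> real \<times> real" where "G = (\<lambda>(x, z). (P x z, Q x z))"

end

text \<open>
  The functions $X_n$ and $Z_n$ below are the coordinates of the image under $G^n$ of the point of
  the line over $t$.
\<close>

locale kan_line = kan_perturbation +
  fixes z0 :: real assumes z0: "0 < z0" "z0 < 1"
begin

definition X :: "nat \<Rightarrow> real \<Rightarrow> real" where "X n t = fst ((G ^^ n) (t, z0))"
definition Z :: "nat \<Rightarrow> real \<Rightarrow> real" where "Z n t = snd ((G ^^ n) (t, z0))"

lemma X_0 [simp]: "X 0 t = t" and Z_0 [simp]: "Z 0 t = z0"
  by (simp_all add: X_def Z_def)

lemma X_Suc: "X (Suc n) t = P (X n t) (Z n t)" and Z_Suc: "Z (Suc n) t = Q (X n t) (Z n t)"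
  by (simp_all add: X_def Z_def G_def split_def)

lemma Z_range: "0 < Z n t" "Z n t < 1"
proof -
  have "0 < Z n t \<and> Z n t < 1"
  proof (induction n)
    case (Suc n)
    then show ?case using Q_bounds(1,3)[of "Z n t" "X n t"] by (auto simp: Z_Suc)
  qed (use z0 in simp)
  then show "0 < Z n t" "Z n t < 1" by auto
qed

lemma Z_range' [simp]: "0 \<le> Z n t" "Z n t \<le> 1" using Z_range[of n t] by simp_all

lemma Z_in: "Z n t \<in> {0..1}" by simp

text \<open>
  The image of the line under $G^n$ is a graph, and its slope $dz/dx$ obeys the recursion given
  by the chain rule; the denominator is the horizontal stretching factor of the $n$-th step.
\<close>

primrec slope :: "nat \<Rightarrow> real \<Rightarrow> real" where
  "slope 0 t = 0"
| "slope (Suc n) t = (Qx (X n t) (Z n t) + Qz (X n t) (Z n t) * slope n t) /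
     (Px (X n t) (Z n t) + Pz (X n t) (Z n t) * slope n t)"

definition stretch :: "nat \<Rightarrow> real \<Rightarrow> real" where
  "stretch n t = Px (X n t) (Z n t) + Pz (X n t) (Z n t) * slope n t"

lemma slope_Suc: "slope (Suc n) t = (Qx (X n t) (Z n t) + Qz (X n t) (Z n t) * slope n t) / stretch n t"
  by (simp add: stretch_def)

declare slope.simps(2) [simp del]

primrec DX :: "nat \<Rightarrow> real \<Rightarrow> real" where
  "DX 0 t = 1"
| "DX (Suc n) t = stretch n t * DX n t"

lemma stretch_bounds_aux: assumes "\<bar>slope n t\<bar> \<le> 1/8" shows "299/100 \<le> stretch n t" "stretch n t \<le> 301/100"
proof -
  have "\<bar>Pz (X n t) (Z n t) * slope n t\<bar> \<le> \<epsilon> * (1/8)"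
    unfolding abs_mult by (rule mult_mono) (use \<epsilon> assms Pz_close[OF Z_in] in auto)
  then show "299/100 \<le> stretch n t" "stretch n t \<le> 301/100"
    using Px_close[OF Z_in[of n t], of "X n t"] \<epsilon> unfolding stretch_def abs_le_iff by linarith+
qed

lemma slope_bound: "\<bar>slope n t\<bar> \<le> 1/8"
proof (induction n)
  case (Suc n)
  have "\<bar>Qz (X n t) (Z n t) * slope n t\<bar> \<le> (1033/1000) * (1/8)"
    unfolding abs_mult using Qz_bound[OF Z_in[of n t], of "X n t"] Suc by (intro mult_mono) linarith+
  then have "\<bar>Qx (X n t) (Z n t) + Qz (X n t) (Z n t) * slope n t\<bar> \<le> 1/8 * (299/100)"
    using Qx_bound[OF Z_in[of n t], of "X n t"] unfolding abs_le_iff by linarith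
  also have "\<dots> \<le> 1/8 * stretch n t" using stretch_bounds_aux[OF Suc] by simp
  finally show ?case
    using stretch_bounds_aux[OF Suc] by (simp add: slope_Suc abs_divide field_simps)
qed simp

lemmas stretch_bounds = stretch_bounds_aux[OF slope_bound]

lemma DX_pos: "0 < DX n t"
proof (induction n)
  case (Suc n)
  have "0 < stretch n t" using stretch_bounds(1)[of n t] by simp
  with Suc show ?case by simp
qed simp

lemma derivs: "(X n has_real_derivative DX n t) (at t) \<and> (Z n has_real_derivative slope n t * DX n t) (at t)"
proof (induction n)
  case 0
  then show ?case by (simp add: X_def[abs_def] Z_def[abs_def])
next
  case (Suc n)
  then have "((\<lambda>t. P (X n t) (Z n t)) has_real_derivative
      Px (X n t) (Z n t) * DX n t + Pz (X n t) (Z n t) * (slope n t * DX n t)) (at t)"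
    by (intro curve_chain_rule P_x P_z Pz_cont) auto
  moreover from Suc have "((\<lambda>t. Q (X n t) (Z n t)) has_real_derivative
      Qx (X n t) (Z n t) * DX n t + Qz (X n t) (Z n t) * (slope n t * DX n t)) (at t)"
    by (intro curve_chain_rule Q_x Q_z Qz_cont) auto
  moreover have "slope (Suc n) t * DX (Suc n) t = (Qx (X n t) (Z n t) + Qz (X n t) (Z n t) * slope n t) * DX n t"
    using stretch_bounds[of n t] by (simp add: slope_Suc)
  ultimately show ?case
    by (simp add: X_Suc[abs_def] Z_Suc[abs_def] stretch_def algebra_simps)
qed

lemmas X_deriv = derivs[THEN conjunct1] and Z_deriv = derivs[THEN conjunct2]

lemma X_cont: "continuous_on A (X n)" and Z_cont: "continuous_on A (Z n)"
  using X_deriv Z_deriv by (meson DERIV_isCont continuous_at_imp_continuous_on)+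

lemma X_step:
  assumes "s \<le> t"
  shows "29/10 * (X n t - X n s) \<le> X (Suc n) t - X (Suc n) s"
    and "X (Suc n) t - X (Suc n) s \<le> 31/10 * (X n t - X n s)"
proof -
  have m: "29/10 * DX n u \<le> DX (Suc n) u" "DX (Suc n) u \<le> 31/10 * DX n u" for u
    using stretch_bounds[of n u] DX_pos[of n u] by (auto simp: mult_right_mono)
  have "X (Suc n) s - 29/10 * X n s \<le> X (Suc n) t - 29/10 * X n t"
    by (rule nonneg_deriv_imp_le[OF assms], rule DERIV_diff[OF X_deriv DERIV_cmult[OF X_deriv]])
       (use m(1) in simp)
  then show "29/10 * (X n t - X n s) \<le> X (Suc n) t - X (Suc n) s" by (simp add: algebra_simps)
  have "31/10 * X n s - X (Suc n) s \<le> 31/10 * X n t - X (Suc n) t"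
    by (rule nonneg_deriv_imp_le[OF assms], rule DERIV_diff[OF DERIV_cmult[OF X_deriv] X_deriv])
       (use m(2) in simp)
  then show "X (Suc n) t - X (Suc n) s \<le> 31/10 * (X n t - X n s)" by (simp add: algebra_simps)
qed

lemma Z_lip: "\<bar>Z n t - Z n s\<bar> \<le> \<bar>X n t - X n s\<bar> / 8"
proof -
  have *: "\<bar>Z n t - Z n s\<bar> \<le> (X n t - X n s) / 8" if "s \<le> t" for s t
  proof -
    have sl: "\<bar>slope n u * DX n u\<bar> \<le> 1/8 * DX n u" for u
      unfolding abs_mult using slope_bound[of n u] DX_pos[of n u] by (intro mult_mono) auto
    have m: "0 \<le> 1/8 * DX n u - slope n u * DX n u" "0 \<le> 1/8 * DX n u + slope n u * DX n u" for u
      using sl[of u] by argo+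
    have "1/8 * X n s - Z n s \<le> 1/8 * X n t - Z n t"
      by (rule nonneg_deriv_imp_le[OF that], rule DERIV_diff[OF DERIV_cmult[OF X_deriv] Z_deriv], rule m)
    moreover have "1/8 * X n s + Z n s \<le> 1/8 * X n t + Z n t"
      by (rule nonneg_deriv_imp_le[OF that], rule DERIV_add[OF DERIV_cmult[OF X_deriv] Z_deriv], rule m)
    ultimately show ?thesis by (intro abs_leI) (simp_all add: field_simps)
  qed
  show ?thesis
  proof (cases "s \<le> t")
    case True
    have "X n t - X n s \<le> \<bar>X n t - X n s\<bar>" by simp
    with *[OF True] show ?thesis by simp
  next
    case False
    have "X n s - X n t \<le> \<bar>X n t - X n s\<bar>" by simp
    with *[of t s] False show ?thesis by (simp add: abs_minus_commute)
  qed
qed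

lemma X_less_iff: "X n s < X n t \<longleftrightarrow> s < t"
proof -
  have *: "X n s < X n t" if "s < t" for s t
    using that by (rule DERIV_pos_imp_increasing) (meson X_deriv DX_pos)
  show ?thesis using *[of s t] *[of t s] by (cases s t rule: linorder_cases) auto
qed

lemma X_le_iff: "X n s \<le> X n t \<longleftrightarrow> s \<le> t"
  by (meson X_less_iff linorder_not_le)

lemma X_expand: "s \<le> t \<Longrightarrow> (29/10)^k * (X n t - X n s) \<le> X (n + k) t - X (n + k) s"
proof (induction k)
  case (Suc k)
  then show ?case using X_step(1)[OF Suc.prems, of "n + k"] by simp
qed simp

lemma X_contract: "s \<le> t \<Longrightarrow> X (n + k) t - X (n + k) s \<le> (31/10)^k * (X n t - X n s)"
proof (induction k)
  case (Suc k)
  then show ?case using X_step(2)[OF Suc.prems, of "n + k"] by simp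
qed simp

lemma X_step_abs: "29/10 * \<bar>X n t - X n s\<bar> \<le> \<bar>X (Suc n) t - X (Suc n) s\<bar>"
proof (cases "s \<le> t")
  case True
  then have "X n s \<le> X n t" "X (Suc n) s \<le> X (Suc n) t" by (simp_all add: X_le_iff)
  then show ?thesis using X_step(1)[OF True, of n] by simp
next
  case False
  then have "X n t \<le> X n s" "X (Suc n) t \<le> X (Suc n) s" "t \<le> s" by (simp_all add: X_le_iff)
  then show ?thesis using X_step(1)[of t s n] by simp
qed

lemma X_surj: "\<exists>t. X n t = y"
proof -
  define r where "r = \<bar>y - X n 0\<bar>"
  have r: "0 \<le> r" by (simp add: r_def)
  have "1 * r \<le> (29/10)^n * r" by (intro mult_right_mono one_le_power r) simp
  then have "r \<le> X n r - X n 0" "r \<le> X n 0 - X n (-r)"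
    using X_expand[OF r, of n 0] X_expand[of "-r" 0 n 0] r by auto
  then have "X n (-r) \<le> y" "y \<le> X n r" unfolding r_def by linarith+
  moreover have "- r \<le> r" by (simp add: r_def)
  ultimately show ?thesis using IVT'[of "X n" "-r" y r, OF _ _ _ X_cont] by metis
qed

end

section \<open>Bounded distortion along horizontal lines\<close>

context kan_perturbation
begin

lemma \<gamma>_pos: "0 < \<gamma>"
  using \<beta> powr_less_mono[of 0 \<beta> "29/10"] by (simp add: holder_gain_def)

text \<open>
  As $Q$ vanishes at $z = 0$, the quotient $Q / z$ is an average of the $z$-derivative over the
  vertical segment below the point and inherits its Hoelder constant; the auxiliary
  function interpolates along the two segments.
\<close>

lemma Q_ratio_holder:
  assumes "0 < z" "z \<le> 1" "0 < z'" "z' \<le> 1" "\<bar>x - x'\<bar> + \<bar>z - z'\<bar> \<le> 8"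
  shows "\<bar>Q x z / z - Q x' z' / z'\<bar> \<le> 9 * (\<bar>x - x'\<bar> + \<bar>z - z'\<bar>) powr \<beta>"
proof -
  define r where "r u = Q x (z * u) / z - Q x' (z' * u) / z'" for u
  have r: "(r has_real_derivative Qz x (z * u) - Qz x' (z' * u)) (at u within {0..1})" if "u \<in> {0..1}" for u
  proof -
    have D: "((\<lambda>u. Q y (v * u)) has_real_derivative Qz y (v * u) * v) (at u within {0..1})"
      if "0 < v" "v \<le> 1" for y v
    proof -
      have "(*) v ` {0..1} \<subseteq> {0..1}" using that by (auto simp: mult_le_one)
      moreover have "v * u \<in> {0..1}" using that \<open>u \<in> {0..1}\<close> by (auto simp: mult_le_one)
      ultimately have "(Q y has_real_derivative Qz y (v * u)) (at (v * u) within (*) v ` {0..1})"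
        using Q_z has_field_derivative_subset by metis
      moreover have "((*) v has_real_derivative v) (at u within {0..1})"
        by (auto intro!: derivative_eq_intros)
      ultimately show ?thesis
        using DERIV_image_chain[of "Q y" _ "(*) v" u "{0..1}" v] by (simp add: comp_def)
    qed
    have D': "((\<lambda>u. Q y (v * u) / v) has_real_derivative Qz y (v * u)) (at u within {0..1})"
      if "0 < v" "v \<le> 1" for y v
      using DERIV_cdivide[OF D[OF that, of y], of v] that by simp
    show ?thesis unfolding r_def
      by (intro DERIV_diff D' assms)
  qed
  let ?B = "9 * (\<bar>x - x'\<bar> + \<bar>z - z'\<bar>) powr \<beta>"
  have "norm (Qz x (z * u) - Qz x' (z' * u)) \<le> ?B" if "u \<in> {0..1}" for u
  proof -
    have "z * u - z' * u = (z - z') * u" by (simp add: algebra_simps)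
    then have "\<bar>z * u - z' * u\<bar> \<le> \<bar>z - z'\<bar>"
      using that by (simp only: abs_mult) (simp add: mult_left_le)
    then have 1: "\<bar>x - x'\<bar> + \<bar>z * u - z' * u\<bar> \<le> \<bar>x - x'\<bar> + \<bar>z - z'\<bar>" by simp
    have "\<bar>Qz x (z * u) - Qz x' (z' * u)\<bar> \<le> 9 * (\<bar>x - x'\<bar> + \<bar>z * u - z' * u\<bar>) powr \<beta>"
      using assms that 1 by (intro Qz_holder) (auto simp: mult_le_one)
    also have "\<dots> \<le> ?B"
      using 1 \<beta> by (intro mult_left_mono powr_mono2) auto
    finally show ?thesis by simp
  qed
  from field_differentiable_bound[of "{0..1}" r, OF _ r this, of 1 0]
  show ?thesis by (simp add: r_def Q_0)
qed

end

lemma ln_lipschitz: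
  fixes x y c :: real
  assumes "0 < c" "c \<le> x" "c \<le> y"
  shows "\<bar>ln x - ln y\<bar> \<le> \<bar>x - y\<bar> / c"
proof -
  have *: "ln x - ln y \<le> \<bar>x - y\<bar> / c" if "c \<le> x" "c \<le> y" for x y :: real
  proof -
    have "ln x - ln y \<le> (x - y) / y" using assms that by (intro ln_diff_le) auto
    also have "\<dots> \<le> \<bar>x - y\<bar> / c" using assms that by (intro frac_le) auto
    finally show ?thesis .
  qed
  show ?thesis using *[of x y] *[of y x] assms by (simp add: abs_le_iff abs_minus_commute)
qed

context kan_line
begin

text \<open>
  All Hoelder estimates below are in terms of the distance at the current time, not at time $0$, which makes
  them uniform in $n$.
\<close>

definition w :: "nat \<Rightarrow> real \<Rightarrow> real \<Rightarrow> real" where "w n s t = \<bar>X n s - X n t\<bar> powr \<beta>"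

lemma w_nonneg [simp]: "0 \<le> w n s t" by (simp add: w_def)

lemma w_Suc: "(1 + \<gamma>) * w n s t \<le> w (Suc n) s t"
proof -
  have "(1 + \<gamma>) * w n s t = (29/10 * \<bar>X n s - X n t\<bar>) powr \<beta>"
    by (simp only: w_def holder_gain_def powr_mult abs_ge_zero) simp
  also have "\<dots> \<le> w (Suc n) s t"
    unfolding w_def using X_step_abs \<beta> by (intro powr_mono2) auto
  finally show ?thesis .
qed

lemma w_le_Suc: "w n s t \<le> w (Suc n) s t"
  using w_Suc[of n s t] mult_right_mono[of 1 "1 + \<gamma>" "w n s t"] \<gamma>_pos by simp

lemma dist_le:
  assumes "\<bar>X n s - X n t\<bar> \<le> 4"
  shows "\<bar>X n s - X n t\<bar> + \<bar>Z n s - Z n t\<bar> \<le> 8"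
    and "(\<bar>X n s - X n t\<bar> + \<bar>Z n s - Z n t\<bar>) powr \<beta> \<le> 2 * w n s t"
proof -
  have 1: "\<bar>X n s - X n t\<bar> + \<bar>Z n s - Z n t\<bar> \<le> 2 * \<bar>X n s - X n t\<bar>"
    using Z_lip[of n s t] by argo
  with assms show "\<bar>X n s - X n t\<bar> + \<bar>Z n s - Z n t\<bar> \<le> 8" by simp
  have "(\<bar>X n s - X n t\<bar> + \<bar>Z n s - Z n t\<bar>) powr \<beta> \<le> (2 * \<bar>X n s - X n t\<bar>) powr \<beta>"
    using 1 \<beta> by (intro powr_mono2) auto
  also have "\<dots> = 2 powr \<beta> * w n s t" by (simp add: w_def powr_mult)
  also have "\<dots> \<le> 2 powr 1 * w n s t" using \<beta> by (intro mult_right_mono powr_mono) auto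
  finally show "(\<bar>X n s - X n t\<bar> + \<bar>Z n s - Z n t\<bar>) powr \<beta> \<le> 2 * w n s t" by simp
qed

lemma X_diff_Suc_le:
  assumes "\<bar>X (Suc n) s - X (Suc n) t\<bar> \<le> 4" shows "\<bar>X n s - X n t\<bar> \<le> 4"
  using X_step_abs[of n s t] assms by argo

lemma P_partials_holder:
  assumes "\<bar>X n s - X n t\<bar> \<le> 4"
  shows "\<bar>Px (X n s) (Z n s) - Px (X n t) (Z n t)\<bar> \<le> 2 * \<epsilon> * w n s t"
    and "\<bar>Pz (X n s) (Z n s) - Pz (X n t) (Z n t)\<bar> \<le> 2 * \<epsilon> * w n s t"
proof -
  have *: "\<epsilon> * (\<bar>X n s - X n t\<bar> + \<bar>Z n s - Z n t\<bar>) powr \<beta> \<le> 2 * \<epsilon> * w n s t"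
    using mult_left_mono[OF dist_le(2)[OF assms], of \<epsilon>] \<epsilon> by simp
  show "\<bar>Px (X n s) (Z n s) - Px (X n t) (Z n t)\<bar> \<le> 2 * \<epsilon> * w n s t"
    by (rule order_trans[OF Px_holder *]) (rule Z_in)+
  show "\<bar>Pz (X n s) (Z n s) - Pz (X n t) (Z n t)\<bar> \<le> 2 * \<epsilon> * w n s t"
    by (rule order_trans[OF Pz_holder *]) (rule Z_in)+
qed

lemma Q_partials_holder:
  assumes "\<bar>X n s - X n t\<bar> \<le> 4"
  shows "\<bar>Qx (X n s) (Z n s) - Qx (X n t) (Z n t)\<bar> \<le> 18 * w n s t"
    and "\<bar>Qz (X n s) (Z n s) - Qz (X n t) (Z n t)\<bar> \<le> 18 * w n s t"
proof -
  have *: "9 * (\<bar>X n s - X n t\<bar> + \<bar>Z n s - Z n t\<bar>) powr \<beta> \<le> 18 * w n s t"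
    using dist_le(2)[OF assms] by simp
  show "\<bar>Qx (X n s) (Z n s) - Qx (X n t) (Z n t)\<bar> \<le> 18 * w n s t"
    by (rule order_trans[OF Qx_holder *]) (use dist_le[OF assms] in auto)
  show "\<bar>Qz (X n s) (Z n s) - Qz (X n t) (Z n t)\<bar> \<le> 18 * w n s t"
    by (rule order_trans[OF Qz_holder *]) (use dist_le[OF assms] in auto)
qed

lemma prod_diff_le:
  fixes d d' \<sigma> \<sigma>' D S M B :: real
  assumes "\<bar>d - d'\<bar> \<le> D" "\<bar>\<sigma> - \<sigma>'\<bar> \<le> S" "\<bar>d\<bar> \<le> M" "\<bar>\<sigma>'\<bar> \<le> B"
  shows "\<bar>d * \<sigma> - d' * \<sigma>'\<bar> \<le> M * S + D * B"
proof -
  have "d * \<sigma> - d' * \<sigma>' = d * (\<sigma> - \<sigma>') + (d - d') * \<sigma>'" by (simp add: algebra_simps)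
  moreover have "\<bar>d * (\<sigma> - \<sigma>')\<bar> \<le> M * S" "\<bar>(d - d') * \<sigma>'\<bar> \<le> D * B"
    unfolding abs_mult using assms by (intro mult_mono; linarith)+
  ultimately show ?thesis by linarith
qed

lemma stretch_diff_le:
  assumes "\<bar>X n s - X n t\<bar> \<le> 4" "\<bar>slope n s - slope n t\<bar> \<le> 12 * w n s t"
  shows "\<bar>stretch n s - stretch n t\<bar> \<le> 15 * \<epsilon> * w n s t"
proof -
  have "\<bar>Pz (X n s) (Z n s) * slope n s - Pz (X n t) (Z n t) * slope n t\<bar>
      \<le> \<epsilon> * (12 * w n s t) + 2 * \<epsilon> * w n s t * (1/8)"
    by (rule prod_diff_le[OF P_partials_holder(2)[OF assms(1)] assms(2) Pz_close[OF Z_in] slope_bound])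
  moreover have "0 \<le> \<epsilon> * w n s t" using \<epsilon> by simp
  ultimately show ?thesis
    using P_partials_holder(1)[OF assms(1)] unfolding stretch_def mult.assoc by argo
qed

text \<open>
  The recursion for the slope contracts differences by a factor of about $1/3$ and adds an error
  of order $w_n$, so a bound by a fixed multiple of $w_n$ propagates.
\<close>

lemma slope_holder: "\<bar>X n s - X n t\<bar> \<le> 4 \<Longrightarrow> \<bar>slope n s - slope n t\<bar> \<le> 12 * w n s t"
proof (induction n)
  case (Suc n)
  note X4 = X_diff_Suc_le[OF Suc.prems]
  note IH = Suc.IH[OF X4]
  let ?N = "\<lambda>t. Qx (X n t) (Z n t) + Qz (X n t) (Z n t) * slope n t"
  have "\<bar>Qz (X n s) (Z n s)\<bar> \<le> 1033/1000" using Qz_bound[OF Z_in[of n s], of "X n s"] by linarith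
  from prod_diff_le[OF Q_partials_holder(2)[OF X4] IH this slope_bound]
  have N: "\<bar>?N s - ?N t\<bar> \<le> 33 * w n s t"
    using Q_partials_holder(1)[OF X4] w_nonneg[of n s t] by argo
  have M: "\<bar>stretch n s - stretch n t\<bar> \<le> 15 * \<epsilon> * w n s t" by (rule stretch_diff_le[OF X4 IH])
  have "15 * \<epsilon> * w n s t \<le> 1 * w n s t" using \<epsilon> by (intro mult_right_mono) auto
  with M have "\<bar>slope (Suc n) t * (stretch n s - stretch n t)\<bar> \<le> 1/8 * (1 * w n s t)"
    unfolding abs_mult using slope_bound[of "Suc n" t] by (intro mult_mono) auto
  then have 1: "\<bar>(?N s - ?N t) - slope (Suc n) t * (stretch n s - stretch n t)\<bar> \<le> 34 * w n s t"
    using N w_nonneg[of n s t] unfolding abs_le_iff by linarith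
  have m: "stretch n s > 0" "stretch n t > 0" "29/10 \<le> stretch n s" using stretch_bounds[of n s] stretch_bounds[of n t] by auto
  have "slope (Suc n) s - slope (Suc n) t
      = ((?N s - ?N t) - slope (Suc n) t * (stretch n s - stretch n t)) / stretch n s"
    using m by (simp add: slope_Suc field_simps)
  then have "\<bar>slope (Suc n) s - slope (Suc n) t\<bar> \<le> (34 * w n s t) / (29/10)"
    using 1 m by (simp only: abs_divide) (intro frac_le, auto)
  also have "\<dots> \<le> 12 * w n s t" by simp
  also have "\<dots> \<le> 12 * w (Suc n) s t" using w_le_Suc by simp
  finally show ?case .
qed simp

lemmas stretch_holder = stretch_diff_le[OF _ slope_holder]

text \<open>
  Because $w_{n+1} \ge (1 + \gamma) w_n$, an error of size $C w_n$ in each step adds up to at most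
  $(C / \gamma) w_n$ at time $n$: the past contributes a geometric series.
\<close>

lemma holder_sum_step:
  assumes "\<bar>v\<bar> \<le> C / \<gamma> * w n s t" "\<bar>u\<bar> \<le> C * w n s t" "0 \<le> C"
  shows "\<bar>u + v\<bar> \<le> C / \<gamma> * w (Suc n) s t"
proof -
  have "\<bar>u + v\<bar> \<le> C * w n s t + C / \<gamma> * w n s t"
    using assms abs_triangle_ineq[of u v] by linarith
  also have "\<dots> = C / \<gamma> * ((1 + \<gamma>) * w n s t)"
    using \<gamma>_pos by (simp add: field_simps)
  also have "\<dots> \<le> C / \<gamma> * w (Suc n) s t"
    using w_Suc \<gamma>_pos assms by (intro mult_left_mono) auto
  finally show ?thesis .
qed

lemma distortion:
  "\<bar>X n s - X n t\<bar> \<le> 4 \<Longrightarrow> \<bar>ln (DX n s) - ln (DX n t)\<bar> \<le> 6 * \<epsilon> / \<gamma> * w n s t"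
proof (induction n)
  case (Suc n)
  note X4 = X_diff_Suc_le[OF Suc.prems]
  have m: "29/10 \<le> stretch n u" "stretch n u > 0" for u using stretch_bounds[of n u] by auto
  have "\<bar>ln (stretch n s) - ln (stretch n t)\<bar> \<le> \<bar>stretch n s - stretch n t\<bar> / (29/10)"
    by (rule ln_lipschitz) (use m in auto)
  also have "\<dots> \<le> (15 * \<epsilon> * w n s t) / (29/10)" using stretch_holder[OF X4 X4] by (intro divide_right_mono) auto
  also have "\<dots> \<le> 6 * \<epsilon> * w n s t" using \<epsilon> w_nonneg[of n s t] by simp
  finally have "\<bar>(ln (stretch n s) - ln (stretch n t)) + (ln (DX n s) - ln (DX n t))\<bar> \<le> 6 * \<epsilon> / \<gamma> * w (Suc n) s t"
    using holder_sum_step[OF Suc.IH[OF X4]] \<epsilon> by simp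
  moreover have DX: "ln (DX (Suc n) u) = ln (stretch n u) + ln (DX n u)" for u
    using m[of u] DX_pos[of n u] by (simp add: ln_mult)
  ultimately show ?case by (simp only: DX add_diff_add)
qed (use \<epsilon> \<gamma>_pos in simp)

lemma Z_variation:
  "\<bar>X n s - X n t\<bar> \<le> 4 \<Longrightarrow> \<bar>ln (Z n s) - ln (Z n t)\<bar> \<le> 20 / \<gamma> * w n s t"
proof (induction n)
  case (Suc n)
  note X4 = X_diff_Suc_le[OF Suc.prems]
  define q where "q u = Q (X n u) (Z n u) / Z n u" for u
  have q: "9/10 \<le> q u" for u
    using Q_bounds(1)[of "Z n u" "X n u"] Z_range[of n u] by (simp add: q_def field_simps)
  have "\<bar>ln (q s) - ln (q t)\<bar> \<le> \<bar>q s - q t\<bar> / (9/10)"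
    by (rule ln_lipschitz) (use q in auto)
  also have "\<bar>q s - q t\<bar> \<le> 9 * (\<bar>X n s - X n t\<bar> + \<bar>Z n s - Z n t\<bar>) powr \<beta>"
    unfolding q_def by (rule Q_ratio_holder) (use Z_range dist_le[OF X4] in auto)
  also have "\<dots> \<le> 18 * w n s t" using dist_le(2)[OF X4] by simp
  also have "\<dots> / (9/10) \<le> 20 * w n s t" by simp
  finally have "\<bar>(ln (q s) - ln (q t)) + (ln (Z n s) - ln (Z n t))\<bar> \<le> 20 / \<gamma> * w (Suc n) s t"
    using holder_sum_step[OF Suc.IH[OF X4]] by (simp add: divide_right_mono)
  moreover have Z: "ln (Z (Suc n) u) = ln (q u) + ln (Z n u)" for u
  proof -
    have "q u > 0" "Z n u > 0" "Z (Suc n) u = q u * Z n u"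
      using less_le_trans[OF _ q[of u], of 0] Z_range[of n u] by (auto simp: Z_Suc q_def)
    then show ?thesis by (simp add: ln_mult)
  qed
  ultimately show ?case by (simp only: Z add_diff_add)
qed (use \<gamma>_pos in simp)

end

section \<open>The mean of the cosine drift\<close>

text \<open>
  For negative arguments the bound comes from $\exp(y/2) \le 1 / (1 - y/2)$.
\<close>

lemma exp_le_quadratic:
  fixes y :: real assumes "\<bar>y\<bar> \<le> 1" shows "exp y \<le> 1 + y + y\<^sup>2"
proof (cases "0 \<le> y")
  case True
  then show ?thesis using assms exp_bound[of y] by simp
next
  case False
  have "(exp (y/2))\<^sup>2 \<le> (1 / (1 - y/2))\<^sup>2"
  proof (rule power_mono)
    have "1 + (- y/2) \<le> exp (- y/2)" by (rule exp_ge_add_one_self)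
    then have "inverse (exp (- y/2)) \<le> inverse (1 - y/2)"
      using False by (intro le_imp_inverse_le) auto
    then show "exp (y/2) \<le> 1 / (1 - y/2)" by (simp add: exp_minus inverse_eq_divide)
  qed simp
  also have "(exp (y/2))\<^sup>2 = exp y" by (simp add: power2_eq_square flip: exp_add)
  also have "(1 / (1 - y/2))\<^sup>2 \<le> 1 + y + y\<^sup>2"
  proof -
    have "1 \<le> (1 + y + y\<^sup>2) * (1 - y/2)\<^sup>2"
    proof -
      have "(1 + y + y\<^sup>2) * (1 - y/2)\<^sup>2 - 1 = y\<^sup>2 * (1/4 - 3/4 * y + y\<^sup>2/4)"
        by (simp add: power2_eq_square algebra_simps)
      also have "\<dots> \<ge> 0" using False by (intro mult_nonneg_nonneg) (auto intro!: add_nonneg_nonneg)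
      finally show ?thesis by simp
    qed
    then show ?thesis using False by (simp add: power_divide divide_le_eq)
  qed
  finally show ?thesis .
qed

lemma ln_le_quadratic:
  fixes y :: real assumes "-1 < y" "y \<le> 1/2" shows "ln (1 + y) \<le> y - y\<^sup>2 / 3"
proof -
  define f where "f u = u - u\<^sup>2 / 3 - ln (1 + u)" for u :: real
  have d: "(f has_real_derivative u * (1 - 2 * u) / (3 * (1 + u))) (at u)" if "-1 < u" for u
    unfolding f_def using that
    by (auto intro!: derivative_eq_intros simp: field_simps power2_eq_square)
  have "f 0 \<le> f y"
  proof (cases "0 \<le> y")
    case True
    show ?thesis
    proof (rule DERIV_nonneg_imp_nondecreasing[OF True])
      fix u assume "0 \<le> u" "u \<le> y"
      then show "\<exists>l. (f has_real_derivative l) (at u) \<and> 0 \<le> l"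
        using assms by (intro exI[of _ "u * (1 - 2 * u) / (3 * (1 + u))"] conjI d) auto
    qed
  next
    case False
    show ?thesis
    proof (rule DERIV_nonpos_imp_nonincreasing[of y 0])
      fix u assume "y \<le> u" "u \<le> 0"
      then show "\<exists>l. (f has_real_derivative l) (at u) \<and> l \<le> 0"
        using assms by (intro exI[of _ "u * (1 - 2 * u) / (3 * (1 + u))"] conjI d) (auto simp: mult_nonpos_nonneg divide_nonpos_pos)
    qed (use False in simp)
  qed
  then show ?thesis by (simp add: f_def)
qed

text \<open>
  An upper bound for $\ln (1 + \cos (2 \pi u) / 32)$ whose integral is elementary.
\<close>

definition \<psi> :: "real \<Rightarrow> real" where
  "\<psi> u = cos (2 * pi * u) / 32 - (cos (2 * pi * u))\<^sup>2 / 3072"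

lemma \<psi>_bound: "\<bar>\<psi> u\<bar> \<le> 1"
proof -
  have "\<bar>cos (2 * pi * u)\<bar> \<le> 1" "(cos (2 * pi * u))\<^sup>2 \<le> 1" by (simp_all add: abs_square_le_1)
  then show ?thesis unfolding \<psi>_def using zero_le_power2[of "cos (2 * pi * u)"] by argo
qed

lemma \<psi>_integral:
  assumes "u \<le> v" "0 < c"
  shows "((\<lambda>t. \<psi> (c * t)) has_integral
           (\<lambda>t. sin (2 * pi * (c * t)) / (64 * pi * c)
             - (t / 2 + sin (4 * pi * (c * t)) / (8 * pi * c)) / 3072) v
         - (\<lambda>t. sin (2 * pi * (c * t)) / (64 * pi * c)
             - (t / 2 + sin (4 * pi * (c * t)) / (8 * pi * c)) / 3072) u) {u..v}"
proof (rule fundamental_theorem_of_calculus[OF assms(1)], simp flip: has_real_derivative_iff_has_vector_derivative)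
  fix t
  have cos4: "cos (4 * pi * (c * t)) = 2 * (cos (2 * pi * (c * t)))\<^sup>2 - 1"
    using cos_double_cos[of "2 * pi * (c * t)"] by (simp add: mult.assoc)
  show "((\<lambda>t. sin (2 * pi * (c * t)) / (64 * pi * c)
             - (t / 2 + sin (4 * pi * (c * t)) / (8 * pi * c)) / 3072) has_real_derivative \<psi> (c * t))
        (at t within {u..v})"
    using assms by (auto intro!: derivative_eq_intros simp: \<psi>_def cos4) (simp add: field_simps)
qed

text \<open>
  The square of the cosine has mean $1/2$, which gives the slope $- 1/6144$; the oscillating parts of
  the primitive contribute at most a multiple of $1/c$.
\<close>

lemma \<psi>_integral_le:
  assumes "u \<le> v" "0 < c"
  shows "integral {u..v} (\<lambda>t. \<psi> (c * t)) \<le> 1 / (4 * c) - (v - u) / 6144"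
proof -
  have s: "sin x / (64 * pi * c) - sin y / (64 * pi * c) \<le> 1 / (8 * c)"
    "sin x / (8 * pi * c) - sin y / (8 * pi * c) \<le> 1 / (8 * c)" for x y
  proof -
    have p: "3 < pi" using pi_gt3 .
    have d: "sin x - sin y \<le> 2" using sin_le_one[of x] sin_ge_minus_one[of y] by linarith
    have "(sin x - sin y) / (64 * pi * c) \<le> 2 / (64 * pi * c)"
      using d p assms by (intro divide_right_mono) auto
    also have "\<dots> \<le> 1 / (8 * c)" using p assms by (simp add: field_simps)
    finally show "sin x / (64 * pi * c) - sin y / (64 * pi * c) \<le> 1 / (8 * c)"
      by (simp add: diff_divide_distrib)
    have "(sin x - sin y) / (8 * pi * c) \<le> 2 / (8 * pi * c)"
      using d p assms by (intro divide_right_mono) auto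
    also have "\<dots> \<le> 1 / (8 * c)" using p assms by (simp add: field_simps)
    finally show "sin x / (8 * pi * c) - sin y / (8 * pi * c) \<le> 1 / (8 * c)"
      by (simp add: diff_divide_distrib)
  qed
  have c: "1 / (4 * c) = 1 / (8 * c) + 1 / (8 * c)" "0 < 1 / (8 * c)" using assms by (auto simp: field_simps)
  show ?thesis
    unfolding integral_unique[OF \<psi>_integral[OF assms]] c(1)
    using s(1)[of "2 * pi * (c * v)" "2 * pi * (c * u)"]
      s(2)[of "4 * pi * (c * u)" "4 * pi * (c * v)"] c(2) by argo
qed

definition \<psi>_sum :: "nat \<Rightarrow> real \<Rightarrow> real" where "\<psi>_sum N u = (\<Sum>j<N. \<psi> (3 ^ j * u))"

lemma \<psi>_continuous: "continuous_on A (\<lambda>t. \<psi> (c * t))"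
  unfolding \<psi>_def by (intro continuous_intros) auto

lemma \<psi>_sum_continuous: "continuous_on A (\<psi>_sum N)"
  unfolding \<psi>_sum_def[abs_def] by (intro continuous_intros \<psi>_continuous)

lemma \<psi>_sum_bound: "\<bar>\<psi>_sum N u\<bar> \<le> N"
proof -
  have "\<bar>\<psi>_sum N u\<bar> \<le> (\<Sum>j<N. \<bar>\<psi> (3 ^ j * u)\<bar>)" unfolding \<psi>_sum_def by (rule sum_abs)
  also have "\<dots> \<le> (\<Sum>j<N. 1)" by (rule sum_mono) (rule \<psi>_bound)
  finally show ?thesis by simp
qed

lemma \<psi>_sum_integral_le:
  assumes "u \<le> v"
  shows "integral {u..v} (\<psi>_sum N) \<le> 1 - N * (v - u) / 6144"
proof -
  have "integral {u..v} (\<psi>_sum N) = (\<Sum>j<N. integral {u..v} (\<lambda>t. \<psi> (3 ^ j * t)))"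
    unfolding \<psi>_sum_def[abs_def]
    by (rule integral_sum) (auto intro!: integrable_continuous_real \<psi>_continuous)
  also have "\<dots> \<le> (\<Sum>j<N. 1 / (4 * 3 ^ j) - (v - u) / 6144)"
    by (intro sum_mono \<psi>_integral_le assms) auto
  also have "\<dots> = (\<Sum>j<N. (1/3) ^ j) / 4 - N * (v - u) / 6144"
    by (simp add: sum_subtractf sum_divide_distrib power_divide mult.commute)
  also have "(\<Sum>j<N. (1/3::real) ^ j) \<le> 3/2"
    by (subst sum_gp_strict) simp
  finally show ?thesis by simp
qed

text \<open>
  With the exponent $1/N^2$ the argument of the exponential is at most $1/N$ in absolute value, so the
  quadratic term costs only $1/N^2$, the size of a constant change of the sum.
\<close>

lemma exp_\<psi>_sum_integral_le:
  assumes "1 \<le> N" "2 \<le> v - u"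
  shows "integral {u..v} (\<lambda>t. exp (\<psi>_sum N t / (real N)\<^sup>2))
    \<le> (v - u) * exp ((3/2 - N / 6144) / (real N)\<^sup>2)"
proof -
  let ?\<theta> = "1 / (real N)\<^sup>2"
  have e: "exp (\<psi>_sum N t / (real N)\<^sup>2) \<le> 1 + ?\<theta> + ?\<theta> * \<psi>_sum N t" for t
  proof -
    have "\<bar>\<psi>_sum N t\<bar> \<le> (real N)\<^sup>2"
      using \<psi>_sum_bound[of N t] self_le_power[of "real N" 2] assms by (auto intro: order_trans)
    then have "\<bar>\<psi>_sum N t / (real N)\<^sup>2\<bar> \<le> 1"
      using assms by (simp add: abs_divide)
    from exp_le_quadratic[OF this]
    have "exp (\<psi>_sum N t / (real N)\<^sup>2) \<le> 1 + ?\<theta> * \<psi>_sum N t + (\<psi>_sum N t / (real N)\<^sup>2)\<^sup>2" by simp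
    also have "(\<psi>_sum N t / (real N)\<^sup>2)\<^sup>2 \<le> (real N / (real N)\<^sup>2)\<^sup>2"
      using \<psi>_sum_bound[of N t] by (intro power2_le_iff_abs_le[THEN iffD2]) (auto simp: abs_divide divide_right_mono)
    also have "\<dots> = ?\<theta>" using assms by (simp add: power2_eq_square)
    finally show ?thesis by simp
  qed
  have "integral {u..v} (\<lambda>t. exp (\<psi>_sum N t / (real N)\<^sup>2))
      \<le> integral {u..v} (\<lambda>t. 1 + ?\<theta> + ?\<theta> * \<psi>_sum N t)"
    by (intro integral_le integrable_continuous_real continuous_intros \<psi>_sum_continuous e) (use assms in auto)
  also have "\<dots> = (v - u) * (1 + ?\<theta>) + ?\<theta> * integral {u..v} (\<psi>_sum N)"
    using assms by (subst integral_add)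
      (auto intro!: integrable_continuous_real continuous_intros \<psi>_sum_continuous)
  also have "\<dots> \<le> (v - u) * (1 + ?\<theta>) + ?\<theta> * (1 - N * (v - u) / 6144)"
    using assms by (intro add_left_mono mult_left_mono \<psi>_sum_integral_le) auto
  also have "\<dots> \<le> (v - u) * (1 + ?\<theta>) + ?\<theta> * ((v - u) / 2 - N * (v - u) / 6144)"
    using assms by (intro add_left_mono mult_left_mono) auto
  also have "\<dots> = (v - u) * (1 + (3/2 - N / 6144) / (real N)\<^sup>2)"
    using assms by (simp add: field_simps)
  also have "\<dots> \<le> (v - u) * exp ((3/2 - N / 6144) / (real N)\<^sup>2)"
    using assms by (intro mult_left_mono exp_ge_add_one_self) auto
  finally show ?thesis .
qed

section \<open>Contraction in the mean near the lower boundary\<close>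

context kan_perturbation
begin

definition \<delta> :: real where "\<delta> = 1 / (8 * real N * 2 ^ N)"

lemma N_pos: "1 \<le> N" by (simp add: drift_steps_def)

lemma N_large: "6144 * (V + 4) \<le> real N"
  using real_nat_ceiling_ge[of "6144 * (V + 4)"] unfolding drift_steps_def by linarith

lemma \<theta>_pos: "0 < \<theta>" using N_pos by (simp add: drift_exponent_def)

lemma \<delta>_pos: "0 < \<delta>" "\<delta> \<le> 1/8"
proof -
  show "0 < \<delta>" using N_pos by (simp add: \<delta>_def)
  have "1 * 1 \<le> real N * 2 ^ N" using N_pos by (intro mult_mono) auto
  then show "\<delta> \<le> 1/8" by (simp add: \<delta>_def field_simps)
qed

lemma step_error: "\<epsilon> * (1 + 3 ^ N) + 2 ^ N * \<delta> \<le> 1 / (4 * real N)"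
proof -
  have "\<epsilon> \<le> 1 / (8 * real N * (1 + 3 ^ N))"
    using \<epsilon>_le unfolding max_perturbation_def by (rule order_trans) (rule Min_le, auto)
  then have "\<epsilon> * (1 + 3 ^ N) \<le> 1 / (8 * real N * (1 + 3 ^ N)) * (1 + 3 ^ N)"
    by (intro mult_right_mono) auto
  also have "\<dots> = 1 / (8 * real N)"
  proof -
    have "(1 + 3 ^ N :: real) > 0" by (simp add: add_pos_pos)
    then show ?thesis using N_pos by (metis divide_divide_eq_left nonzero_eq_divide_eq order_less_irrefl)
  qed
  finally have "\<epsilon> * (1 + 3 ^ N) \<le> 1 / (8 * real N)" .
  moreover have "2 ^ N * \<delta> = 1 / (8 * real N)" by (simp add: \<delta>_def)
  moreover have "1 / (8 * real N) + 1 / (8 * real N) = 1 / (4 * real N)" using N_pos by (simp add: field_simps)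
  ultimately show ?thesis by linarith
qed

end

context kan_line
begin

lemma w_le_4: "\<bar>X n s - X n t\<bar> \<le> 4 \<Longrightarrow> w n s t \<le> 4"
  unfolding w_def using \<beta> powr_mono2[of \<beta> "\<bar>X n s - X n t\<bar>" 4] powr_mono[of \<beta> 1 "4::real"] by simp

lemma Z_comparable:
  assumes "\<bar>X n s - X n t\<bar> \<le> 4"
  shows "Z n t powr \<theta> \<le> exp (\<theta> * V) * Z n s powr \<theta>"
proof -
  have "20 / \<gamma> * w n s t \<le> 20 / \<gamma> * 4" using \<gamma>_pos w_le_4[OF assms] by (intro mult_left_mono) auto
  then have "ln (Z n t) - ln (Z n s) \<le> V"
    using Z_variation[OF assms] unfolding log_variation_def by argo
  then have "\<theta> * (ln (Z n t) - ln (Z n s)) \<le> \<theta> * V" using \<theta>_pos by (intro mult_left_mono) auto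
  then show ?thesis
    using Z_range[of n t] Z_range[of n s] by (simp add: powr_def algebra_simps flip: exp_add)
qed

lemma DX_comparable:
  assumes "\<bar>X n s - X n t\<bar> \<le> 4"
  shows "DX n t \<le> exp (\<theta> / 2) * DX n s"
proof -
  have "6 * \<epsilon> / \<gamma> * w n s t \<le> 6 * \<epsilon> / \<gamma> * 4" using \<gamma>_pos \<epsilon> w_le_4[OF assms] by (intro mult_left_mono) auto
  also have "\<dots> \<le> \<theta> / 2"
    using \<epsilon>_le \<gamma>_pos by (simp add: max_perturbation_def field_simps)
  finally have "ln (DX n t) \<le> \<theta> / 2 + ln (DX n s)" using distortion[OF assms] by argo
  then have "exp (ln (DX n t)) \<le> exp (\<theta> / 2 + ln (DX n s))" by simp
  then show ?thesis using DX_pos by (simp add: exp_add)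
qed

lemma length_comparable:
  assumes "u \<le> v" "X n v - X n u \<le> 4" "t \<in> {u..v}"
  shows "(v - u) * DX n t \<le> exp (\<theta> / 2) * (X n v - X n u)"
    and "X n v - X n u \<le> exp (\<theta> / 2) * ((v - u) * DX n t)"
proof -
  have "\<exists>\<xi>\<in>{u..v}. X n v - X n u = (v - u) * DX n \<xi>"
  proof (cases "u = v")
    case False
    then have "u < v" using assms by simp
    from MVT2[OF this, of "X n" "DX n"] X_deriv show ?thesis by (metis atLeastAtMost_iff less_imp_le)
  qed auto
  then obtain \<xi> where \<xi>: "\<xi> \<in> {u..v}" "X n v - X n u = (v - u) * DX n \<xi>" by blast
  have X4: "\<bar>X n \<xi> - X n t\<bar> \<le> 4" "\<bar>X n t - X n \<xi>\<bar> \<le> 4"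
    using X_le_iff[of n u \<xi>] X_le_iff[of n \<xi> v] X_le_iff[of n u t] X_le_iff[of n t v] \<xi>(1) assms
    by (auto simp: abs_le_iff)
  show "(v - u) * DX n t \<le> exp (\<theta> / 2) * (X n v - X n u)"
    using mult_left_mono[OF DX_comparable[OF X4(1)], of "v - u"] assms(1) by (simp add: \<xi>(2) mult.left_commute)
  show "X n v - X n u \<le> exp (\<theta> / 2) * ((v - u) * DX n t)"
    using mult_left_mono[OF DX_comparable[OF X4(2)], of "v - u"] assms(1) by (simp add: \<xi>(2) mult.left_commute)
qed

lemma proportion:
  assumes "u \<le> a" "a \<le> b" "b \<le> v" "X n v - X n u \<le> 4"
  shows "(X n b - X n a) * (v - u) \<le> exp \<theta> * (b - a) * (X n v - X n u)"
proof -
  have "X n b - X n a \<le> 4"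
    using X_le_iff[of n u a] X_le_iff[of n b v] assms by auto
  from length_comparable(2)[OF assms(2) this, of a] assms
  have 1: "X n b - X n a \<le> exp (\<theta> / 2) * ((b - a) * DX n a)" by simp
  have 2: "(v - u) * DX n a \<le> exp (\<theta> / 2) * (X n v - X n u)"
    using length_comparable(1)[of u v n a] assms by simp
  have "(X n b - X n a) * (v - u) \<le> exp (\<theta> / 2) * ((b - a) * DX n a) * (v - u)"
    using 1 assms by (intro mult_right_mono) auto
  also have "\<dots> = exp (\<theta> / 2) * (b - a) * ((v - u) * DX n a)" by simp
  also have "\<dots> \<le> exp (\<theta> / 2) * (b - a) * (exp (\<theta> / 2) * (X n v - X n u))"
    using 2 assms by (intro mult_left_mono) auto
  also have "\<dots> = exp \<theta> * (b - a) * (X n v - X n u)"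
    by (simp add: field_simps flip: exp_add)
  finally show ?thesis .
qed

text \<open>
  The integer is invisible to the cosine.  The error triples in each step, which is affordable because
  only boundedly many steps are taken.
\<close>

lemma X_shadow: "\<exists>q::int. \<bar>X (n + j) t - (3 ^ j * X n t + q)\<bar> \<le> \<epsilon> * (3 ^ j - 1)"
proof (induction j)
  case 0
  show ?case by (rule exI[of _ 0]) simp
next
  case (Suc j)
  then obtain q :: int where q: "\<bar>X (n + j) t - (3 ^ j * X n t + q)\<bar> \<le> \<epsilon> * (3 ^ j - 1)" by blast
  have "\<bar>X (n + Suc j) t - (3 * X (n + j) t + p)\<bar> \<le> \<epsilon>"
    using P_close[OF Z_in[of "n + j" t], of "X (n + j) t"] by (simp add: X_Suc)
  moreover have "3 ^ Suc j * X n t = 3 * (3 ^ j * X n t)" by simp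
  moreover have "\<epsilon> * (3 ^ Suc j - 1) = 3 * (\<epsilon> * (3 ^ j - 1)) + 2 * \<epsilon>" by (simp add: algebra_simps)
  ultimately have "\<bar>X (n + Suc j) t - (3 ^ Suc j * X n t + (3 * q + p))\<bar> \<le> \<epsilon> * (3 ^ Suc j - 1)"
    using q \<epsilon>(1) unfolding of_int_add of_int_mult of_int_numeral by argo
  then show ?case by (intro exI[of _ "3 * q + p"]) simp
qed

lemma Z_growth: "Z (n + j) t \<le> 2 ^ j * Z n t"
proof (induction j)
  case (Suc j)
  have "Z (n + Suc j) t \<le> 11/10 * Z (n + j) t"
    using Q_bounds(2)[OF Z_range[of "n + j" t], of "X (n + j) t"] by (simp add: Z_Suc)
  then show ?case using Suc Z_range[of "n + j" t] by simp
qed simp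

lemma cos_lipschitz: "\<bar>cos (2 * pi * x) - cos (2 * pi * y)\<bar> \<le> 7 * \<bar>x - y :: real\<bar>"
proof -
  have "\<bar>cos (2 * pi * x) - cos (2 * pi * y)\<bar> \<le> \<bar>2 * pi * x - 2 * pi * y\<bar>"
    using field_differentiable_bound[of UNIV cos "\<lambda>x. - sin x" 1 "2 * pi * x" "2 * pi * y"]
    by (simp add: DERIV_cos)
  also have "\<dots> = 2 * pi * \<bar>x - y\<bar>" by (simp add: abs_mult flip: right_diff_distrib)
  also have "\<dots> \<le> 7 * \<bar>x - y\<bar>" using pi_approx by (intro mult_right_mono) auto
  finally show ?thesis .
qed

text \<open>
  One step of the estimate $\ln Q(x, z) - \ln z \le \psi(3^j X_n) + $ error: the error collects the
  size of the perturbation, the deviation of the orbit from tripling, and the height $z$, which enters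
  through the factor $1 - z$.
\<close>

lemma log_step:
  assumes "Z n t \<le> \<delta>" "j < N"
  shows "ln (Z (n + Suc j) t) \<le> ln (Z (n + j) t) + \<psi> (3 ^ j * X n t) + 1 / (2 * real N)"
proof -
  define x z C where "x = X (n + j) t" and "z = Z (n + j) t" and "C = cos (2 * pi * (3 ^ j * X n t))"
  define y where "y = Q x z / z - 1"
  have z: "0 < z" "z < 1" unfolding z_def by (rule Z_range)+
  have "z \<le> 2 ^ j * Z n t" unfolding z_def by (rule Z_growth)
  also have "\<dots> \<le> 2 ^ N * \<delta>" using assms Z_range[of n t] by (intro mult_mono power_increasing) auto
  finally have z_le: "z \<le> 2 ^ N * \<delta>" .
  obtain q :: int where q: "\<bar>x - (3 ^ j * X n t + q)\<bar> \<le> \<epsilon> * (3 ^ j - 1)"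
    unfolding x_def using X_shadow by blast
  have x_le: "\<bar>x - (3 ^ j * X n t + q)\<bar> \<le> \<epsilon> * 3 ^ N"
  proof -
    note q
    also have "\<dots> \<le> \<epsilon> * 3 ^ N"
      using \<epsilon>(1) assms power_increasing[of j N "3::real"] by (intro mult_left_mono) linarith+
    finally show ?thesis .
  qed
  have "\<bar>Q x z - (z + cos (2 * pi * x) * (z * (1 - z) / 32))\<bar> \<le> \<epsilon> * z"
    by (rule order_trans[OF Q_close mult_left_mono]) (use z \<epsilon>(1) in auto)
  then have "\<bar>Q x z - (z + cos (2 * pi * x) * (z * (1 - z) / 32))\<bar> / z \<le> \<epsilon>"
    using z by (simp add: divide_le_eq)
  also have "\<bar>Q x z - (z + cos (2 * pi * x) * (z * (1 - z) / 32))\<bar> / z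
      = \<bar>(Q x z - (z + cos (2 * pi * x) * (z * (1 - z) / 32))) / z\<bar>" using z by (simp add: abs_divide)
  also have "(Q x z - (z + cos (2 * pi * x) * (z * (1 - z) / 32))) / z = y - cos (2 * pi * x) * (1 - z) / 32"
    using z by (simp add: y_def field_simps)
  finally have 1: "\<bar>y - cos (2 * pi * x) * (1 - z) / 32\<bar> \<le> \<epsilon>" .
  have 2: "\<bar>cos (2 * pi * x) * z\<bar> \<le> 1 * z"
    unfolding abs_mult using z by (intro mult_mono) auto
  have 3: "\<bar>cos (2 * pi * x) - C\<bar> \<le> 7 * (\<epsilon> * 3 ^ N)"
  proof -
    have "cos (2 * pi * (3 ^ j * X n t + q)) = C"
      unfolding C_def distrib_left by (simp add: cos_add)
    then show ?thesis using cos_lipschitz[of x "3 ^ j * X n t + q"] x_le by argo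
  qed
  have "0 \<le> \<epsilon> * 3 ^ N" using \<epsilon>(1) by simp
  moreover have "y - cos (2 * pi * x) * (1 - z) / 32
      = (y - C / 32) - (cos (2 * pi * x) - C) / 32 + cos (2 * pi * x) * z / 32"
    by (simp add: field_simps)
  ultimately have "\<bar>y - C / 32\<bar> \<le> \<epsilon> * (1 + 3 ^ N) + 2 ^ N * \<delta>"
    using 1 2 3 z_le z unfolding distrib_left by argo
  with step_error have h: "\<bar>y - C / 32\<bar> \<le> 1 / (4 * real N)" by linarith
  have N1: "1 / (4 * real N) \<le> 1/4" "0 < 1 / (4 * real N)" using N_pos by (auto simp: field_simps)
  have C1: "\<bar>C\<bar> \<le> 1" by (simp add: C_def)
  have y: "-1 < y" "y \<le> 1/2" using h N1 C1 by argo+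
  have "ln (Q x z) = ln z + ln (1 + y)"
  proof -
    have "Q x z = z * (1 + y)" using z by (simp add: y_def)
    then show ?thesis using z y by (simp add: ln_mult)
  qed
  moreover have "ln (1 + y) \<le> y - y\<^sup>2 / 3" by (rule ln_le_quadratic[OF y])
  moreover have "y - y\<^sup>2 / 3 \<le> C / 32 - C\<^sup>2 / 3072 + 1 / (2 * real N)"
  proof -
    define r where "r = y - C / 32"
    have r: "\<bar>r\<bar> \<le> 1 / (4 * real N)" using h by (simp add: r_def)
    have "\<bar>C * r\<bar> \<le> 1 * \<bar>r\<bar>" unfolding abs_mult by (rule mult_right_mono[OF C1]) simp
    moreover have "y - y\<^sup>2 / 3 = C / 32 - C\<^sup>2 / 3072 + r - C * r / 48 - r\<^sup>2 / 3"
      by (simp add: r_def power2_eq_square field_simps)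
    moreover have "1 / (2 * real N) = 2 * (1 / (4 * real N))" by simp
    moreover have "0 \<le> r\<^sup>2" by simp
    ultimately show ?thesis using r by argo
  qed
  moreover have "\<psi> (3 ^ j * X n t) = C / 32 - C\<^sup>2 / 3072" by (simp add: \<psi>_def C_def)
  moreover have "ln (Z (n + Suc j) t) = ln (Q x z)" by (simp add: Z_Suc x_def z_def)
  ultimately show ?thesis unfolding z_def by linarith
qed

lemma log_drift:
  assumes "Z n t \<le> \<delta>"
  shows "ln (Z (n + N) t) \<le> ln (Z n t) + \<psi>_sum N (X n t) + 1/2"
proof -
  have "ln (Z (n + j) t) \<le> ln (Z n t) + \<psi>_sum j (X n t) + j * (1 / (2 * real N))" if "j \<le> N" for j
    using that
  proof (induction j)
    case (Suc j)
    then show ?case using log_step[OF assms, of j] by (simp add: \<psi>_sum_def algebra_simps add_divide_distrib)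
  qed (simp add: \<psi>_sum_def)
  from this[of N] show ?thesis using N_pos by simp
qed

text \<open>
  Along a standard piece $z^\theta$ is comparable with its value at any reference point, so the ratio of
  its values at times $n + N$ and $n$ may be integrated separately.  By distortion this integral
  is nearly that of the exponential of \<open>\<theta> * \<psi>_sum N u\<close> over an interval, and $N$ was chosen such that
  its decay beats the oscillation.
\<close>

lemma drift:
  assumes "u \<le> v" "2 \<le> X n v - X n u" "X n v - X n u \<le> 4" "\<And>t. t \<in> {u..v} \<Longrightarrow> Z n t \<le> \<delta>"
  shows "integral {u..v} (\<lambda>t. Z (n + N) t powr \<theta>) \<le> exp (- \<theta>) * integral {u..v} (\<lambda>t. Z n t powr \<theta>)"
proof -
  let ?L = "X n v - X n u"
  let ?h = "\<lambda>u. exp (\<theta> * \<psi>_sum N u)"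
  have int: "(\<lambda>t. Z m t powr \<theta>) integrable_on {u..v}" for m
    using Z_range by (intro integrable_continuous_real continuous_on_powr' Z_cont continuous_intros)
      (auto simp: less_imp_le less_imp_neq[symmetric])
  have uv: "u < v" using assms(2) by (cases "u = v") (use assms(1) in auto)
  have hcont: "continuous_on A ?h" for A by (intro continuous_intros \<psi>_sum_continuous)
  define I where "I = integral {X n u..X n v} ?h"
  have I_le: "I \<le> ?L * exp (\<theta> * (3/2 - N / 6144))"
    using exp_\<psi>_sum_integral_le[OF N_pos assms(2)] by (simp add: I_def drift_exponent_def field_simps)
  have sub: "((\<lambda>t. ?h (X n t) * DX n t) has_integral I) {u..v}"
  proof -
    have "((\<lambda>t. DX n t *\<^sub>R ?h (X n t)) has_integral (integral {X n u..X n v} ?h - integral {X n v..X n u} ?h)) {u..v}"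
    proof (rule has_integral_substitution_general[of "{}" u v "X n" "X n u" "X n v"])
      show "X n ` {u..v} \<subseteq> {X n u..X n v}" by (auto simp: X_le_iff)
      show "(X n has_real_derivative DX n x) (at x within {u..v})" for x
        by (rule has_field_derivative_at_within[OF X_deriv])
    qed (use assms X_cont hcont in auto)
    moreover have "integral {X n v..X n u} ?h = 0" using assms by auto
    ultimately show ?thesis by (simp add: I_def mult.commute)
  qed
  have "integral {u..v} (\<lambda>t. ?h (X n t)) \<le> integral {u..v} (\<lambda>t. (v - u) * exp (\<theta> / 2) / ?L * (?h (X n t) * DX n t))"
  proof (rule integral_le)
    show "(\<lambda>t. ?h (X n t)) integrable_on {u..v}"
      by (intro integrable_continuous_real continuous_on_compose2[OF hcont[of UNIV] X_cont]) auto
    show "(\<lambda>t. (v - u) * exp (\<theta> / 2) / ?L * (?h (X n t) * DX n t)) integrable_on {u..v}"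
      using has_integral_mult_right[OF sub] by (rule has_integral_integrable)
    fix t assume "t \<in> {u..v}"
    from length_comparable(2)[OF assms(1,3) this]
    have "1 \<le> (v - u) * exp (\<theta> / 2) / ?L * DX n t" using assms(2) by (simp add: field_simps)
    then show "?h (X n t) \<le> (v - u) * exp (\<theta> / 2) / ?L * (?h (X n t) * DX n t)"
      using mult_left_mono[of 1 "(v - u) * exp (\<theta> / 2) / ?L * DX n t" "?h (X n t)"] by (simp add: mult_ac)
  qed
  also have "\<dots> = (v - u) * exp (\<theta> / 2) / ?L * I"
    using has_integral_mult_right[OF sub] by (rule integral_unique)
  also have "\<dots> \<le> (v - u) * exp (\<theta> / 2) / ?L * (?L * exp (\<theta> * (3/2 - N / 6144)))"
    using I_le assms by (intro mult_left_mono) auto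
  also have "\<dots> = (v - u) * exp (\<theta> / 2 + \<theta> * (3/2 - N / 6144))"
    using assms(2) by (simp add: exp_add)
  also have "\<dots> \<le> (v - u) * exp (\<theta> * (- V - 2))"
  proof -
    have "\<theta> * (3/2 - N / 6144) \<le> \<theta> * (3/2 - (V + 4))" using N_large \<theta>_pos by (intro mult_left_mono) auto
    also have "\<dots> = \<theta> * (- V - 2) - \<theta> / 2" by (simp add: algebra_simps)
    finally show ?thesis using assms by (intro mult_left_mono) auto
  qed
  finally have hX: "integral {u..v} (\<lambda>t. ?h (X n t)) \<le> (v - u) * exp (\<theta> * (- V - 2))" .
  \<comment> \<open>The reference point \<open>r\<close> is arbitrary; averaging over it replaces its value by the mean.\<close>
  have pt: "integral {u..v} (\<lambda>t. Z (n + N) t powr \<theta>) \<le> (v - u) * exp (- \<theta>) * Z n r powr \<theta>"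
    if r: "r \<in> {u..v}" for r
  proof -
    have "integral {u..v} (\<lambda>t. Z (n + N) t powr \<theta>)
        \<le> integral {u..v} (\<lambda>t. exp (\<theta> * V) * Z n r powr \<theta> * exp (\<theta> / 2) * ?h (X n t))"
    proof (intro integral_le int)
      show "(\<lambda>t. exp (\<theta> * V) * Z n r powr \<theta> * exp (\<theta> / 2) * ?h (X n t)) integrable_on {u..v}"
        by (intro integrable_continuous_real continuous_intros continuous_on_compose2[OF hcont[of UNIV] X_cont]) auto
      fix t assume t: "t \<in> {u..v}"
      have X4: "\<bar>X n r - X n t\<bar> \<le> 4"
        using X_le_iff[of n u r] X_le_iff[of n r v] X_le_iff[of n u t] X_le_iff[of n t v] t r assms
        by (auto simp: abs_le_iff)
      have "\<theta> * ln (Z (n + N) t) \<le> \<theta> * (ln (Z n t) + \<psi>_sum N (X n t) + 1/2)"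
        using log_drift[OF assms(4)[OF t]] \<theta>_pos by (intro mult_left_mono) auto
      then have "exp (\<theta> * ln (Z (n + N) t)) \<le> exp (\<theta> * ln (Z n t)) * (exp (\<theta> / 2) * ?h (X n t))"
        by (simp add: algebra_simps flip: exp_add)
      then have "Z (n + N) t powr \<theta> \<le> Z n t powr \<theta> * (exp (\<theta> / 2) * ?h (X n t))"
        using Z_range[of n t] Z_range[of "n + N" t] by (simp add: powr_def)
      also have "\<dots> \<le> (exp (\<theta> * V) * Z n r powr \<theta>) * (exp (\<theta> / 2) * ?h (X n t))"
        by (intro mult_right_mono Z_comparable X4) auto
      finally show "Z (n + N) t powr \<theta> \<le> exp (\<theta> * V) * Z n r powr \<theta> * exp (\<theta> / 2) * ?h (X n t)"
        by (simp add: mult.assoc)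
    qed
    also have "\<dots> = exp (\<theta> * V) * Z n r powr \<theta> * exp (\<theta> / 2) * integral {u..v} (\<lambda>t. ?h (X n t))"
      by (rule integral_mult_right)
    also have "\<dots> \<le> exp (\<theta> * V) * Z n r powr \<theta> * exp (\<theta> / 2) * ((v - u) * exp (\<theta> * (- V - 2)))"
      by (intro mult_left_mono hX) auto
    also have "\<dots> = Z n r powr \<theta> * (v - u) * exp (\<theta> * V + \<theta> / 2 + \<theta> * (- V - 2))"
      by (simp add: exp_add)
    also have "\<dots> \<le> Z n r powr \<theta> * (v - u) * exp (- \<theta>)"
      using \<theta>_pos assms(1) by (intro mult_left_mono mult_nonneg_nonneg) (auto simp: algebra_simps)
    finally show ?thesis by (simp add: mult_ac)
  qed
  have "(v - u) * integral {u..v} (\<lambda>t. Z (n + N) t powr \<theta>)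
      = integral {u..v} (\<lambda>r. integral {u..v} (\<lambda>t. Z (n + N) t powr \<theta>))"
    using assms(1) by simp
  also have "\<dots> \<le> integral {u..v} (\<lambda>r. (v - u) * exp (- \<theta>) * Z n r powr \<theta>)"
    by (intro integral_le pt integrable_on_mult_right int) auto
  also have "\<dots> = (v - u) * (exp (- \<theta>) * integral {u..v} (\<lambda>t. Z n t powr \<theta>))"
    by (simp add: integral_mult_right mult.assoc)
  finally show ?thesis using uv by simp
qed

end

section \<open>Trapping and steering\<close>

lemma cos_le_neg_half:
  fixes m :: int
  assumes "m + 1/3 \<le> x" "x \<le> m + 2/3"
  shows "cos (2 * pi * x) \<le> - 1/2"
proof -
  define y where "y = x - m - 1/2"
  have y: "\<bar>y\<bar> \<le> 1/6" using assms by (intro abs_leI) (simp_all add: y_def)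
  have "cos (2 * pi * x) = cos (2 * pi * of_int m + (2 * pi * y + pi))"
    by (rule arg_cong[where f = cos]) (simp add: y_def algebra_simps)
  also have "\<dots> = - cos (2 * pi * y)" by (simp add: cos_add cos_int_2pin sin_int_2pin)
  also have "cos (2 * pi * y) = cos \<bar>2 * pi * y\<bar>" by simp
  also have "- \<dots> \<le> - cos (pi / 3)"
  proof -
    have "2 * pi * \<bar>y\<bar> \<le> 2 * pi * (1/6)" using y by (intro mult_left_mono) auto
    then have "cos (pi / 3) \<le> cos \<bar>2 * pi * y\<bar>"
      by (intro cos_monotone_0_pi_le) (auto simp: abs_mult)
    then show ?thesis by simp
  qed
  finally show ?thesis by (simp add: cos_60)
qed

lemma sets_tendsto_borel:
  fixes f :: "nat \<Rightarrow> 'a \<Rightarrow> real"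
  assumes [measurable]: "\<And>k. f k \<in> borel_measurable M"
  shows "{x \<in> space M. (\<lambda>k. f k x) \<longlonglongrightarrow> c} \<in> sets M"
proof -
  have "(\<lambda>k. f k x) \<longlonglongrightarrow> c \<longleftrightarrow> (\<forall>m. \<exists>K. \<forall>k\<ge>K. \<bar>f k x - c\<bar> < inverse (real (Suc m)))" for x
  proof
    assume "(\<lambda>k. f k x) \<longlonglongrightarrow> c"
    from LIMSEQ_D[OF this] show "\<forall>m. \<exists>K. \<forall>k\<ge>K. \<bar>f k x - c\<bar> < inverse (real (Suc m))" by simp
  next
    assume *: "\<forall>m. \<exists>K. \<forall>k\<ge>K. \<bar>f k x - c\<bar> < inverse (real (Suc m))"
    show "(\<lambda>k. f k x) \<longlonglongrightarrow> c"
    proof (rule LIMSEQ_I)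
      fix r :: real assume "0 < r"
      then obtain m where m: "inverse (real (Suc m)) < r" using reals_Archimedean by blast
      from * obtain K where "\<forall>k\<ge>K. \<bar>f k x - c\<bar> < inverse (real (Suc m))" by blast
      with m show "\<exists>K. \<forall>k\<ge>K. norm (f k x - c) < r" unfolding real_norm_def by (meson less_trans)
    qed
  qed
  then have "{x \<in> space M. (\<lambda>k. f k x) \<longlonglongrightarrow> c}
      = {x \<in> space M. \<forall>m. \<exists>K. \<forall>k\<ge>K. \<bar>f k x - c\<bar> < inverse (real (Suc m))}" by simp
  also have "\<dots> \<in> sets M" by measurable
  finally show ?thesis .
qed

context kan_perturbation
begin

definition \<delta>\<^sub>0 :: real where "\<delta>\<^sub>0 = \<delta> * exp (- V - 1 / \<theta>)"

lemma \<delta>\<^sub>0_pos: "0 < \<delta>\<^sub>0" by (simp add: \<delta>\<^sub>0_def \<delta>_pos)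

text \<open>
  The odds $z / (1 - z)$ measure the distance to both circles at once: they contract wherever the
  cosine is at most $-1/2$, uniformly in $z$, including near $z = 1$.
\<close>

lemma odds_step:
  fixes m :: int
  assumes "m + 1/3 \<le> x" "x \<le> m + 2/3" "0 < z" "z < 1"
  shows "Q x z / (1 - Q x z) \<le> 99/100 * (z / (1 - z))"
proof -
  define C where "C = cos (2 * pi * x)"
  have C: "C \<le> - 1/2" using cos_le_neg_half[OF assms(1,2)] by (simp add: C_def)
  have "0 \<le> z * (1 - z)" using assms by simp
  then have 1: "C * (z * (1 - z)) \<le> - 1/2 * (z * (1 - z))" using C by (rule mult_right_mono[rotated])
  have q: "\<bar>Q x z - (z + C * (z * (1 - z) / 32))\<bar> \<le> \<epsilon> * min z (1 - z)"
    unfolding C_def by (rule Q_close) (use assms in auto)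
  have e: "\<epsilon> * min z (1 - z) \<le> 1/1000 * min z (1 - z)"
    using assms \<epsilon> by (intro mult_right_mono) auto
  define m' where "m' = \<epsilon> * min z (1 - z)"
  have e1: "m' \<le> z / 1000" "m' \<le> (1 - z) / 1000" using e by (auto simp: m'_def)
  have q': "Q x z \<le> z - z * (1 - z) / 64 + m'" "z + C * (z * (1 - z)) / 32 - m' \<le> Q x z"
    using q 1 unfolding m'_def[symmetric] by argo+
  have up: "Q x z \<le> z * (1 - (1 - z) / 64 + 1/1000)"
  proof -
    have "z * (1 - (1 - z) / 64 + 1/1000) = z - z * (1 - z) / 64 + z / 1000" by (simp add: field_simps)
    then show ?thesis using q'(1) e1(1) by argo
  qed
  have "z * (1 - z) / 64 - m' \<le> z - Q x z" using q'(1) by simp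
  then have lo: "(1 - z) * (1 + z / 64 - 1/1000) \<le> 1 - Q x z"
  proof -
    assume h: "z * (1 - z) / 64 - m' \<le> z - Q x z"
    have "(1 - z) * (1 + z / 64 - 1/1000) = 1 - z + z * (1 - z) / 64 - (1 - z) / 1000" by (simp add: field_simps)
    then show ?thesis using h e1(2) by argo
  qed
  have pos: "0 < (1 - z) * (1 + z / 64 - 1/1000)" using assms by (intro mult_pos_pos) auto
  have "Q x z / (1 - Q x z) \<le> (z * (1 - (1 - z) / 64 + 1/1000)) / ((1 - z) * (1 + z / 64 - 1/1000))"
    using up lo pos assms Q_bounds(1)[OF assms(3,4), of x] by (intro frac_le) auto
  also have "\<dots> = z / (1 - z) * ((1 - (1 - z) / 64 + 1/1000) / (1 + z / 64 - 1/1000))"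
    by simp
  also have "\<dots> \<le> z / (1 - z) * (99/100)"
  proof (rule mult_left_mono)
    have "1 - (1 - z) / 64 + 1/1000 \<le> 99/100 * (1 + z / 64 - 1/1000)"
      using assms(4) by (simp add: field_simps)
    moreover have "0 < 1 + z / 64 - 1/1000" using assms(3) by simp
    ultimately show "(1 - (1 - z) / 64 + 1/1000) / (1 + z / 64 - 1/1000) \<le> 99/100"
      by (simp only: pos_divide_le_eq)
  qed (use assms in auto)
  finally show ?thesis by (simp add: mult.commute)
qed

end

context kan_line
begin

lemma Z_powr_continuous: "continuous_on A (\<lambda>t. Z n t powr \<theta>)"
  using Z_range by (intro continuous_on_powr' Z_cont continuous_intros)
    (auto simp: less_imp_le less_imp_neq[symmetric])

lemma Z_measurable [measurable]: "Z n \<in> borel_measurable borel"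
  and X_measurable [measurable]: "X n \<in> borel_measurable borel"
  by (intro borel_measurable_continuous_onI Z_cont X_cont)+

lemma Int_interval_fmeasurable: "A \<in> sets borel \<Longrightarrow> A \<inter> {u..v::real} \<in> fmeasurable lborel"
  by (rule fmeasurableI2[of "{u..v}"]) (auto simp: fmeasurable_compact)

lemma length_Int_le: "A \<in> sets borel \<Longrightarrow> u \<le> v \<Longrightarrow> measure lborel (A \<inter> {u..v}) \<le> v - u" for u v :: real
  using measure_mono_fmeasurable[of "A \<inter> {u..v}" "{u..v}" lborel] by (auto simp: fmeasurable_compact)

text \<open>
  A long interval is a union of standard pieces, so estimates linear in an integral extend from
  standard pieces to all longer intervals.
\<close>

lemma split_intervals:
  assumes A: "A \<in> sets borel" and f: "continuous_on UNIV f"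
    and std: "\<And>u v. u \<le> v \<Longrightarrow> 2 \<le> X m v - X m u \<Longrightarrow> X m v - X m u \<le> 4 \<Longrightarrow>
      measure lborel (A \<inter> {u..v}) \<le> K * integral {u..v} f"
    and "u \<le> v" "2 \<le> X m v - X m u"
  shows "measure lborel (A \<inter> {u..v}) \<le> K * integral {u..v} f"
proof -
  have "measure lborel (A \<inter> {u..v}) \<le> K * integral {u..v} f"
    if "u \<le> v" "2 \<le> X m v - X m u" "X m v - X m u \<le> 2 * real k + 4" for k
    using that
  proof (induction k arbitrary: u)
    case (Suc k)
    show ?case
    proof (cases "X m v - X m u \<le> 4")
      case False
      obtain c where c: "X m c = X m u + 2" using X_surj by blast
      have uc: "u \<le> c" "c \<le> v" using X_le_iff[of m u c] X_le_iff[of m c v] c False by auto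
      have "A \<inter> {u..v} = (A \<inter> {u..c}) \<union> (A \<inter> {c..v})" using uc by auto
      then have "measure lborel (A \<inter> {u..v}) \<le> measure lborel (A \<inter> {u..c}) + measure lborel (A \<inter> {c..v})"
        using A by (simp add: measure_Un_le)
      also have "\<dots> \<le> K * integral {u..c} f + K * integral {c..v} f"
        using c uc False Suc.prems by (intro add_mono std Suc.IH) auto
      also have "\<dots> = K * integral {u..v} f"
        using Henstock_Kurzweil_Integration.integral_combine[OF uc, of f]
          integrable_continuous_real[OF continuous_on_subset[OF f]]
        by (simp flip: distrib_left)
      finally show ?thesis .
    qed (use std Suc.prems in auto)
  qed (use std in auto)
  moreover obtain k where "X m v - X m u \<le> real k" using real_arch_simple by blast
  then have "X m v - X m u \<le> 2 * real k + 4" by simp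
  ultimately show ?thesis using assms(4,5) by blast
qed

text \<open>
  The threshold decreases exponentially, so that points which never escape converge to $z = 0$.
\<close>

definition escape :: "nat \<Rightarrow> real \<Rightarrow> nat \<Rightarrow> real set" where
  "escape i \<eta> n = {t. \<exists>j\<le>i. \<eta> * exp (- real j) < Z (n + j * N) t}"

lemma escape_measurable [measurable]: "escape i \<eta> n \<in> sets borel"
  unfolding escape_def by measurable

text \<open>
  Induction on the time horizon.  If $z$ exceeds the threshold somewhere on the piece, it does so up to
  a constant everywhere and the bound is trivial.  Otherwise the piece is low, the drift
  gains $\exp(- \theta)$ in the integral, which is exactly what is lost by lowering the threshold
  to $\eta / e$ for the standard pieces $N$ steps later.
\<close>

lemma escape_bound:
  assumes "0 < \<eta>" "\<eta> \<le> \<delta>" "u \<le> v" "2 \<le> X n v - X n u" "X n v - X n u \<le> 4"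
  shows "measure lborel (escape i \<eta> n \<inter> {u..v})
    \<le> exp (\<theta> * V) / \<eta> powr \<theta> * integral {u..v} (\<lambda>t. Z n t powr \<theta>)"
  using assms
proof (induction i arbitrary: \<eta> n u v)
  have high: "measure lborel (escape i \<eta> n \<inter> {u..v})
      \<le> exp (\<theta> * V) / \<eta> powr \<theta> * integral {u..v} (\<lambda>t. Z n t powr \<theta>)"
    if "0 < \<eta>" "u \<le> v" "X n v - X n u \<le> 4" "r \<in> {u..v}" "\<eta> < Z n r" for i \<eta> n u v r
  proof -
    have "1 \<le> exp (\<theta> * V) / \<eta> powr \<theta> * Z n t powr \<theta>" if t: "t \<in> {u..v}" for t
    proof -
      have X4: "\<bar>X n t - X n r\<bar> \<le> 4"
        using X_le_iff[of n u r] X_le_iff[of n r v] X_le_iff[of n u t] X_le_iff[of n t v] t that \<open>r \<in> {u..v}\<close> \<open>X n v - X n u \<le> 4\<close>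
        by (auto simp: abs_le_iff)
      have "\<eta> powr \<theta> \<le> Z n r powr \<theta>"
        using \<theta>_pos \<open>0 < \<eta>\<close> \<open>\<eta> < Z n r\<close> by (intro powr_mono2) auto
      also have "\<dots> \<le> exp (\<theta> * V) * Z n t powr \<theta>" by (rule Z_comparable[OF X4])
      finally show ?thesis using \<open>0 < \<eta>\<close> by (simp add: field_simps)
    qed
    then have "integral {u..v} (\<lambda>t. 1) \<le> integral {u..v} (\<lambda>t. exp (\<theta> * V) / \<eta> powr \<theta> * Z n t powr \<theta>)"
      by (intro integral_le integrable_continuous_real continuous_on_mult_left Z_powr_continuous) auto
    then have "v - u \<le> exp (\<theta> * V) / \<eta> powr \<theta> * integral {u..v} (\<lambda>t. Z n t powr \<theta>)"
      using \<open>u \<le> v\<close> by simp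
    with length_Int_le[OF escape_measurable \<open>u \<le> v\<close>, of i \<eta> n] show ?thesis by linarith
  qed
  have nonneg: "0 \<le> integral {u..v} (\<lambda>t. Z n t powr \<theta>)" for u v n
    by (rule Henstock_Kurzweil_Integration.integral_nonneg)
       (auto intro: integrable_continuous_real Z_powr_continuous)
  {
    case (0 \<eta> n u v)
    show ?case
    proof (cases "\<exists>r\<in>{u..v}. \<eta> < Z n r")
      case True
      then show ?thesis using high 0 by blast
    next
      case False
      then have "escape 0 \<eta> n \<inter> {u..v} = {}" by (auto simp: escape_def)
      then show ?thesis using nonneg by simp
    qed
  next
    case (Suc i \<eta> n u v)
    show ?case
    proof (cases "\<exists>r\<in>{u..v}. \<eta> < Z n r")
      case True
      then show ?thesis using high Suc.prems by blast
    next
      case False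
      have "escape (Suc i) \<eta> n \<inter> {u..v} \<subseteq> escape i (\<eta> * exp (- 1)) (n + N) \<inter> {u..v}"
      proof (clarsimp simp: escape_def)
        fix t j assume t: "u \<le> t" "t \<le> v" "j \<le> Suc i" "\<eta> * exp (- real j) < Z (n + j * N) t"
        then have "j \<noteq> 0" using False by (intro notI) auto
        then obtain j' where "j = Suc j'" using not0_implies_Suc by blast
        then show "\<exists>j\<le>i. \<eta> * exp (- 1) * exp (- real j) < Z (n + N + j * N) t"
          using t by (intro exI[of _ j'] conjI) (simp_all add: mult.assoc add.assoc flip: exp_add)
      qed
      then have "measure lborel (escape (Suc i) \<eta> n \<inter> {u..v})
          \<le> measure lborel (escape i (\<eta> * exp (- 1)) (n + N) \<inter> {u..v})"
        by (rule measure_mono_fmeasurable) (simp_all add: Int_interval_fmeasurable)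
      also have "\<dots> \<le> exp (\<theta> * V) / (\<eta> * exp (- 1)) powr \<theta> * integral {u..v} (\<lambda>t. Z (n + N) t powr \<theta>)"
      proof (rule split_intervals[where m = "n + N"])
        have "1 * 2 \<le> (29/10)^N * (X n v - X n u)"
          using Suc.prems by (intro mult_mono) auto
        then show "2 \<le> X (n + N) v - X (n + N) u" using X_expand[OF Suc.prems(3), of N n] by linarith
        have "\<eta> * exp (- 1) \<le> \<eta>" using Suc.prems(1) by simp
        with Suc.prems(2) have "\<eta> * exp (- 1) \<le> \<delta>" by simp
        then show "measure lborel (escape i (\<eta> * exp (- 1)) (n + N) \<inter> {u..v})
            \<le> exp (\<theta> * V) / (\<eta> * exp (- 1)) powr \<theta> * integral {u..v} (\<lambda>t. Z (n + N) t powr \<theta>)"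
          if "u \<le> v" "2 \<le> X (n + N) v - X (n + N) u" "X (n + N) v - X (n + N) u \<le> 4" for u v
          using Suc.prems(1,2) that by (intro Suc.IH) auto
      qed (use Suc.prems Z_powr_continuous in auto)
      also have "\<dots> \<le> exp (\<theta> * V) / (\<eta> * exp (- 1)) powr \<theta> * (exp (- \<theta>) * integral {u..v} (\<lambda>t. Z n t powr \<theta>))"
        using False Suc.prems by (intro mult_left_mono drift) (auto simp: not_less intro: order_trans)
      also have "\<dots> = exp (\<theta> * V) / \<eta> powr \<theta> * integral {u..v} (\<lambda>t. Z n t powr \<theta>)"
        using Suc.prems(1) by (simp add: powr_mult) (simp add: powr_def field_simps flip: exp_add)
      finally show ?thesis .
    qed
  }
qed

lemma tendsto_0_if_never_escapes:
  assumes "\<And>i. t \<notin> escape i \<delta> n"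
  shows "(\<lambda>k. Z k t) \<longlonglongrightarrow> 0"
proof -
  have N: "0 < real N" using N_pos by simp
  have bound: "Z k t \<le> 2 ^ N * (\<delta> * exp (1 - (real k - real n) / real N))" if "n \<le> k" for k
  proof -
    define j r where "j = (k - n) div N" and "r = (k - n) mod N"
    have k: "k = n + j * N + r" using that by (simp add: j_def r_def)
    have r: "r < N" using N_pos by (simp add: r_def)
    have "Z k t \<le> 2 ^ r * Z (n + j * N) t" unfolding k by (rule Z_growth)
    also have "\<dots> \<le> 2 ^ N * (\<delta> * exp (- real j))"
      using assms[of j] r Z_range[of "n + j * N" t] by (intro mult_mono power_increasing) (auto simp: escape_def not_less)
    also have "\<dots> \<le> 2 ^ N * (\<delta> * exp (1 - (real k - real n) / real N))"
    proof -
      have "(real k - real n) / real N = real j + real r / real N" using N by (simp add: k field_simps)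
      moreover have "real r / real N \<le> 1" using r N by simp
      ultimately show ?thesis using \<delta>_pos by simp
    qed
    finally show ?thesis .
  qed
  have "(\<lambda>k. exp (1 + real n / real N) * exp (- 1 / real N) ^ k) \<longlonglongrightarrow> exp (1 + real n / real N) * 0"
    using N by (intro tendsto_intros LIMSEQ_realpow_zero) auto
  moreover have "exp (1 - (real k - real n) / real N) = exp (1 + real n / real N) * exp (- 1 / real N) ^ k" for k
    by (simp add: diff_divide_distrib flip: exp_of_nat_mult exp_add)
  ultimately have "(\<lambda>k. exp (1 - (real k - real n) / real N)) \<longlonglongrightarrow> 0" by simp
  then have "(\<lambda>k. 2 ^ N * (\<delta> * exp (1 - (real k - real n) / real N))) \<longlonglongrightarrow> 2 ^ N * (\<delta> * 0)"
    by (intro tendsto_intros)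
  then have lim: "(\<lambda>k. 2 ^ N * (\<delta> * exp (1 - (real k - real n) / real N))) \<longlonglongrightarrow> 0" by simp
  show ?thesis
  proof (rule tendsto_sandwich[OF _ _ tendsto_const lim])
    show "eventually (\<lambda>k. Z k t \<le> 2 ^ N * (\<delta> * exp (1 - (real k - real n) / real N))) sequentially"
      using bound by (auto simp: eventually_sequentially)
  qed auto
qed

definition lower :: "real set" where "lower = {t. (\<lambda>k. Z k t) \<longlonglongrightarrow> 0}"

lemma lower_measurable [measurable]: "lower \<in> sets borel"
  unfolding lower_def using sets_tendsto_borel[of Z borel 0] by simp

text \<open>
  Markov's inequality in the limit of an infinite time horizon: a piece below $\delta_0$ escapes with
  proportion at most $1/e$.
\<close>

lemma trapped:
  assumes "u \<le> v" "2 \<le> X n v - X n u" "X n v - X n u \<le> 4" "\<And>t. t \<in> {u..v} \<Longrightarrow> Z n t \<le> \<delta>\<^sub>0"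
  shows "(v - u) / 2 \<le> measure lborel (lower \<inter> {u..v})"
proof -
  let ?B = "exp (\<theta> * V) / \<delta> powr \<theta> * integral {u..v} (\<lambda>t. Z n t powr \<theta>)"
  have "?B \<le> exp (\<theta> * V) / \<delta> powr \<theta> * integral {u..v} (\<lambda>t. \<delta>\<^sub>0 powr \<theta>)"
    using assms \<theta>_pos Z_range
    by (intro mult_left_mono integral_le integrable_continuous_real Z_powr_continuous powr_mono2 continuous_intros)
       (auto simp: less_imp_le)
  also have "\<dots> = (v - u) * exp (- 1)"
    using assms(1) \<delta>_pos \<theta>_pos
    by (simp add: \<delta>\<^sub>0_def powr_mult) (simp add: powr_def algebra_simps flip: exp_add)
  also have "\<dots> \<le> (v - u) * (1/2)"
  proof -
    have "exp (1::real) \<ge> 2" using exp_ge_add_one_self[of 1] by simp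
    then have "exp (- 1 :: real) \<le> 1/2" by (simp add: exp_minus field_simps)
    then show ?thesis using assms(1) by (intro mult_left_mono) auto
  qed
  finally have B: "?B \<le> (v - u) / 2" by simp
  let ?E = "\<lambda>i. escape i \<delta> n \<inter> {u..v}"
  have "(\<lambda>i. measure lborel (?E i)) \<longlonglongrightarrow> measure lborel (\<Union>i. ?E i)"
  proof (rule Lim_measure_incseq)
    show "incseq ?E" by (rule incseq_SucI) (auto simp: escape_def intro: le_SucI)
    have "(\<Union>i. ?E i) = (\<Union>i. escape i \<delta> n) \<inter> {u..v}" by auto
    then show "emeasure lborel (\<Union>i. ?E i) \<noteq> \<infinity>"
      using Int_interval_fmeasurable[of "\<Union>i. escape i \<delta> n" u v] by (simp add: fmeasurable_def less_top)
  qed auto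
  then have E: "measure lborel (\<Union>i. ?E i) \<le> (v - u) / 2"
    by (rule LIMSEQ_le_const2) (use order_trans[OF escape_bound[OF \<delta>_pos(1) order_refl assms(1-3)] B] in blast)
  have "{u..v} = (\<Union>i. ?E i) \<union> (lower \<inter> {u..v})"
    using tendsto_0_if_never_escapes[of _ n] by (auto simp: lower_def)
  then have "v - u = measure lborel ((\<Union>i. ?E i) \<union> (lower \<inter> {u..v}))"
    using assms(1) by (metis measure_lborel_Icc)
  also have "\<dots> \<le> measure lborel (\<Union>i. ?E i) + measure lborel (lower \<inter> {u..v})"
    by (intro measure_Un_le) auto
  finally show ?thesis using E by argo
qed

text \<open>
  The interval between $m + 1/3$ and $m + 2/3$ is stretched over the corresponding interval around the
  image of its centre, so a nested sequence of segments follows the fixed point $1/2$ of tripling.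
\<close>

lemma steering_interval:
  assumes "u \<le> v" "2 \<le> X n v - X n u"
  shows "\<exists>a b. \<exists>m::int. u \<le> a \<and> a \<le> b \<and> b \<le> v \<and> X (n + k) a = m + 1/3 \<and> X (n + k) b = m + 2/3
    \<and> (\<forall>t\<in>{a..b}. Z (n + k) t / (1 - Z (n + k) t) \<le> (99/100)^k * (Z n t / (1 - Z n t)))"
proof (induction k)
  case 0
  define m where "m = \<lceil>X n u\<rceil>"
  obtain a where a: "X n a = m + 1/3" using X_surj by blast
  obtain b where b: "X n b = m + 2/3" using X_surj by blast
  have "X n u \<le> X n a" "X n a \<le> X n b" "X n b \<le> X n v"
    using assms a b unfolding m_def by linarith+
  then have "u \<le> a" "a \<le> b" "b \<le> v" by (simp_all add: X_le_iff)
  then show ?case using a b by (intro exI[of _ a] exI[of _ b] exI[of _ m]) auto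
next
  case (Suc k)
  then obtain a b and m :: int where IH: "u \<le> a" "a \<le> b" "b \<le> v" "X (n + k) a = m + 1/3" "X (n + k) b = m + 2/3"
    "\<And>t. t \<in> {a..b} \<Longrightarrow> Z (n + k) t / (1 - Z (n + k) t) \<le> (99/100)^k * (Z n t / (1 - Z n t))" by blast
  \<comment> \<open>The centre \<open>m + 1/2\<close> is mapped to \<open>3 * m + p + 3/2\<close>, up to \<open>\<epsilon>\<close>.\<close>
  obtain a' where a': "X (n + Suc k) a' = (3 * m + 1 + p) + 1/3" using X_surj by blast
  obtain b' where b': "X (n + Suc k) b' = (3 * m + 1 + p) + 2/3" using X_surj by blast
  have "\<bar>X (n + Suc k) a - (3 * m + 1 + p)\<bar> \<le> \<epsilon>" "\<bar>X (n + Suc k) b - (3 * m + 2 + p)\<bar> \<le> \<epsilon>"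
    using P_close[OF Z_in[of "n + k" a], of "X (n + k) a"] P_close[OF Z_in[of "n + k" b], of "X (n + k) b"]
    by (simp_all add: X_Suc IH(4,5))
  then have "X (n + Suc k) a \<le> X (n + Suc k) a'" "X (n + Suc k) a' \<le> X (n + Suc k) b'"
     "X (n + Suc k) b' \<le> X (n + Suc k) b"
    using a' b' \<epsilon> by (auto simp: abs_le_iff)
  then have ab: "a \<le> a'" "a' \<le> b'" "b' \<le> b" by (simp_all add: X_le_iff)
  have "Z (n + Suc k) t / (1 - Z (n + Suc k) t) \<le> (99/100)^Suc k * (Z n t / (1 - Z n t))" if t: "t \<in> {a'..b'}" for t
  proof -
    have t': "t \<in> {a..b}" using t ab by auto
    have "X (n + k) a \<le> X (n + k) t" "X (n + k) t \<le> X (n + k) b" using t' by (auto simp: X_le_iff)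
    then have "Z (n + Suc k) t / (1 - Z (n + Suc k) t) \<le> 99/100 * (Z (n + k) t / (1 - Z (n + k) t))"
      using odds_step[of m "X (n + k) t" "Z (n + k) t"] Z_range[of "n + k" t] by (simp add: IH(4,5) Z_Suc)
    also have "\<dots> \<le> 99/100 * ((99/100)^k * (Z n t / (1 - Z n t)))" by (intro mult_left_mono IH(6) t') auto
    finally show ?thesis by simp
  qed
  moreover have "X (n + Suc k) a' = (3 * m + 1 + p :: int) + 1/3" "X (n + Suc k) b' = (3 * m + 1 + p :: int) + 2/3"
    using a' b' by auto
  ultimately show ?case using IH(1,3) ab
    by (intro exI[of _ a'] exI[of _ b'] exI[of _ "3 * m + 1 + p"]) auto
qed

text \<open>
  The steering time depends on $d$ only.  Two further steps stretch the steered
  segment of length $1/3$ to a standard piece, half of which is trapped; bounded distortion compares the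
  segment with the original piece.
\<close>

lemma lower_proportion:
  assumes "0 < d"
  shows "\<exists>c>0. \<forall>n u v. u \<le> v \<longrightarrow> 2 \<le> X n v - X n u \<longrightarrow> X n v - X n u \<le> 4 \<longrightarrow>
    (\<forall>t\<in>{u..v}. Z n t \<le> 1 - d) \<longrightarrow> c * (v - u) \<le> measure lborel (lower \<inter> {u..v})"
proof -
  have "0 < d * \<delta>\<^sub>0 / 4" using assms \<delta>\<^sub>0_pos by simp
  from real_arch_pow_inv[OF this, of "99/100"]
  obtain k where k: "(99/100::real)^k < d * \<delta>\<^sub>0 / 4" by auto
  define c where "c = 1 / (24 * (31/10)^k * exp \<theta>)"
  have "c * (v - u) \<le> measure lborel (lower \<inter> {u..v})"
    if uv: "u \<le> v" "2 \<le> X n v - X n u" "X n v - X n u \<le> 4" and d: "\<And>t. t \<in> {u..v} \<Longrightarrow> Z n t \<le> 1 - d" for n u v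
  proof -
    obtain a b and m :: int where ab: "u \<le> a" "a \<le> b" "b \<le> v" "X (n + k) a = m + 1/3" "X (n + k) b = m + 2/3"
      "\<And>t. t \<in> {a..b} \<Longrightarrow> Z (n + k) t / (1 - Z (n + k) t) \<le> (99/100)^k * (Z n t / (1 - Z n t))"
      using steering_interval[OF uv(1,2), of k] by blast
    have len: "X (n + k) b - X (n + k) a = 1/3" using ab by simp
    have "(b - a) / 2 \<le> measure lborel (lower \<inter> {a..b})"
    proof (rule trapped[where n = "n + k + 2"])
      show "2 \<le> X (n + k + 2) b - X (n + k + 2) a" "X (n + k + 2) b - X (n + k + 2) a \<le> 4"
        using X_expand[OF ab(2), of 2 "n + k"] X_contract[OF ab(2), of "n + k" 2] len
        by (auto simp: power2_eq_square)
      fix t assume t: "t \<in> {a..b}"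
      have z: "0 < Z n t" "Z n t \<le> 1 - d" "0 < Z (n + k) t" "Z (n + k) t < 1"
        using d[of t] t ab Z_range by auto
      have "Z (n + k + 2) t \<le> 4 * Z (n + k) t" using Z_growth[of "n + k" 2 t] by simp
      also have "Z (n + k) t \<le> Z (n + k) t / (1 - Z (n + k) t)" using z by (simp add: field_simps)
      also have "\<dots> \<le> (99/100)^k * (Z n t / (1 - Z n t))" by (rule ab(6)[OF t])
      also have "\<dots> \<le> (99/100)^k * (1 / d)" using z assms by (intro mult_left_mono frac_le) auto
      also have "\<dots> \<le> d * \<delta>\<^sub>0 / 4 * (1 / d)" using k assms by (intro mult_right_mono) auto
      finally show "Z (n + k + 2) t \<le> \<delta>\<^sub>0" using assms by simp
    qed (rule ab(2))
    also have "\<dots> \<le> measure lborel (lower \<inter> {u..v})"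
      using ab by (intro measure_mono_fmeasurable Int_interval_fmeasurable) auto
    finally have 1: "(b - a) / 2 \<le> measure lborel (lower \<inter> {u..v})" .
    have "1/3 \<le> (31/10)^k * (X n b - X n a)" using X_contract[OF ab(2), of n k] len by simp
    then have "1/3 * (v - u) \<le> (31/10)^k * (X n b - X n a) * (v - u)" using uv by (intro mult_right_mono) auto
    also have "\<dots> \<le> (31/10)^k * (exp \<theta> * (b - a) * (X n v - X n u))"
      using proportion[OF ab(1-3) uv(3)] by (simp add: mult.assoc)
    also have "\<dots> \<le> (31/10)^k * (exp \<theta> * (b - a) * 4)"
      using uv ab by (intro mult_left_mono) auto
    finally have "c * (v - u) \<le> (b - a) / 2" by (simp add: c_def field_simps)
    with 1 show ?thesis by simp
  qed
  moreover have "0 < c" by (simp add: c_def)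
  ultimately show ?thesis by blast
qed

end

section \<open>Almost every point of a horizontal line\<close>

context kan_line
begin

lemma X_gap: "s \<le> t \<Longrightarrow> (29/10)^n * (t - s) \<le> X n t - X n s"
  using X_expand[of s t n 0] by simp

text \<open>
  A substitute for Lebesgue's density theorem adapted to the dynamics.  Enclose a bounded part of $E$ in an
  open set of almost the same measure.  The preimages under $X_n$ of the intervals $[2m, 2m + 2)$ that lie
  in it exhaust it as $n$ grows, and each meets $E$ in a proportion of at most $1 - c$.
\<close>

lemma null_if_never_dense:
  assumes E: "E \<in> sets borel" and c: "0 < c" "c \<le> 1"
    and sparse: "\<And>n u v. n0 \<le> n \<Longrightarrow> u \<le> v \<Longrightarrow> X n v - X n u = 2 \<Longrightarrow>
      measure lborel (E \<inter> {u..v}) \<le> (1 - c) * (v - u)"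
  shows "E \<in> null_sets lborel"
proof -
  have bounded: "measure lborel (E \<inter> {-M<..<M}) = 0" if M: "0 < M" for M :: real
  proof -
    define B where "B = E \<inter> {-M<..<M}"
    have B[measurable]: "B \<in> sets borel" using E by (simp add: B_def)
    have "c * measure lborel B \<le> 2 * e" if e: "0 < e" for e
    proof -
      obtain T0 where T0: "open T0" "B \<subseteq> T0" "emeasure lborel (T0 - B) < ennreal e"
        using outer_regular_lborel[OF B e] by blast
      define T where "T = T0 \<inter> {-M<..<M}"
      have T: "open T" "B \<subseteq> T" "T \<subseteq> {-M..M}" using T0 by (auto simp: T_def B_def)
      have T_sets[measurable]: "T \<in> sets borel" using T(1) by simp
      have fmT: "A \<in> fmeasurable lborel" if "A \<in> sets borel" "A \<subseteq> T" for A
        using that T(3) by (intro fmeasurableI2[OF fmeasurable_compact[of "{-M..M}"]]) simp_all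
      have "measure lborel T \<le> measure lborel B + measure lborel (T - B)"
        using measure_Un_le[of B lborel "T - B"] T(2) by (simp add: Un_absorb1)
      moreover have "measure lborel (T - B) \<le> e"
      proof -
        have "emeasure lborel (T - B) \<le> emeasure lborel (T0 - B)"
          using T0(1) by (intro emeasure_mono) (auto simp: T_def)
        also have "\<dots> \<le> ennreal e" using T0(3) by simp
        finally show ?thesis using e by (simp add: measure_def enn2real_leI)
      qed
      ultimately have T_le: "measure lborel T \<le> measure lborel B + e" by simp
      define A where "A n m = {t. 2 * of_int m \<le> X n t \<and> X n t < 2 * of_int m + 2}" for n and m :: int
      have A_sets[measurable]: "A n m \<in> sets borel" for n m unfolding A_def by measurable
      define S where "S n = {m. A n m \<subseteq> T}" for n
      define U where "U n = (\<Union>m\<in>S n. A n m)" for n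
      have A_eq: "\<exists>u v. u \<le> v \<and> X n v - X n u = 2 \<and> A n m = {u..<v}" for n m
      proof -
        obtain u where u: "X n u = 2 * of_int m" using X_surj by blast
        obtain v where v: "X n v = 2 * of_int m + 2" using X_surj by blast
        have "X n u \<le> X n v" using u v by simp
        then have "u \<le> v" by (simp add: X_le_iff)
        moreover have "A n m = {u..<v}"
        proof (rule set_eqI)
          fix t
          have "t \<in> A n m \<longleftrightarrow> X n u \<le> X n t \<and> X n t < X n v" by (simp add: A_def u v)
          then show "t \<in> A n m \<longleftrightarrow> t \<in> {u..<v}" by (simp add: X_le_iff X_less_iff)
        qed
        ultimately show ?thesis using u v by (intro exI[of _ u] exI[of _ v]) simp
      qed
      have finS: "finite (S n)" for n
      proof (rule finite_subset)
        show "S n \<subseteq> {\<lfloor>X n (-M) / 2\<rfloor> - 1..\<lceil>X n M / 2\<rceil>}"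
        proof
          fix m assume m: "m \<in> S n"
          obtain t where t: "X n t = 2 * of_int m" using X_surj by blast
          then have "t \<in> A n m" by (simp add: A_def)
          then have "t \<in> {-M..M}" using m T(3) by (auto simp: S_def)
          then have "X n (-M) \<le> 2 * of_int m" "2 * of_int m \<le> X n M" unfolding t[symmetric] by (auto simp: X_le_iff)
          then show "m \<in> {\<lfloor>X n (-M) / 2\<rfloor> - 1..\<lceil>X n M / 2\<rceil>}" by (simp add: field_simps) linarith
        qed
      qed simp
      have U_sets[measurable]: "U n \<in> sets borel" for n
        unfolding U_def using finS by (intro sets.finite_UN) auto
      have UT: "U n \<subseteq> T" for n by (auto simp: U_def S_def)
      have disj: "disjoint_family_on (A n) (S n)" for n
        unfolding disjoint_family_on_def
      proof (intro ballI impI)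
        fix m m' :: int assume "m \<noteq> m'"
        then have "m + 1 \<le> m' \<or> m' + 1 \<le> m" by linarith
        then have "real_of_int m + 1 \<le> real_of_int m' \<or> real_of_int m' + 1 \<le> real_of_int m" by linarith
        then show "A n m \<inter> A n m' = {}" by (auto simp: A_def)
      qed
      have BU: "measure lborel (B \<inter> U n) \<le> (1 - c) * measure lborel (U n)" if n: "n0 \<le> n" for n
      proof -
        have "B \<inter> U n = (\<Union>m\<in>S n. B \<inter> A n m)" by (auto simp: U_def)
        moreover have fin: "emeasure lborel (C \<inter> A n m) \<noteq> \<infinity>" if "m \<in> S n" "C \<in> sets borel" for m C
        proof -
          have "C \<inter> A n m \<subseteq> T" using that(1) by (auto simp: S_def)
          from fmT[OF _ this] that(2) show ?thesis by (simp add: fmeasurable_def less_top)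
        qed
        ultimately have "measure lborel (B \<inter> U n) = measure lborel (\<Union>m\<in>S n. B \<inter> A n m)" by simp
        also have "\<dots> = (\<Sum>m\<in>S n. measure lborel (B \<inter> A n m))"
          using disj[of n] fin[OF _ B] by (intro measure_finite_Union finS) (auto simp: disjoint_family_on_def)
        also have "\<dots> \<le> (\<Sum>m\<in>S n. (1 - c) * measure lborel (A n m))"
        proof (rule sum_mono)
          fix m assume "m \<in> S n"
          obtain u v where uv: "u \<le> v" "X n v - X n u = 2" "A n m = {u..<v}" using A_eq by blast
          have "measure lborel (B \<inter> A n m) \<le> measure lborel (E \<inter> {u..v})"
            using uv E by (intro measure_mono_fmeasurable Int_interval_fmeasurable) (auto simp: B_def)
          also have "\<dots> \<le> (1 - c) * (v - u)" by (rule sparse[OF n uv(1,2)])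
          finally show "measure lborel (B \<inter> A n m) \<le> (1 - c) * measure lborel (A n m)"
            using uv by simp
        qed
        also have "\<dots> = (1 - c) * measure lborel (U n)"
          unfolding U_def sum_distrib_left[symmetric]
          using fin[of _ UNIV] by (subst measure_finite_Union[OF finS _ disj]) auto
        finally show ?thesis .
      qed
      \<comment> \<open>The sets \<open>U n\<close> need not increase with \<open>n\<close>, but every point of \<open>T\<close> is in all late ones.\<close>
      define W where "W n = (\<Inter>k\<in>{n..}. U k)" for n
      have W_sets[measurable]: "W n \<in> sets borel" for n
        unfolding W_def by (intro sets.countable_INT'') auto
      have "(\<Union>n. W n) = T"
      proof (intro equalityI subsetI)
        fix t assume "t \<in> T"
        then obtain r where r: "0 < r" "ball t r \<subseteq> T" using T(1) open_contains_ball by blast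
        obtain K where K: "2 / r < (29/10::real)^K" using real_arch_pow[of "29/10"] by auto
        have "t \<in> U k" if k: "K \<le> k" for k
        proof -
          define m where "m = \<lfloor>X k t / 2\<rfloor>"
          have t: "t \<in> A k m" unfolding A_def m_def by (simp, linarith)
          have pw: "2 < (29/10)^k * r"
          proof -
            have "2 < (29/10)^K * r" using K r by (simp add: field_simps)
            also have "\<dots> \<le> (29/10)^k * r" using r k by (intro mult_right_mono power_increasing) auto
            finally show ?thesis .
          qed
          have "A k m \<subseteq> T"
          proof
            fix s assume s: "s \<in> A k m"
            have "\<bar>X k s - X k t\<bar> < 2" using s t by (auto simp: A_def)
            moreover have "(29/10)^k * \<bar>s - t\<bar> \<le> \<bar>X k s - X k t\<bar>"
              using X_gap[of s t k] X_gap[of t s k] X_le_iff[of k s t] X_le_iff[of k t s] by (cases "s \<le> t") auto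
            ultimately have "(29/10)^k * \<bar>s - t\<bar> < (29/10)^k * r" using pw by linarith
            then have "\<bar>s - t\<bar> < r" by simp
            then show "s \<in> T" using r by (auto simp: dist_real_def abs_minus_commute)
          qed
          then show ?thesis using t by (auto simp: U_def S_def)
        qed
        then show "t \<in> (\<Union>n. W n)" by (auto simp: W_def)
      qed (use UT in \<open>auto simp: W_def\<close>)
      moreover have "(\<lambda>n. measure lborel (W n)) \<longlonglongrightarrow> measure lborel (\<Union>n. W n)"
      proof (rule Lim_measure_incseq)
        show "incseq W" unfolding W_def by (intro incseq_SucI) auto
        show "emeasure lborel (\<Union>n. W n) \<noteq> \<infinity>"
          using fmT[of T] calculation by (auto simp: fmeasurable_def)
      qed auto
      ultimately have "eventually (\<lambda>n. measure lborel T - e < measure lborel (W n)) sequentially"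
        using e by (intro order_tendstoD) auto
      then obtain n where n: "n0 \<le> n" "measure lborel T - e < measure lborel (W n)"
        unfolding eventually_sequentially by (meson nle_le)
      have "measure lborel (W n) \<le> measure lborel (U n)"
        using UT by (intro measure_mono_fmeasurable fmT) (auto simp: W_def)
      then have UTn: "measure lborel T - e \<le> measure lborel (U n)" using n by simp
      have "measure lborel B \<le> measure lborel (B \<inter> U n) + measure lborel (T - U n)"
      proof -
        have "measure lborel B \<le> measure lborel ((B \<inter> U n) \<union> (T - U n))"
          using T(2) UT by (intro measure_mono_fmeasurable fmT) auto
        also have "\<dots> \<le> measure lborel (B \<inter> U n) + measure lborel (T - U n)" by (intro measure_Un_le) auto
        finally show ?thesis .
      qed
      also have "measure lborel (T - U n) = measure lborel T - measure lborel (U n)"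
        using UT fmT by (intro measurable_measure_Diff) auto
      also have "\<dots> \<le> e" using UTn by simp
      also have "measure lborel (B \<inter> U n) \<le> (1 - c) * measure lborel T"
      proof -
        have "measure lborel (U n) \<le> measure lborel T" using UT by (intro measure_mono_fmeasurable fmT) auto
        then have "(1 - c) * measure lborel (U n) \<le> (1 - c) * measure lborel T" using c by (intro mult_left_mono) auto
        with BU[OF n(1)] show ?thesis by linarith
      qed
      also have "(1 - c) * measure lborel T \<le> (1 - c) * (measure lborel B + e)"
        using T_le c by (intro mult_left_mono) auto
      finally have "measure lborel B \<le> (1 - c) * measure lborel B + (1 - c) * e + e" by (simp add: algebra_simps)
      moreover have "(1 - c) * e \<le> 1 * e" using c e by (intro mult_right_mono) auto
      ultimately show ?thesis by (simp add: algebra_simps)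
    qed
    then have "c * measure lborel B \<le> 0"
    proof -
      assume *: "\<And>e. 0 < e \<Longrightarrow> c * measure lborel B \<le> 2 * e"
      show ?thesis
      proof (rule field_le_epsilon)
        fix e :: real assume "0 < e"
        then show "c * measure lborel B \<le> 0 + e" using *[of "e / 2"] by simp
      qed
    qed
    then show ?thesis using c measure_nonneg[of lborel B] unfolding B_def
      by (simp add: mult_le_0_iff)
  qed
  have "E \<inter> {-M<..<M} \<in> null_sets lborel" if "0 < M" for M :: real
  proof (rule null_setsI)
    have "E \<inter> {-M<..<M} \<in> fmeasurable lborel"
      using E by (intro fmeasurableI2[OF fmeasurable_compact[of "{-M..M}"]]) auto
    then show "emeasure lborel (E \<inter> {-M<..<M}) = 0"
      using bounded[OF that] by (simp add: emeasure_eq_measure2)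
  qed (use E in auto)
  then have "(\<Union>M::nat. E \<inter> {- real (Suc M)<..<real (Suc M)}) \<in> null_sets lborel"
    by (intro null_sets_UN) (simp del: of_nat_Suc)
  moreover have "(\<Union>M::nat. E \<inter> {- real (Suc M)<..<real (Suc M)}) = E"
  proof -
    have "x \<in> (\<Union>M::nat. {- real (Suc M)<..<real (Suc M)})" for x :: real
    proof -
      obtain M :: nat where "\<bar>x\<bar> < real M" using reals_Archimedean2 by blast
      then have "x \<in> {- real (Suc M)<..<real (Suc M)}" by (auto simp: abs_less_iff)
      then show ?thesis by blast
    qed
    then show ?thesis by auto
  qed
  ultimately show ?thesis by simp
qed

text \<open>
  The image of a piece of length $2$ covers a whole fundamental interval, so by bounded distortion
  a fixed proportion of the piece is in the prescribed arc at that time.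
\<close>

lemma visits_infinitely_often:
  assumes "0 \<le> a" "a < b" "b \<le> 1"
  shows "AE t in lborel. \<exists>\<^sub>F j in sequentially. a < frac (X j t) \<and> frac (X j t) < b"
proof -
  define E where "E k = {t. \<forall>j\<ge>k. \<not> (a < frac (X j t) \<and> frac (X j t) < b)}" for k
  have E_sets: "E k \<in> sets borel" for k unfolding E_def frac_def by measurable
  define a' b' where "a' = (2 * a + b) / 3" and "b' = (a + 2 * b) / 3"
  have ab: "a < a'" "a' < b'" "b' < b" using assms by (auto simp: a'_def b'_def)
  define c where "c = (b' - a') / (2 * exp \<theta>)"
  have c: "0 < c" "c \<le> 1"
  proof -
    show "0 < c" using ab by (simp add: c_def)
    have "b' - a' \<le> 2 * exp \<theta>" using ab assms \<theta>_pos one_le_exp_iff[of \<theta>] by linarith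
    then show "c \<le> 1" by (simp add: c_def)
  qed
  have null: "E k \<in> null_sets lborel" for k
  proof (rule null_if_never_dense[OF E_sets c])
    fix n u v assume n: "k \<le> n" and uv: "u \<le> v" "X n v - X n u = 2"
    define m where "m = \<lceil>X n u\<rceil>"
    obtain s where s: "X n s = m + a'" using X_surj by blast
    obtain t where t: "X n t = m + b'" using X_surj by blast
    have "X n u \<le> X n s" "X n s \<le> X n t" "X n t \<le> X n v"
      using s t uv(2) ab assms unfolding m_def by linarith+
    then have st: "u \<le> s" "s \<le> t" "t \<le> v" by (simp_all add: X_le_iff)
    have "(b' - a') * (v - u) \<le> exp \<theta> * (t - s) * 2"
      using proportion[OF st, of n] uv s t by simp
    then have p: "c * (v - u) \<le> t - s" by (simp add: c_def field_simps)
    have "E k \<inter> {u..v} \<subseteq> {u..s} \<union> {t..v}"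
    proof
      fix r assume r: "r \<in> E k \<inter> {u..v}"
      have "\<not> (s < r \<and> r < t)"
      proof
        assume "s < r \<and> r < t"
        then have "m + a' < X n r" "X n r < m + b'" by (simp_all add: X_less_iff flip: s t)
        then have "frac (X n r) = X n r - m"
          using ab assms by (intro frac_unique_iff[THEN iffD2]) auto
        then have "a < frac (X n r)" "frac (X n r) < b"
          using \<open>m + a' < X n r\<close> \<open>X n r < m + b'\<close> ab by auto
        then show False using r n by (auto simp: E_def)
      qed
      then show "r \<in> {u..s} \<union> {t..v}" using r by auto
    qed
    then have "measure lborel (E k \<inter> {u..v}) \<le> measure lborel ({u..s} \<union> {t..v})"
      using E_sets by (intro measure_mono_fmeasurable fmeasurable.Un fmeasurable_compact) simp_all
    also have "\<dots> \<le> measure lborel {u..s} + measure lborel {t..v}" by (intro measure_Un_le) auto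
    also have "\<dots> = (v - u) - (t - s)" using st by simp
    also have "\<dots> \<le> (1 - c) * (v - u)" using p by (simp add: algebra_simps)
    finally show "measure lborel (E k \<inter> {u..v}) \<le> (1 - c) * (v - u)" .
  qed
  have "AE t in lborel. \<forall>k. t \<notin> E k"
    unfolding AE_all_countable using null by (auto intro: AE_not_in)
  then show ?thesis
    by eventually_elim (auto simp: E_def frequently_sequentially)
qed

lemma one_minus_Z: "(9/10)^n * (1 - z0) \<le> 1 - Z n t"
proof (induction n)
  case (Suc n)
  have "9/10 * (1 - Z n t) \<le> 1 - Z (Suc n) t"
    using Q_bounds(4)[OF Z_range[of n t], of "X n t"] by (simp add: Z_Suc)
  then show ?case using Suc by simp
qed simp

text \<open>
  Every interval contains standard pieces of late generations, and points do not reach $z = 1$ in finite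
  time, so steering applies with some margin.
\<close>

lemma lower_everywhere:
  assumes "s < t"
  shows "0 < measure lborel (lower \<inter> {s..t})"
proof -
  obtain n where n: "2 / (t - s) < (29/10::real)^n" using real_arch_pow[of "29/10"] by auto
  have "2 < (29/10)^n * (t - s)" using n assms by (simp only: pos_divide_less_eq diff_gt_0_iff_gt)
  then have "2 \<le> X n t - X n s" using X_gap[of s t n] assms by linarith
  obtain v where v: "X n v = X n s + 2" using X_surj by blast
  have "X n s < X n v" "X n v \<le> X n t" using v \<open>2 \<le> X n t - X n s\<close> by auto
  then have sv: "s < v" "v \<le> t" by (auto simp: X_le_iff X_less_iff)
  have d: "0 < (9/10)^n * (1 - z0)" using z0 by simp
  from lower_proportion[OF d] obtain c where c: "0 < c" "\<And>m u v. u \<le> v \<Longrightarrow> 2 \<le> X m v - X m u \<Longrightarrow>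
      X m v - X m u \<le> 4 \<Longrightarrow> (\<forall>t\<in>{u..v}. Z m t \<le> 1 - (9/10)^n * (1 - z0)) \<Longrightarrow>
      c * (v - u) \<le> measure lborel (lower \<inter> {u..v})"
    by blast
  have "0 < c * (v - s)" using c sv by simp
  also have "\<dots> \<le> measure lborel (lower \<inter> {s..v})"
    using one_minus_Z[of n] v sv by (intro c(2)) (auto simp: algebra_simps)
  also have "\<dots> \<le> measure lborel (lower \<inter> {s..t})"
    using sv by (intro measure_mono_fmeasurable Int_interval_fmeasurable) auto
  finally show ?thesis .
qed

end

section \<open>Exchanging the two boundary circles\<close>

context kan_perturbation
begin

text \<open>
  Conjugating by $(x, z) \mapsto (x + 1/2, 1 - z)$ leaves the form of the unperturbed map
  unchanged, since the cosine changes sign, except that $3 (x + 1/2) - 1/2$ exceeds $3 x$ by $1$.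
\<close>

lemma flip:
  "kan_perturbation (\<lambda>x z. P (x + 1/2) (1 - z) - 1/2) (\<lambda>x z. 1 - Q (x + 1/2) (1 - z))
    (\<lambda>x z. Px (x + 1/2) (1 - z)) (\<lambda>x z. - Pz (x + 1/2) (1 - z))
    (\<lambda>x z. - Qx (x + 1/2) (1 - z)) (\<lambda>x z. Qz (x + 1/2) (1 - z)) \<beta> \<epsilon> (p + 1)"
proof
  have x_shift: "((\<lambda>x. R (x + 1/2)) has_real_derivative D) (at x)"
    if "(R has_real_derivative D) (at (x + 1/2))" for R D and x :: real
    using that by (simp add: DERIV_shift)
  have z_flip: "((\<lambda>z. R (1 - z)) has_real_derivative - D) (at z within {0..1})"
    if "(R has_real_derivative D) (at (1 - z) within {0..1})" for R D and z :: real
  proof -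
    have "(R has_real_derivative D) (at (1 - z) within (\<lambda>z. 1 - z) ` {0..1})" using that by simp
    moreover have "((\<lambda>z. 1 - z) has_real_derivative -1) (at z within {0..1})"
      by (auto intro!: derivative_eq_intros)
    ultimately show ?thesis
      using DERIV_image_chain[of R D "\<lambda>z. 1 - z" z "{0..1}" "-1"] by (simp add: comp_def)
  qed
  have ang: "2 * pi * (x + 1/2) = 2 * pi * x + pi" for x by (simp add: algebra_simps)
  have shift: "\<bar>x + 1/2 - (x' + 1/2)\<bar> + \<bar>1 - z - (1 - z')\<bar> = \<bar>x - x'\<bar> + \<bar>z - z'\<bar>" for x x' z z' :: real
    by (simp add: abs_minus_commute)
  {
    fix x z :: real assume z: "z \<in> {0..1}"
    then have z': "1 - z \<in> {0..1}" by auto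
    show "((\<lambda>x. P (x + 1/2) (1 - z) - 1/2) has_real_derivative Px (x + 1/2) (1 - z)) (at x)"
      using DERIV_diff[OF x_shift[OF P_x[OF z']] DERIV_const] by simp
    show "((\<lambda>x. 1 - Q (x + 1/2) (1 - z)) has_real_derivative - Qx (x + 1/2) (1 - z)) (at x)"
      using DERIV_diff[OF DERIV_const x_shift[OF Q_x[OF z']]] by simp
    show "((\<lambda>z. P (x + 1/2) (1 - z) - 1/2) has_real_derivative - Pz (x + 1/2) (1 - z)) (at z within {0..1})"
      using DERIV_diff[OF z_flip[OF P_z[OF z']] DERIV_const] by simp
    show "((\<lambda>z. 1 - Q (x + 1/2) (1 - z)) has_real_derivative Qz (x + 1/2) (1 - z)) (at z within {0..1})"
      using DERIV_diff[OF DERIV_const z_flip[OF Q_z[OF z']]] by simp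
    show "\<bar>P (x + 1/2) (1 - z) - 1/2 - (3 * x + (p + 1))\<bar> \<le> \<epsilon>"
      using P_close[OF z', of "x + 1/2"] by (simp add: algebra_simps)
    show "\<bar>Px (x + 1/2) (1 - z) - 3\<bar> \<le> \<epsilon>" by (rule Px_close[OF z'])
    show "\<bar>- Pz (x + 1/2) (1 - z)\<bar> \<le> \<epsilon>" using Pz_close[OF z'] by simp
    have "- Qx (x + 1/2) (1 - z) + 2 * pi * sin (2 * pi * x) * (z * (1 - z) / 32)
      = - (Qx (x + 1/2) (1 - z) + 2 * pi * sin (2 * pi * (x + 1/2)) * ((1 - z) * (1 - (1 - z)) / 32))"
      unfolding ang by (simp add: mult.commute)
    then show "\<bar>- Qx (x + 1/2) (1 - z) + 2 * pi * sin (2 * pi * x) * (z * (1 - z) / 32)\<bar> \<le> \<epsilon>"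
      using Qx_close[OF z', of "x + 1/2"] by (simp only: abs_minus_cancel)
    have "cos (2 * pi * x) * ((1 - 2 * z) / 32) = cos (2 * pi * (x + 1/2)) * ((1 - 2 * (1 - z)) / 32)"
      unfolding ang by (simp add: algebra_simps diff_divide_distrib)
    then show "\<bar>Qz (x + 1/2) (1 - z) - (1 + cos (2 * pi * x) * ((1 - 2 * z) / 32))\<bar> \<le> \<epsilon>"
      using Qz_close[OF z', of "x + 1/2"] by (simp only:)
  next
    fix x z x' z' :: real assume "z \<in> {0..1}" "z' \<in> {0..1}"
    then have z: "1 - z \<in> {0..1}" "1 - z' \<in> {0..1}" by auto
    have minus: "\<bar>- r - - s\<bar> = \<bar>r - s\<bar>" for r s :: real by simp
    show "\<bar>Px (x + 1/2) (1 - z) - Px (x' + 1/2) (1 - z')\<bar> \<le> \<epsilon> * (\<bar>x - x'\<bar> + \<bar>z - z'\<bar>) powr \<beta>"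
      using Px_holder[OF z, of "x + 1/2" "x' + 1/2"] unfolding shift .
    show "\<bar>- Pz (x + 1/2) (1 - z) - - Pz (x' + 1/2) (1 - z')\<bar> \<le> \<epsilon> * (\<bar>x - x'\<bar> + \<bar>z - z'\<bar>) powr \<beta>"
      using Pz_holder[OF z, of "x + 1/2" "x' + 1/2"] unfolding shift minus .
    assume d: "\<bar>x - x'\<bar> + \<bar>z - z'\<bar> \<le> 8"
    show "\<bar>- Qx (x + 1/2) (1 - z) - - Qx (x' + 1/2) (1 - z')\<bar> \<le> 9 * (\<bar>x - x'\<bar> + \<bar>z - z'\<bar>) powr \<beta>"
      using Qx_holder[OF z, of "x + 1/2" "x' + 1/2"] d unfolding shift minus by simp
    show "\<bar>Qz (x + 1/2) (1 - z) - Qz (x' + 1/2) (1 - z')\<bar> \<le> 9 * (\<bar>x - x'\<bar> + \<bar>z - z'\<bar>) powr \<beta>"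
      using Qz_holder[OF z, of "x + 1/2" "x' + 1/2"] d unfolding shift by simp
  }
qed (use \<beta> \<epsilon>_pos \<epsilon>_le in \<open>simp_all add: Q_0 Q_1\<close>)

end

lemma measure_lborel_shift:
  fixes c u v :: real
  assumes "A \<in> sets borel"
  shows "measure lborel ({t. t + c \<in> A} \<inter> {u - c..v - c}) = measure lborel (A \<inter> {u..v})"
proof -
  have "emeasure lborel (A \<inter> {u..v}) = emeasure (distr lborel borel ((+) c)) (A \<inter> {u..v})"
    by (simp add: lborel_distr_plus)
  also have "\<dots> = emeasure lborel ((+) c -` (A \<inter> {u..v}) \<inter> space lborel)"
    using assms by (intro emeasure_distr) auto
  also have "(+) c -` (A \<inter> {u..v}) \<inter> space lborel = {t. t + c \<in> A} \<inter> {u - c..v - c}"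
    by (auto simp: add.commute)
  finally show ?thesis by (simp add: measure_def)
qed

context kan_line
begin

definition upper :: "real set" where "upper = {t. (\<lambda>k. Z k t) \<longlonglongrightarrow> 1}"

lemma upper_measurable [measurable]: "upper \<in> sets borel"
  unfolding upper_def using sets_tendsto_borel[of Z borel 1] by simp

interpretation flip: kan_line "\<lambda>x z. P (x + 1/2) (1 - z) - 1/2" "\<lambda>x z. 1 - Q (x + 1/2) (1 - z)"
    "\<lambda>x z. Px (x + 1/2) (1 - z)" "\<lambda>x z. - Pz (x + 1/2) (1 - z)"
    "\<lambda>x z. - Qx (x + 1/2) (1 - z)" "\<lambda>x z. Qz (x + 1/2) (1 - z)" \<beta> \<epsilon> "p + 1" "1 - z0"
  by (intro kan_line.intro flip) (unfold_locales, use z0 in auto)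

lemma flip_orbit: "flip.X n t = X n (t + 1/2) - 1/2 \<and> flip.Z n t = 1 - Z n (t + 1/2)"
  by (induction n) (simp_all add: flip.X_Suc flip.Z_Suc X_Suc Z_Suc)

lemma flip_lower: "flip.lower = {t. t + 1/2 \<in> upper}"
proof -
  have "(\<lambda>k. 1 - Z k t) \<longlonglongrightarrow> 0 \<longleftrightarrow> (\<lambda>k. Z k t) \<longlonglongrightarrow> 1" for t
    using tendsto_diff[OF tendsto_const[of 1], of "\<lambda>k. Z k t" 1 sequentially]
      tendsto_diff[OF tendsto_const[of 1], of "\<lambda>k. 1 - Z k t" 0 sequentially] by auto
  then show ?thesis by (simp add: flip.lower_def upper_def flip_orbit)
qed

lemma measure_flip_lower:
  "measure lborel (flip.lower \<inter> {u - 1/2..v - 1/2}) = measure lborel (upper \<inter> {u..v})"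
  unfolding flip_lower by (rule measure_lborel_shift) simp

lemma upper_proportion:
  assumes "0 < d"
  shows "\<exists>c>0. \<forall>n u v. u \<le> v \<longrightarrow> 2 \<le> X n v - X n u \<longrightarrow> X n v - X n u \<le> 4 \<longrightarrow>
    (\<forall>t\<in>{u..v}. d \<le> Z n t) \<longrightarrow> c * (v - u) \<le> measure lborel (upper \<inter> {u..v})"
proof -
  obtain c where c: "c > 0" "\<forall>n u v. u \<le> v \<longrightarrow> 2 \<le> flip.X n v - flip.X n u \<longrightarrow> flip.X n v - flip.X n u \<le> 4 \<longrightarrow>
    (\<forall>t\<in>{u..v}. flip.Z n t \<le> 1 - d) \<longrightarrow> c * (v - u) \<le> measure lborel (flip.lower \<inter> {u..v})"
    using flip.lower_proportion[OF assms] by blast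
  have "c * (v - u) \<le> measure lborel (upper \<inter> {u..v})"
    if "u \<le> v" "2 \<le> X n v - X n u" "X n v - X n u \<le> 4" "\<forall>t\<in>{u..v}. d \<le> Z n t" for n u v
  proof -
    have "c * ((v - 1/2) - (u - 1/2)) \<le> measure lborel (flip.lower \<inter> {u - 1/2..v - 1/2})"
      by (rule c(2)[rule_format]) (use that in \<open>auto simp: flip_orbit\<close>)
    then show ?thesis unfolding measure_flip_lower by simp
  qed
  with c(1) show ?thesis by blast
qed

lemma upper_everywhere:
  assumes "s < t"
  shows "0 < measure lborel (upper \<inter> {s..t})"
  using flip.lower_everywhere[of "s - 1/2" "t - 1/2"] assms unfolding measure_flip_lower by simp

text \<open>
  The slope bound makes $z$ vary by at most $1/4$ on a piece of length $2$, so each such piece stays at a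
  distance of at least $1/4$ from one of the two circles.
\<close>

theorem lower_or_upper: "AE t in lborel. t \<in> lower \<or> t \<in> upper"
proof -
  obtain c1 where c1: "c1 > 0" "\<forall>n u v. u \<le> v \<longrightarrow> 2 \<le> X n v - X n u \<longrightarrow> X n v - X n u \<le> 4 \<longrightarrow>
    (\<forall>t\<in>{u..v}. Z n t \<le> 1 - 1/4) \<longrightarrow> c1 * (v - u) \<le> measure lborel (lower \<inter> {u..v})"
    using lower_proportion[of "1/4"] by auto
  obtain c2 where c2: "c2 > 0" "\<forall>n u v. u \<le> v \<longrightarrow> 2 \<le> X n v - X n u \<longrightarrow> X n v - X n u \<le> 4 \<longrightarrow>
    (\<forall>t\<in>{u..v}. 1/4 \<le> Z n t) \<longrightarrow> c2 * (v - u) \<le> measure lborel (upper \<inter> {u..v})"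
    using upper_proportion[of "1/4"] by auto
  define c where "c = min 1 (min c1 c2)"
  have c: "0 < c" "c \<le> 1" "c \<le> c1" "c \<le> c2" using c1(1) c2(1) by (auto simp: c_def)
  have "- (lower \<union> upper) \<in> null_sets lborel"
  proof (rule null_if_never_dense[OF _ c(1,2)])
    fix n u v assume uv: "u \<le> v" "X n v - X n u = 2"
    have "c * (v - u) \<le> measure lborel ((lower \<union> upper) \<inter> {u..v})"
    proof (cases "\<forall>t\<in>{u..v}. Z n t \<le> 1 - 1/4")
      case True
      have "c * (v - u) \<le> c1 * (v - u)" using c uv by (intro mult_right_mono) auto
      also have "\<dots> \<le> measure lborel (lower \<inter> {u..v})" using uv True by (intro c1(2)[rule_format]) auto
      also have "\<dots> \<le> measure lborel ((lower \<union> upper) \<inter> {u..v})"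
        by (intro measure_mono_fmeasurable Int_interval_fmeasurable) auto
      finally show ?thesis .
    next
      case False
      then obtain s where s: "s \<in> {u..v}" "3/4 < Z n s" by auto
      have "1/4 \<le> Z n t" if t: "t \<in> {u..v}" for t
      proof -
        have "X n u \<le> X n t" "X n t \<le> X n v" "X n u \<le> X n s" "X n s \<le> X n v"
          using t s by (simp_all add: X_le_iff)
        then have "\<bar>X n t - X n s\<bar> \<le> 2" using uv(2) by (intro abs_leI) linarith+
        then show ?thesis using Z_lip[of n t s] s(2) by argo
      qed
      have "c * (v - u) \<le> c2 * (v - u)" using c uv by (intro mult_right_mono) auto
      also have "\<dots> \<le> measure lborel (upper \<inter> {u..v})" using uv \<open>\<And>t. t \<in> {u..v} \<Longrightarrow> 1/4 \<le> Z n t\<close> by (intro c2(2)[rule_format]) auto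
      also have "\<dots> \<le> measure lborel ((lower \<union> upper) \<inter> {u..v})"
        by (intro measure_mono_fmeasurable Int_interval_fmeasurable) auto
      finally show ?thesis .
    qed
    moreover have "measure lborel (- (lower \<union> upper) \<inter> {u..v}) = measure lborel {u..v} - measure lborel ((lower \<union> upper) \<inter> {u..v})"
    proof -
      have "- (lower \<union> upper) \<inter> {u..v} = {u..v} - (lower \<union> upper) \<inter> {u..v}" by auto
      then show ?thesis
        using measurable_measure_Diff[of "{u..v}" lborel "(lower \<union> upper) \<inter> {u..v}"] fmeasurable_compact[of "{u..v}"] by simp
    qed
    ultimately show "measure lborel (- (lower \<union> upper) \<inter> {u..v}) \<le> (1 - c) * (v - u)"
      using uv(1) by (simp add: algebra_simps)
  qed simp
  then have "AE t in lborel. t \<notin> - (lower \<union> upper)" by (rule AE_not_in)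
  then show ?thesis by eventually_elim auto
qed

end

section \<open>The circle, the annulus and limit sets\<close>

lemma to_circle_eq_iff: "to_circle x = to_circle y \<longleftrightarrow> x - y \<in> \<int>"
  by (rule circle.abs_eq_iff)

lemma to_circle_frac [simp]: "to_circle (frac x) = to_circle x"
  by (simp add: to_circle_eq_iff frac_def)

lemma continuous_to_circle: "continuous_on A to_circle"
  by (rule continuous_on_subset[OF _ subset_UNIV]) (simp add: continuous_on_open_vimage open_circle_def)

lemma continuous_covering: "continuous_on A covering"
  unfolding covering_def split_def
  by (intro continuous_on_Pair continuous_on_compose2[OF continuous_to_circle[of UNIV]] continuous_intros) auto

text \<open>
  The representative in $[0, 1)$ of a point of the circle.  It is not continuous, but it is Borel, which is
  enough to transport measurable sets from the plane to the annulus.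
\<close>

lift_definition angle :: "circle \<Rightarrow> real" is frac
proof -
  fix x y :: real
  assume "x - y \<in> \<int>"
  then obtain n where "x - y = of_int n" by (auto elim: Ints_cases)
  then have "x = y + of_int n" by simp
  then show "frac x = frac y" by (simp add: frac_def)
qed

lemma angle_range: "0 \<le> angle \<xi>" "angle \<xi> < 1"
  by (transfer, simp add: frac_lt_1)+

lemma to_circle_angle [simp]: "to_circle (angle \<xi>) = \<xi>"
proof -
  obtain x where x: "\<xi> = to_circle x" by (metis Quotient_abs_rep Quotient_circle)
  show ?thesis by (simp add: x angle.abs_eq)
qed

lemma angle_measurable [measurable]: "angle \<in> borel_measurable borel"
proof (rule borel_measurableI_greater)
  fix a :: real
  have "open {\<xi>. a < angle \<xi>}"
  proof (cases "a < 0")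
    case True
    then have "{\<xi>. a < angle \<xi>} = UNIV" using angle_range(1) by (auto intro: less_le_trans)
    then show ?thesis by simp
  next
    case False
    have "to_circle -` {\<xi>. a < angle \<xi>} = (\<Union>k::int. {k + a<..<k + 1})"
    proof (intro set_eqI iffI)
      fix x assume "x \<in> to_circle -` {\<xi>. a < angle \<xi>}"
      then have "a < frac x" by (simp add: angle.abs_eq)
      then have "x \<in> {real_of_int \<lfloor>x\<rfloor> + a<..<real_of_int \<lfloor>x\<rfloor> + 1}"
        using frac_lt_1[of x] by (simp add: frac_def)
      then show "x \<in> (\<Union>k::int. {k + a<..<k + 1})" by (intro UN_I[of "\<lfloor>x\<rfloor>"]) simp_all
    next
      fix x assume "x \<in> (\<Union>k::int. {k + a<..<k + 1})"
      then obtain k :: int where k: "k + a < x" "x < k + 1" by auto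
      then have "\<lfloor>x\<rfloor> = k" using False by linarith
      then have "a < frac x" using k by (simp add: frac_def)
      then show "x \<in> to_circle -` {\<xi>. a < angle \<xi>}" by (simp add: angle.abs_eq)
    qed
    moreover have "open (\<Union>k::int. {k + a<..<k + 1 :: real})"
      by (intro open_UN ballI open_greaterThanLessThan)
    ultimately show ?thesis unfolding open_circle_def by metis
  qed
  then show "{\<xi> \<in> space borel. a < angle \<xi>} \<in> sets borel" by simp
qed

definition unfold :: "circle \<times> real \<Rightarrow> real \<times> real" where
  "unfold q = (angle (fst q), snd q)"

lemma unfold_measurable: "unfold \<in> borel \<rightarrow>\<^sub>M borel"
proof -
  have [measurable]: "fst \<in> (borel :: (circle \<times> real) measure) \<rightarrow>\<^sub>M borel"
    "snd \<in> (borel :: (circle \<times> real) measure) \<rightarrow>\<^sub>M borel"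
    by (intro borel_measurable_continuous_onI continuous_intros)+
  show ?thesis unfolding unfold_def[abs_def]
    by (intro borel_measurable_Pair) measurable
qed

lemma covering_unfold: "covering (unfold q) = q"
  by (simp add: covering_def unfold_def)

definition fundamental_domain :: "(real \<times> real) set" where
  "fundamental_domain = {0..<1} \<times> {0..1}"

lemma fundamental_domain_borel: "fundamental_domain \<in> sets borel"
  unfolding fundamental_domain_def by (intro borel_Times) auto

lemma unfold_covering: "p \<in> fundamental_domain \<Longrightarrow> unfold (covering p) = p"
  by (auto simp: unfold_def covering_def fundamental_domain_def angle.abs_eq frac_eq)

definition annulus_borel :: "(circle \<times> real) measure" where
  "annulus_borel = distr (restrict_space lborel fundamental_domain) borel covering"

lemma annulus_lebesgue_eq: "annulus_lebesgue = completion annulus_borel"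
  by (simp add: annulus_lebesgue_def annulus_borel_def fundamental_domain_def)

lemma sets_annulus_borel [simp]: "sets annulus_borel = sets borel"
  by (simp add: annulus_borel_def)

lemma emeasure_annulus_borel:
  assumes "A \<in> sets borel"
  shows "emeasure annulus_borel A = emeasure lborel (covering -` A \<inter> fundamental_domain)"
proof -
  have c: "covering \<in> borel_measurable borel"
    by (intro borel_measurable_continuous_onI continuous_covering)
  then have "covering \<in> restrict_space lborel fundamental_domain \<rightarrow>\<^sub>M borel"
    by (intro measurable_restrict_space1) simp
  then have "emeasure annulus_borel A
      = emeasure (restrict_space lborel fundamental_domain) (covering -` A \<inter> fundamental_domain)"
    using assms by (simp add: annulus_borel_def emeasure_distr space_restrict_space)
  also have "\<dots> = emeasure lborel (covering -` A \<inter> fundamental_domain)"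
    using fundamental_domain_borel by (intro emeasure_restrict_space) auto
  finally show ?thesis .
qed

lemma emeasure_annulus_borel_unfold:
  assumes "E \<in> sets borel"
  shows "unfold -` E \<in> sets borel" "emeasure annulus_borel (unfold -` E) = emeasure lborel (E \<inter> fundamental_domain)"
proof -
  show 1: "unfold -` E \<in> sets borel"
    using measurable_sets[OF unfold_measurable assms] by simp
  have "covering -` (unfold -` E) \<inter> fundamental_domain = E \<inter> fundamental_domain"
    using unfold_covering by (intro set_eqI) (metis Int_iff vimage_eq)
  then show "emeasure annulus_borel (unfold -` E) = emeasure lborel (E \<inter> fundamental_domain)"
    using emeasure_annulus_borel[OF 1] by simp
qed

lemma compact_boundary_circle: "compact ((UNIV :: circle set) \<times> {c :: real})"
proof -
  have "(UNIV :: circle set) \<times> {c} = covering ` ({0..1} \<times> {c})"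
  proof (intro equalityI subsetI)
    fix q assume "q \<in> (UNIV :: circle set) \<times> {c}"
    then have "q = covering (angle (fst q), c)" by (auto simp: covering_def)
    moreover have "(angle (fst q), c) \<in> {0..1} \<times> {c}" using angle_range[of "fst q"] by simp
    ultimately show "q \<in> covering ` ({0..1} \<times> {c})" by blast
  qed (auto simp: covering_def)
  moreover have "compact (covering ` ({0..1} \<times> {c}))"
    by (intro compact_continuous_image continuous_covering compact_Times compact_Icc compact_sing)
  ultimately show ?thesis by simp
qed

lemma omega_limit_subset_circle:
  fixes g :: "circle \<times> real \<Rightarrow> circle \<times> real"
  assumes "(\<lambda>l. snd ((g ^^ l) q)) \<longlonglongrightarrow> c"
  shows "omega_limit g q \<subseteq> UNIV \<times> {c}"
proof
  fix y assume y: "y \<in> omega_limit g q"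
  have e: "\<bar>snd y - c\<bar> \<le> e" if "0 < e" for e
  proof -
    obtain k where k: "\<And>l. k \<le> l \<Longrightarrow> \<bar>snd ((g ^^ l) q) - c\<bar> < e"
      using LIMSEQ_D[OF assms \<open>0 < e\<close>] by auto
    have "closure (\<Union>l\<in>{k..}. {(g ^^ l) q}) \<subseteq> {p. \<bar>snd p - c\<bar> \<le> e}"
      by (intro closure_minimal closed_Collect_le continuous_intros) (use k in \<open>auto intro: less_imp_le\<close>)
    then show ?thesis using y by (auto simp: omega_limit_def)
  qed
  have "\<bar>snd y - c\<bar> \<le> 0" by (rule field_le_epsilon) (simp only: e add_0_left)
  then show "y \<in> UNIV \<times> {c}" by (cases y) auto
qed

text \<open>
  Density of the angles at late times alone suffices, since the heights converge.
\<close>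

lemma circle_subset_omega_limit:
  fixes g :: "circle \<times> real \<Rightarrow> circle \<times> real"
  assumes lim: "(\<lambda>l. snd ((g ^^ l) q)) \<longlonglongrightarrow> c"
    and dense: "\<And>a b k. 0 \<le> a \<Longrightarrow> a < b \<Longrightarrow> b \<le> 1 \<Longrightarrow> \<exists>l\<ge>k. angle (fst ((g ^^ l) q)) \<in> {real_of_rat a<..<real_of_rat b}"
  shows "UNIV \<times> {c} \<subseteq> omega_limit g q"
proof
  fix y :: "circle \<times> real" assume "y \<in> UNIV \<times> {c}"
  then obtain \<xi> where y: "y = (\<xi>, c)" by auto
  have "y \<in> closure (\<Union>l\<in>{k..}. {(g ^^ l) q})" (is "y \<in> closure ?O") for k
  proof (rule ccontr)
    assume "y \<notin> closure ?O"
    then have "y \<in> - closure ?O" by simp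
    then obtain A B where "open A" "open B" "y \<in> A \<times> B" and sub: "A \<times> B \<subseteq> - closure ?O"
      using open_prod_elim[OF open_Compl[OF closed_closure]] by metis
    then have AB: "open A" "open B" "\<xi> \<in> A" "c \<in> B" by (simp_all add: y)
    have "open (to_circle -` A)" using AB(1) by (simp add: open_circle_def)
    moreover have "angle \<xi> \<in> to_circle -` A" using AB(3) by simp
    ultimately obtain r where r: "0 < r" "ball (angle \<xi>) r \<subseteq> to_circle -` A"
      using open_contains_ball by blast
    define x where "x = angle \<xi>"
    have "x < min (x + r) 1" using r angle_range by (simp add: x_def)
    then obtain b where b: "x < real_of_rat b" "real_of_rat b < min (x + r) 1" using of_rat_dense[of x "min (x + r) 1"] by metis
    then obtain a where a: "x < real_of_rat a" "real_of_rat a < real_of_rat b"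
      using of_rat_dense[of x "real_of_rat b"] by metis
    have rat: "0 \<le> a" "a < b" "b \<le> 1"
    proof -
      have "0 < real_of_rat a" using a(1) angle_range(1)[of \<xi>] unfolding x_def by linarith
      then show "0 \<le> a" by simp
      show "a < b" using a by (simp add: of_rat_less)
      have "real_of_rat b < 1" using b(2) by linarith
      then show "b \<le> 1" by simp
    qed
    have "eventually (\<lambda>l. snd ((g ^^ l) q) \<in> B) sequentially"
      using topological_tendstoD[OF lim AB(2,4)] .
    then obtain K where K: "\<And>l. K \<le> l \<Longrightarrow> snd ((g ^^ l) q) \<in> B" by (auto simp: eventually_sequentially)
    obtain l where l: "max k K \<le> l" "angle (fst ((g ^^ l) q)) \<in> {real_of_rat a<..<real_of_rat b}"
      using dense[OF rat, of "max k K"] by blast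
    have "angle (fst ((g ^^ l) q)) \<in> ball (angle \<xi>) r"
      using l(2) a(1) b(2) unfolding x_def by (simp add: dist_real_def)
    then have "to_circle (angle (fst ((g ^^ l) q))) \<in> A" using r(2) by (meson subsetD vimage_eq)
    then have "fst ((g ^^ l) q) \<in> A" by simp
    then have "(g ^^ l) q \<in> A \<times> B" using K l(1) by (simp add: mem_Times_iff)
    then have "(g ^^ l) q \<notin> closure ?O" by (rule ComplD[OF subsetD[OF sub]])
    moreover have "(g ^^ l) q \<in> closure ?O"
      by (rule subsetD[OF closure_subset]) (use l(1) in auto)
    ultimately show False by (rule notE)
  qed
  then show "y \<in> omega_limit g q" unfolding omega_limit_def by (intro INT_I)
qed

section \<open>From horizontal lines to the strip\<close>

text \<open>
  Fubini's theorem in the two forms in which it transfers statements about single lines to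
  the plane.
\<close>

lemma null_if_null_on_horizontal_lines:
  fixes S :: "(real \<times> real) set"
  assumes S: "S \<in> sets borel" and null: "\<And>z. {x. (x, z) \<in> S} \<in> null_sets lborel"
  shows "S \<in> null_sets lborel"
proof (rule null_setsI)
  have "emeasure lborel S = emeasure (lborel \<Otimes>\<^sub>M lborel) S" by (simp only: lborel_prod)
  also have "\<dots> = (\<integral>\<^sup>+z. emeasure lborel ((\<lambda>x. (x, z)) -` S) \<partial>lborel)"
    using S by (intro lborel_pair.emeasure_pair_measure_alt2) (simp only: lborel_prod sets_lborel)
  also have "\<dots> = (\<integral>\<^sup>+z. 0 \<partial>(lborel :: real measure))"
    using null by (intro nn_integral_cong) (simp add: vimage_def null_setsD1)
  finally show "emeasure lborel S = 0" by simp
qed (use S in simp)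

lemma positive_if_horizontal_lines_positive:
  fixes S :: "(real \<times> real) set"
  assumes S: "S \<in> sets borel" and cd: "c < d"
    and pos: "\<And>z. c < z \<Longrightarrow> z < d \<Longrightarrow> 0 < emeasure lborel {x. (x, z) \<in> S}"
  shows "0 < emeasure lborel S"
proof (rule ccontr)
  assume "\<not> 0 < emeasure lborel S"
  then have "0 = emeasure (lborel \<Otimes>\<^sub>M lborel) S" by (simp add: lborel_prod)
  also have "\<dots> = (\<integral>\<^sup>+z. emeasure lborel ((\<lambda>x. (x, z)) -` S) \<partial>lborel)"
    using S by (intro lborel_pair.emeasure_pair_measure_alt2) (simp only: lborel_prod sets_lborel)
  finally have "(\<integral>\<^sup>+z. emeasure lborel ((\<lambda>x. (x, z)) -` S) \<partial>lborel) = 0" by simp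
  moreover have "(\<lambda>z. emeasure lborel ((\<lambda>x. (x, z)) -` S)) \<in> borel_measurable lborel"
    using S by (intro lborel_pair.measurable_emeasure_Pair2) (simp only: lborel_prod sets_lborel)
  ultimately have "AE z in lborel. emeasure lborel ((\<lambda>x. (x, z)) -` S) = 0"
    by (simp add: nn_integral_0_iff_AE)
  then have "AE z in lborel. z \<notin> {c<..<d}"
  proof eventually_elim
    case (elim z)
    then show ?case using pos[of z] by (auto simp: vimage_def)
  qed
  then have "{c<..<d} \<in> null_sets lborel" by (subst AE_iff_null_sets) auto
  then have "emeasure lborel {c<..<d} = 0" by (rule null_setsD1)
  then show False using cd by simp
qed

context kan_perturbation
begin

lemma G_continuous: "continuous_on (UNIV \<times> {0..1}) G"
proof -
  have PQ_cont: "continuous_on (UNIV \<times> {0..1}) (\<lambda>(x, z). R x z)"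
    if x: "\<And>x z. z \<in> {0..1} \<Longrightarrow> ((\<lambda>x. R x z) has_real_derivative Rx x z) (at x)"
      and z: "\<And>x z. z \<in> {0..1} \<Longrightarrow> (R x has_real_derivative Rz x z) (at z within {0..1})"
      and bx: "\<And>x z. z \<in> {0..1} \<Longrightarrow> \<bar>Rx x z\<bar> \<le> 4" and bz: "\<And>x z. z \<in> {0..1} \<Longrightarrow> \<bar>Rz x z\<bar> \<le> 4"
    for R Rx Rz
  proof (clarsimp simp: continuous_on_def)
    fix x z :: real assume xz: "0 \<le> z" "z \<le> 1"
    have lip: "\<bar>R x' z' - R x z\<bar> \<le> 4 * (\<bar>x' - x\<bar> + \<bar>z' - z\<bar>)" if "z' \<in> {0..1}" for x' z'
    proof -
      have "\<bar>R x' z' - R x z'\<bar> \<le> 4 * \<bar>x' - x\<bar>"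
        using field_differentiable_bound[of UNIV "\<lambda>x. R x z'" "\<lambda>x. Rx x z'" 4 x' x] x[OF that] bx[OF that] by simp
      moreover have "\<bar>R x z' - R x z\<bar> \<le> 4 * \<bar>z' - z\<bar>"
        using field_differentiable_bound[of "{0..1}" "R x" "Rz x" 4 z' z] z bz that xz by simp
      ultimately show ?thesis by argo
    qed
    let ?F = "at (x, z) within UNIV \<times> {0..1}"
    let ?d = "\<lambda>p. 4 * (\<bar>fst p - x\<bar> + \<bar>snd p - z\<bar>)"
    have "(?d \<longlongrightarrow> ?d (x, z)) ?F" by (intro tendsto_intros)
    then have d: "(?d \<longlongrightarrow> 0) ?F" by simp
    have "eventually (\<lambda>p. snd p \<in> {0..1}) ?F"
      by (auto simp: eventually_at_topological)
    then have "eventually (\<lambda>p. norm ((case p of (x, z) \<Rightarrow> R x z) - R x z) \<le> ?d p) ?F"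
    proof (rule eventually_mono)
      fix q :: "real \<times> real" assume "snd q \<in> {0..1}"
      then show "norm ((case q of (x, z) \<Rightarrow> R x z) - R x z) \<le> ?d q"
        using lip[of "snd q" "fst q"] by (simp add: split_def)
    qed
    then have "((\<lambda>p. (case p of (x, z) \<Rightarrow> R x z) - R x z) \<longlongrightarrow> 0) ?F"
      by (rule Lim_null_comparison) (rule d)
    then show "((\<lambda>(x, z). R x z) \<longlongrightarrow> R x z) ?F"
      by (rule Lim_transform[rotated]) simp_all
  qed
  have b: "\<bar>Px x z\<bar> \<le> 4" "\<bar>Pz x z\<bar> \<le> 4" "\<bar>Qx x z\<bar> \<le> 4" "\<bar>Qz x z\<bar> \<le> 4" if "z \<in> {0..1}" for x z
    using Px_close[OF that, of x] Pz_close[OF that, of x] Qx_bound[OF that, of x] Qz_bound[OF that, of x] \<epsilon> by argo+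
  have "continuous_on (UNIV \<times> {0..1}) (\<lambda>(x, z). P x z)" "continuous_on (UNIV \<times> {0..1}) (\<lambda>(x, z). Q x z)"
    by (rule PQ_cont[OF P_x P_z b(1,2)] PQ_cont[OF Q_x Q_z b(3,4)]; assumption)+
  from continuous_on_Pair[OF this] show ?thesis by (simp add: G_def split_def)
qed

lemma G_strip: "snd q \<in> {0..1} \<Longrightarrow> snd (G q) \<in> {0..1}"
  using Q_bounds(1,3)[of "snd q" "fst q"] Q_0[of "fst q"] Q_1[of "fst q"]
  by (cases "snd q = 0"; cases "snd q = 1") (auto simp: G_def split_def less_imp_le intro: order_trans)

lemma G_iterate_strip: "snd q \<in> {0..1} \<Longrightarrow> snd ((G ^^ n) q) \<in> {0..1}"
  by (induction n) (simp_all only: funpow.simps comp_apply id_apply G_strip)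

lemma G_iterate_continuous: "continuous_on (UNIV \<times> {0..1}) (G ^^ n)"
proof (induction n)
  case (Suc n)
  have "continuous_on (UNIV \<times> {0..1}) (\<lambda>q. G ((G ^^ n) q))"
    by (rule continuous_on_compose2[OF G_continuous Suc])
       (intro image_subsetI, simp only: mem_Times_iff UNIV_I G_iterate_strip simp_thms)
  then show ?case by (simp add: comp_def)
qed (simp add: continuous_on_id[unfolded id_def] id_def)

definition open_strip :: "(real \<times> real) set" where "open_strip = UNIV \<times> {0<..<1}"

lemma open_strip_borel: "open_strip \<in> sets borel"
  unfolding open_strip_def by (intro borel_open open_Times) auto

lemma G_iterate_measurable: "G ^^ n \<in> borel_measurable (restrict_space borel open_strip)"
  by (rule borel_measurable_continuous_on_restrict)
     (rule continuous_on_subset[OF G_iterate_continuous], auto simp: open_strip_def)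

definition tends_to :: "real \<Rightarrow> (real \<times> real) set" where
  "tends_to c = {q \<in> open_strip. (\<lambda>n. snd ((G ^^ n) q)) \<longlonglongrightarrow> c}"

text \<open>
  Points whose angles are dense at arbitrarily late times; rational endpoints keep the condition a
  countable one.
\<close>

definition recurrent :: "(real \<times> real) set" where
  "recurrent = {q \<in> open_strip. \<forall>(a::rat) b. 0 \<le> a \<longrightarrow> a < b \<longrightarrow> b \<le> 1 \<longrightarrow>
     (\<forall>k. \<exists>l\<ge>k. frac (fst ((G ^^ l) q)) \<in> {real_of_rat a<..<real_of_rat b})}"

lemma tends_to_borel: "tends_to c \<in> sets borel"
proof -
  have "{q \<in> space (restrict_space borel open_strip). (\<lambda>n. snd ((G ^^ n) q)) \<longlonglongrightarrow> c}
      \<in> sets (restrict_space borel open_strip)"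
    by (rule sets_tendsto_borel) (rule measurable_compose[OF G_iterate_measurable], simp add: borel_measurable_continuous_onI continuous_on_snd)
  then show ?thesis
    using open_strip_borel by (simp add: sets_restrict_space_iff space_restrict_space tends_to_def)
qed

lemma recurrent_borel: "recurrent \<in> sets borel"
proof -
  have [measurable]: "(\<lambda>q. fst ((G ^^ n) q)) \<in> borel_measurable (restrict_space borel open_strip)" for n
    by (rule measurable_compose[OF G_iterate_measurable]) (simp add: borel_measurable_continuous_onI continuous_on_fst)
  have "{q \<in> space (restrict_space borel open_strip). \<forall>(a::rat) b. 0 \<le> a \<longrightarrow> a < b \<longrightarrow> b \<le> 1 \<longrightarrow>
     (\<forall>k. \<exists>l\<ge>k. frac (fst ((G ^^ l) q)) \<in> {real_of_rat a<..<real_of_rat b})}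
      \<in> sets (restrict_space borel open_strip)"
    unfolding frac_def by measurable
  then have "recurrent \<in> sets (restrict_space borel open_strip)"
    by (simp only: recurrent_def space_restrict_space space_borel Int_UNIV_right)
  moreover have "open_strip \<inter> space borel \<in> sets borel" using open_strip_borel by simp
  ultimately show ?thesis by (simp only: sets_restrict_space_iff)
qed

lemma horizontal_line: "0 < z \<Longrightarrow> z < 1 \<Longrightarrow> kan_line P Q Px Pz Qx Qz \<beta> \<epsilon> p z"
  by unfold_locales

lemma typical_points: "open_strip - (tends_to 0 \<union> tends_to 1) \<inter> recurrent \<in> null_sets lborel"
proof (rule null_if_null_on_horizontal_lines)
  show "open_strip - (tends_to 0 \<union> tends_to 1) \<inter> recurrent \<in> sets borel"
    using open_strip_borel tends_to_borel recurrent_borel by (intro sets.Diff sets.Int sets.Un)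
  fix z :: real
  show "{x. (x, z) \<in> open_strip - (tends_to 0 \<union> tends_to 1) \<inter> recurrent} \<in> null_sets lborel"
  proof (cases "0 < z \<and> z < 1")
    case False
    then have "{x. (x, z) \<in> open_strip - (tends_to 0 \<union> tends_to 1) \<inter> recurrent} = {}"
      by (auto simp: open_strip_def)
    then show ?thesis by (simp only: null_sets.empty_sets)
  next
    case True
    interpret kan_line P Q Px Pz Qx Qz \<beta> \<epsilon> p z using True horizontal_line by blast
    have sets: "{x. (x, z) \<in> open_strip - (tends_to 0 \<union> tends_to 1) \<inter> recurrent} \<in> sets lborel"
    proof -
      have "(\<lambda>x. (x, z)) -` (open_strip - (tends_to 0 \<union> tends_to 1) \<inter> recurrent) \<inter> space borel \<in> sets borel"
        using open_strip_borel tends_to_borel recurrent_borel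
        by (intro measurable_sets[where A = borel]) (auto intro!: borel_measurable_continuous_onI continuous_intros)
      then show ?thesis by (simp add: vimage_def)
    qed
    have "AE x in lborel. \<forall>(a::rat) b. 0 \<le> a \<longrightarrow> a < b \<longrightarrow> b \<le> 1 \<longrightarrow>
       (\<exists>\<^sub>F j in sequentially. real_of_rat a < frac (X j x) \<and> frac (X j x) < real_of_rat b)"
      unfolding AE_all_countable
    proof (intro allI)
      fix a b :: rat
      show "AE x in lborel. 0 \<le> a \<longrightarrow> a < b \<longrightarrow> b \<le> 1 \<longrightarrow>
       (\<exists>\<^sub>F j in sequentially. real_of_rat a < frac (X j x) \<and> frac (X j x) < real_of_rat b)"
        using visits_infinitely_often[of "real_of_rat a" "real_of_rat b"]
        by (cases "0 \<le> a \<and> a < b \<and> b \<le> 1") (auto simp: of_rat_less)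
    qed
    with lower_or_upper have "AE x in lborel. x \<notin> {x. (x, z) \<in> open_strip - (tends_to 0 \<union> tends_to 1) \<inter> recurrent}"
    proof eventually_elim
      case (elim x)
      have strip: "(x, z) \<in> open_strip" using True by (simp add: open_strip_def)
      have "(x, z) \<in> tends_to 0 \<union> tends_to 1"
        using elim(1) strip by (simp add: tends_to_def lower_def upper_def Z_def)
      moreover have "(x, z) \<in> recurrent"
        using elim(2) strip by (simp add: recurrent_def frequently_sequentially X_def)
      ultimately show ?case by simp
    qed
    then show ?thesis by (simp only: AE_iff_null_sets[OF sets])
  qed
qed

lemma tends_to_everywhere:
  assumes "open W" "(x, z) \<in> W" "0 < z" "z < 1" "c \<in> {0, 1}"
  shows "0 < emeasure lborel (tends_to c \<inter> W)"
proof -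
  obtain A B where AB: "open A" "open B" "x \<in> A" "z \<in> B" "A \<times> B \<subseteq> W"
    by (rule open_prod_elim[OF assms(1,2)]) blast
  obtain r where r: "0 < r" "ball x r \<subseteq> A" using openE[OF AB(1,3)] by blast
  have "open (B \<inter> {0<..<1})" "z \<in> B \<inter> {0<..<1}" using AB assms by auto
  then obtain e where e: "0 < e" "ball z e \<subseteq> B \<inter> {0<..<1}" using openE by blast
  show ?thesis
  proof (rule positive_if_horizontal_lines_positive[of _ z "z + e"])
    show "tends_to c \<inter> W \<in> sets borel" using tends_to_borel assms(1) by auto
    fix y assume y: "z < y" "y < z + e"
    then have "y \<in> ball z e" by (simp add: dist_real_def)
    then have yB: "y \<in> B" "0 < y" "y < 1" using e by auto
    interpret kan_line P Q Px Pz Qx Qz \<beta> \<epsilon> p y using yB horizontal_line by blast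
    define S where "S = (if c = 0 then lower else upper)"
    have S: "S = {t. (t, y) \<in> tends_to c}"
      using assms(5) yB by (auto simp: S_def lower_def upper_def tends_to_def open_strip_def Z_def)
    have "0 < measure lborel (S \<inter> {x..x + r/2})"
      using lower_everywhere[of x "x + r/2"] upper_everywhere[of x "x + r/2"] r(1) by (simp add: S_def)
    then have "0 < emeasure lborel (S \<inter> {x..x + r/2})"
      unfolding measure_def zero_less_iff_neq_zero by (intro notI) simp
    also have "\<dots> \<le> emeasure lborel {t. (t, y) \<in> tends_to c \<inter> W}"
    proof (rule emeasure_mono)
      have "{x..x + r/2} \<subseteq> A" using r by (auto simp: subset_eq dist_real_def)
      then show "S \<inter> {x..x + r/2} \<subseteq> {t. (t, y) \<in> tends_to c \<inter> W}"
        using AB(5) yB(1) by (auto simp: S)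
      have "(\<lambda>t. (t, y)) -` (tends_to c \<inter> W) \<inter> space borel \<in> sets borel"
        using tends_to_borel assms(1)
        by (intro measurable_sets[where A = borel]) (auto intro!: borel_measurable_continuous_onI continuous_intros)
      then show "{t. (t, y) \<in> tends_to c \<inter> W} \<in> sets lborel" by (simp add: vimage_def)
    qed
    finally show "0 < emeasure lborel {t. (t, y) \<in> tends_to c \<inter> W}" .
  qed (use e in simp)
qed

end

section \<open>Basins in the annulus\<close>

locale kan_lift = kan_perturbation +
  fixes g :: "circle \<times> real \<Rightarrow> circle \<times> real"
  assumes covering_G: "\<And>q. q \<in> strip \<Longrightarrow> covering (G q) = g (covering q)"
begin

lemma iterate_covering: "q \<in> strip \<Longrightarrow> (g ^^ n) (covering q) = covering ((G ^^ n) q)"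
proof (induction n)
  case (Suc n)
  then have "(G ^^ n) q \<in> strip" using G_iterate_strip[of q n] by (simp add: strip_def mem_Times_iff)
  then show ?case using Suc covering_G by simp
qed simp

lemma open_strip_subset: "open_strip \<subseteq> strip"
  by (auto simp: open_strip_def strip_def)

lemma orbit:
  assumes "unfold q \<in> open_strip"
  shows "snd ((g ^^ n) q) = snd ((G ^^ n) (unfold q))"
    and "angle (fst ((g ^^ n) q)) = frac (fst ((G ^^ n) (unfold q)))"
proof -
  have "(g ^^ n) q = covering ((G ^^ n) (unfold q))"
    using iterate_covering[of "unfold q" n] assms open_strip_subset by (auto simp: covering_unfold)
  then show "snd ((g ^^ n) q) = snd ((G ^^ n) (unfold q))"
    and "angle (fst ((g ^^ n) q)) = frac (fst ((G ^^ n) (unfold q)))"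
    by (simp_all add: covering_def split_def angle.abs_eq)
qed

lemma omega_limit_subset:
  assumes "unfold q \<in> tends_to c"
  shows "omega_limit g q \<subseteq> UNIV \<times> {c}"
  using assms by (intro omega_limit_subset_circle) (simp add: tends_to_def orbit)

lemma omega_limit_eq:
  assumes "unfold q \<in> tends_to c \<inter> recurrent"
  shows "omega_limit g q = UNIV \<times> {c}"
proof
  show "omega_limit g q \<subseteq> UNIV \<times> {c}" using assms omega_limit_subset by simp
  have "unfold q \<in> open_strip" using assms by (simp add: tends_to_def)
  note o = orbit[OF this]
  show "UNIV \<times> {c} \<subseteq> omega_limit g q"
  proof (rule circle_subset_omega_limit)
    show "(\<lambda>l. snd ((g ^^ l) q)) \<longlonglongrightarrow> c" using assms by (simp add: tends_to_def o)
    fix a b :: rat and k :: nat assume "0 \<le> a" "a < b" "b \<le> 1"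
    then show "\<exists>l\<ge>k. angle (fst ((g ^^ l) q)) \<in> {real_of_rat a<..<real_of_rat b}"
      using assms unfolding o recurrent_def by blast
  qed
qed

definition atypical :: "(circle \<times> real) set" where
  "atypical = annulus - unfold -` ((tends_to 0 \<union> tends_to 1) \<inter> recurrent)"

lemma atypical_null: "atypical \<in> null_sets annulus_borel"
proof (rule null_setsI)
  let ?E = "UNIV \<times> {0..1} - (tends_to 0 \<union> tends_to 1) \<inter> recurrent"
  have E: "?E \<in> sets borel"
  proof (intro sets.Diff sets.Int sets.Un tends_to_borel recurrent_borel)
    show "UNIV \<times> {0..1} \<in> sets (borel :: (real \<times> real) measure)"
      by (intro borel_closed closed_Times) auto
  qed
  have eq: "atypical = unfold -` ?E"
    by (auto simp: atypical_def annulus_def unfold_def)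
  show "atypical \<in> sets annulus_borel"
    using emeasure_annulus_borel_unfold(1)[OF E] by (simp add: eq)
  have "emeasure lborel (UNIV \<times> {0, 1} :: (real \<times> real) set) = emeasure (lborel \<Otimes>\<^sub>M lborel) (UNIV \<times> {0, 1} :: (real \<times> real) set)"
    by (simp only: lborel_prod)
  also have "\<dots> = emeasure lborel (UNIV :: real set) * emeasure lborel {0, 1 :: real}"
    by (intro lborel.emeasure_pair_measure_Times) auto
  also have "emeasure lborel {0, 1 :: real} = 0" by (rule emeasure_lborel_countable) simp
  finally have "UNIV \<times> {0, 1} \<in> null_sets (lborel :: (real \<times> real) measure)"
    by (intro null_setsI) (auto intro!: borel_closed closed_Times)
  with typical_points have "(open_strip - (tends_to 0 \<union> tends_to 1) \<inter> recurrent) \<union> UNIV \<times> {0, 1} \<in> null_sets lborel"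
    by (rule null_sets.Un)
  moreover have "?E \<inter> fundamental_domain \<subseteq> (open_strip - (tends_to 0 \<union> tends_to 1) \<inter> recurrent) \<union> UNIV \<times> {0, 1}"
    by (auto simp: open_strip_def)
  ultimately have "?E \<inter> fundamental_domain \<in> null_sets lborel"
    using E fundamental_domain_borel by (intro null_sets_subset[of _ lborel "?E \<inter> fundamental_domain"]) auto
  then show "emeasure annulus_borel atypical = 0"
    using emeasure_annulus_borel_unfold(2)[OF E] by (simp add: eq null_setsD1)
qed

lemma basin_iff:
  assumes "q \<in> annulus - atypical" "c \<in> {0, 1}"
  shows "q \<in> basin annulus g (UNIV \<times> {c}) \<longleftrightarrow> unfold q \<in> tends_to c"
    and "omega_limit g q = UNIV \<times> {c} \<longleftrightarrow> unfold q \<in> tends_to c"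
proof -
  obtain c' where c': "c' \<in> {0, 1}" "unfold q \<in> tends_to c' \<inter> recurrent"
    using assms(1) by (auto simp: atypical_def)
  note w = omega_limit_eq[OF c'(2)]
  have "(UNIV :: circle set) \<times> {c'} \<subseteq> UNIV \<times> {c} \<longleftrightarrow> c' = c" by auto
  moreover have "unfold q \<in> tends_to c \<longleftrightarrow> c' = c"
    using c'(2) LIMSEQ_unique by (auto simp: tends_to_def)
  moreover have "(UNIV :: circle set) \<times> {c'} = UNIV \<times> {c} \<longleftrightarrow> c' = c" by auto
  ultimately show "q \<in> basin annulus g (UNIV \<times> {c}) \<longleftrightarrow> unfold q \<in> tends_to c"
    and "omega_limit g q = UNIV \<times> {c} \<longleftrightarrow> unfold q \<in> tends_to c"
    using assms(1) by (simp_all add: basin_def w)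
qed

text \<open>
  Basins and sets of prescribed limit set are identified only up to a null set with Borel sets; completeness
  of the measure makes them measurable.
\<close>

lemma sets_annulus_lebesgue_if_borel_up_to_null:
  assumes S: "S \<in> sets borel" and eq: "T - atypical = S - atypical"
  shows "T \<in> sets annulus_lebesgue" "emeasure annulus_borel S \<le> emeasure annulus_lebesgue T"
proof -
  have at: "atypical \<in> sets annulus_borel" using atypical_null by auto
  have "S - atypical \<in> sets annulus_lebesgue"
    using S at by (auto simp: annulus_lebesgue_eq intro: sets_completionI_sets)
  moreover have "T \<inter> atypical \<in> sets annulus_lebesgue"
    unfolding annulus_lebesgue_eq by (rule sets_completionI_sub[OF atypical_null]) auto
  moreover have "T = (S - atypical) \<union> (T \<inter> atypical)" using eq by auto
  ultimately show T: "T \<in> sets annulus_lebesgue" by (metis sets.Un)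
  have "emeasure annulus_borel S = emeasure annulus_borel (S - atypical)"
    using S atypical_null by (simp add: emeasure_Diff_null_set)
  also have "\<dots> = emeasure annulus_lebesgue (S - atypical)"
    using S at by (simp add: annulus_lebesgue_eq)
  also have "\<dots> \<le> emeasure annulus_lebesgue T" using T eq by (intro emeasure_mono) auto
  finally show "emeasure annulus_borel S \<le> emeasure annulus_lebesgue T" .
qed

lemma basin_positive:
  assumes U: "open U" and q: "q \<in> U" "unfold q \<in> open_strip" and c: "c \<in> {0, 1}"
  shows "0 < emeasure annulus_borel (U \<inter> unfold -` tends_to c)"
proof -
  have U_sets: "U \<in> sets borel" using U by simp
  have open_U: "open (covering -` U)"
    using continuous_covering[of UNIV] U by (simp add: continuous_on_open_vimage)
  define W where "W = covering -` U \<inter> {0<..<1} \<times> UNIV"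
  have W: "open W" unfolding W_def by (intro open_Int open_U open_Times) auto
  obtain x z where xz: "unfold q = (x, z)" by (cases "unfold q")
  have x: "0 \<le> x" "x < 1" and z: "0 < z" "z < 1"
    using xz q(2) angle_range[of "fst q"] by (auto simp: unfold_def open_strip_def)
  have "(x, z) \<in> covering -` U" using q(1) by (simp add: covering_unfold flip: xz)
  then obtain A B where AB: "open A" "x \<in> A" "z \<in> B" "A \<times> B \<subseteq> covering -` U"
    by (rule open_prod_elim[OF open_U]) blast
  obtain r where r: "0 < r" "ball x r \<subseteq> A" using openE[OF AB(1,2)] by blast
  define y where "y = x + min r (1 - x) / 2"
  have "0 < min r (1 - x)" "min r (1 - x) \<le> 1 - x" "min r (1 - x) \<le> r" using r(1) x by auto
  then have y: "0 < y" "y < 1" "y \<in> ball x r"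
    using x by (simp_all only: y_def mem_ball dist_real_def) argo+
  then have y: "0 < y" "y < 1" "y \<in> A" using r(2) by auto
  then have "(y, z) \<in> W" using AB by (auto simp: W_def)
  from tends_to_everywhere[OF W this z c]
  have "0 < emeasure lborel (tends_to c \<inter> W)" .
  also have "\<dots> \<le> emeasure lborel (covering -` (U \<inter> unfold -` tends_to c) \<inter> fundamental_domain)"
  proof (rule emeasure_mono)
    show "tends_to c \<inter> W \<subseteq> covering -` (U \<inter> unfold -` tends_to c) \<inter> fundamental_domain"
    proof
      fix s assume s: "s \<in> tends_to c \<inter> W"
      then have fd: "s \<in> fundamental_domain"
        by (auto simp: W_def tends_to_def open_strip_def fundamental_domain_def)
      then show "s \<in> covering -` (U \<inter> unfold -` tends_to c) \<inter> fundamental_domain"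
        using s unfold_covering[OF fd] by (auto simp: W_def)
    qed
    have "covering \<in> borel_measurable borel"
      by (intro borel_measurable_continuous_onI continuous_covering)
    from measurable_sets[OF this, of "U \<inter> unfold -` tends_to c"]
    show "covering -` (U \<inter> unfold -` tends_to c) \<inter> fundamental_domain \<in> sets lborel"
      using U_sets emeasure_annulus_borel_unfold(1)[OF tends_to_borel[of c]] fundamental_domain_borel by simp
  qed
  also have "\<dots> = emeasure annulus_borel (U \<inter> unfold -` tends_to c)"
    using U_sets emeasure_annulus_borel_unfold(1)[OF tends_to_borel[of c]]
    by (intro emeasure_annulus_borel[symmetric]) auto
  finally show ?thesis .
qed

lemma unfold_tends_to_annulus: "unfold q \<in> tends_to c \<Longrightarrow> q \<in> annulus"
  by (cases q) (auto simp: tends_to_def open_strip_def unfold_def annulus_def)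

lemma emeasure_basin_pos:
  assumes "open U" "q \<in> U" "unfold q \<in> open_strip" "c \<in> {0, 1}"
  shows "0 < emeasure annulus_lebesgue (U \<inter> basin annulus g (UNIV \<times> {c}))"
proof -
  have "0 < emeasure annulus_borel (U \<inter> unfold -` tends_to c)" by (rule basin_positive[OF assms])
  also have "\<dots> \<le> emeasure annulus_lebesgue (U \<inter> basin annulus g (UNIV \<times> {c}))"
  proof (rule sets_annulus_lebesgue_if_borel_up_to_null(2))
    show "U \<inter> unfold -` tends_to c \<in> sets borel"
      using assms(1) emeasure_annulus_borel_unfold(1)[OF tends_to_borel[of c]] by simp
    show "U \<inter> basin annulus g (UNIV \<times> {c}) - atypical = U \<inter> unfold -` tends_to c - atypical"
    proof (rule set_eqI)
      fix q
      have "q \<in> basin annulus g (UNIV \<times> {c}) \<Longrightarrow> q \<in> annulus" by (simp add: basin_def)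
      then show "q \<in> U \<inter> basin annulus g (UNIV \<times> {c}) - atypical \<longleftrightarrow> q \<in> U \<inter> unfold -` tends_to c - atypical"
        using basin_iff(1)[OF _ assms(4), of q] unfold_tends_to_annulus[of q c] by blast
    qed
  qed
  finally show ?thesis .
qed

lemma attractor_boundary:
  assumes "c \<in> {0, 1}"
  shows "attractor annulus_lebesgue annulus g (UNIV \<times> {c})"
  unfolding attractor_def
proof (intro conjI)
  show "(UNIV :: circle set) \<times> {c} \<subseteq> annulus" using assms by (auto simp: annulus_def)
  have "0 < emeasure annulus_borel (UNIV \<inter> unfold -` tends_to c)"
    by (rule basin_positive[of _ "covering (0, 1/2)"])
       (use assms in \<open>auto simp: unfold_covering fundamental_domain_def open_strip_def\<close>)
  also have "\<dots> \<le> emeasure annulus_lebesgue {q \<in> annulus. omega_limit g q = UNIV \<times> {c}}"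
  proof (rule sets_annulus_lebesgue_if_borel_up_to_null(2))
    show "UNIV \<inter> unfold -` tends_to c \<in> sets borel"
      using emeasure_annulus_borel_unfold(1)[OF tends_to_borel[of c]] by simp
    show "{q \<in> annulus. omega_limit g q = UNIV \<times> {c}} - atypical = UNIV \<inter> unfold -` tends_to c - atypical"
    proof (rule set_eqI)
      fix q
      show "q \<in> {q \<in> annulus. omega_limit g q = UNIV \<times> {c}} - atypical \<longleftrightarrow> q \<in> UNIV \<inter> unfold -` tends_to c - atypical"
        using basin_iff(2)[OF _ assms, of q] unfold_tends_to_annulus[of q c] by blast
    qed
  qed
  finally show "0 < emeasure annulus_lebesgue {q \<in> annulus. omega_limit g q = UNIV \<times> {c}}" .
qed (rule compact_boundary_circle)

lemma basins_full:
  "annulus - (basin annulus g (UNIV \<times> {0}) \<union> basin annulus g (UNIV \<times> {1})) \<in> null_sets annulus_lebesgue"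
proof -
  have "annulus - (basin annulus g (UNIV \<times> {0}) \<union> basin annulus g (UNIV \<times> {1})) \<subseteq> atypical"
  proof
    fix q assume q: "q \<in> annulus - (basin annulus g (UNIV \<times> {0}) \<union> basin annulus g (UNIV \<times> {1}))"
    show "q \<in> atypical"
    proof (rule ccontr)
      assume "q \<notin> atypical"
      then show False using q basin_iff(1)[of q 0] basin_iff(1)[of q 1] by (auto simp: atypical_def)
    qed
  qed
  then show ?thesis
    unfolding annulus_lebesgue_eq using atypical_null null_sets_completion_subset null_sets_completionI by blast
qed

lemma basins_intermingled:
  "intermingled annulus_lebesgue {basin annulus g (UNIV \<times> {0}), basin annulus g (UNIV \<times> {1})}"
  unfolding intermingled_def
proof (intro allI impI ballI)
  fix U :: "(circle \<times> real) set" and B B'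
  assume U: "open U" and B: "B \<in> {basin annulus g (UNIV \<times> {0}), basin annulus g (UNIV \<times> {1})}"
    and pos: "0 < emeasure annulus_lebesgue (U \<inter> B)"
    and B': "B' \<in> {basin annulus g (UNIV \<times> {0}), basin annulus g (UNIV \<times> {1})}"
  obtain c c' where c: "c \<in> {0, 1}" "B = basin annulus g (UNIV \<times> {c})"
    and c': "c' \<in> {0, 1}" "B' = basin annulus g (UNIV \<times> {c'})" using B B' by blast
  have "\<not> U \<inter> B \<subseteq> atypical"
  proof
    assume "U \<inter> B \<subseteq> atypical"
    then have "U \<inter> B \<in> null_sets annulus_lebesgue"
      unfolding annulus_lebesgue_eq using atypical_null null_sets_completion_subset null_sets_completionI by blast
    with pos show False by (simp add: null_setsD1)
  qed
  then obtain q where q: "q \<in> U" "q \<in> B" "q \<notin> atypical" by blast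
  then have "q \<in> annulus - atypical" using c(2) by (simp add: basin_def)
  then have "unfold q \<in> tends_to c" using basin_iff(1)[OF _ c(1)] q c(2) by blast
  then have "unfold q \<in> open_strip" by (simp add: tends_to_def)
  then show "0 < emeasure annulus_lebesgue (U \<inter> B')"
    unfolding c'(2) by (rule emeasure_basin_pos[OF U q(1) _ c'(1)])
qed

end

section \<open>Partial derivatives on the strip\<close>

lemma vector_derivative_within_eqI:
  assumes "(f has_vector_derivative d) (at x within S)" "at x within S \<noteq> bot"
  shows "vector_derivative f (at x within S) = d"
  using vector_derivative_within[OF assms(2,1)] .

lemma partial_within_cong:
  assumes "\<And>q. q \<in> S \<Longrightarrow> u q = v q" "p \<in> S"
  shows "partial_within S b u p = partial_within S b v p"
proof -
  have "((\<lambda>t. u (p + t *\<^sub>R b)) has_vector_derivative d) (at 0 within {t. p + t *\<^sub>R b \<in> S})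
    \<longleftrightarrow> ((\<lambda>t. v (p + t *\<^sub>R b)) has_vector_derivative d) (at 0 within {t. p + t *\<^sub>R b \<in> S})" for d
    using assms by (intro iffI; elim has_vector_derivative_transform[rotated 2]) auto
  then show ?thesis by (simp add: partial_within_def vector_derivative_def)
qed

lemma strip_directions: "(Basis :: (real \<times> real) set) = {(1, 0), (0, 1)}"
  by (auto simp: Basis_prod_def)

text \<open>
  Hence one-sided derivatives at the boundary of the strip are unique.
\<close>

lemma strip_not_isolated:
  assumes "p \<in> strip" "b \<in> Basis"
  shows "at 0 within {t. p + t *\<^sub>R b \<in> strip} \<noteq> bot"
proof -
  obtain x z where p: "p = (x, z)" "0 \<le> z" "z \<le> 1" using assms(1) by (auto simp: strip_def)
  consider "b = (1, 0)" | "b = (0, 1)" using assms(2) by (auto simp: strip_directions)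
  then show ?thesis
  proof cases
    case 1
    then have "{t. p + t *\<^sub>R b \<in> strip} = UNIV" using p by (auto simp: strip_def)
    then show ?thesis by simp
  next
    case 2
    then have "{t. p + t *\<^sub>R b \<in> strip} = {-z..1 - z}" using p by (auto simp: strip_def)
    moreover have "0 islimpt {-z..1 - z}" using p by simp
    ultimately show ?thesis by (simp add: trivial_limit_within)
  qed
qed

abbreviation differentiable_along :: "(real \<times> real \<Rightarrow> real \<times> real) \<Rightarrow> real \<times> real \<Rightarrow> real \<times> real \<Rightarrow> bool" where
  "differentiable_along u b p \<equiv> (\<lambda>t. u (p + t *\<^sub>R b)) differentiable (at 0 within {t. p + t *\<^sub>R b \<in> strip})"

lemma partial_has_vector_derivative:
  assumes "differentiable_along u b p"
  shows "((\<lambda>t. u (p + t *\<^sub>R b)) has_vector_derivative partial_within strip b u p)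
    (at 0 within {t. p + t *\<^sub>R b \<in> strip})"
  using assms unfolding partial_within_def by (simp add: vector_derivative_works)

lemma partial_within_eqI:
  assumes "((\<lambda>t. u (p + t *\<^sub>R b)) has_vector_derivative d) (at 0 within {t. p + t *\<^sub>R b \<in> strip})"
    "p \<in> strip" "b \<in> Basis"
  shows "partial_within strip b u p = d"
  unfolding partial_within_def by (rule vector_derivative_within_eqI[OF assms(1) strip_not_isolated[OF assms(2,3)]])

lemma differentiable_along_cong:
  assumes "\<And>q. q \<in> strip \<Longrightarrow> u q = v q" "p \<in> strip" "differentiable_along u b p"
  shows "differentiable_along v b p"
  by (rule differentiable_transform_within[OF assms(3), of 1]) (use assms in auto)

lemma Cr_onD:
  assumes "Cr_on r strip u" "bs \<in> lists Basis"
  shows "length bs < r \<Longrightarrow> b \<in> Basis \<Longrightarrow> p \<in> strip \<Longrightarrow> differentiable_along (partials_within strip bs u) b p"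
    and "length bs \<le> r \<Longrightarrow> continuous_on strip (partials_within strip bs u)"
  using assms unfolding Cr_on_def by auto

text \<open>
  Iterated partial derivatives are defined by a choice of derivative, hence additive only where the
  inner derivatives exist; this is what the regularity assumptions provide.
\<close>

lemma partials_within_combination:
  fixes u v :: "real \<times> real \<Rightarrow> real \<times> real"
  assumes u: "Cr_on r strip u" and v: "Cr_on r strip v"
    and "bs \<in> lists Basis" "length bs \<le> r" "p \<in> strip"
  shows "partials_within strip bs (\<lambda>p. u p + c *\<^sub>R v p) p
    = partials_within strip bs u p + c *\<^sub>R partials_within strip bs v p"
  using assms(3-5)
proof (induction bs arbitrary: p)
  case (Cons b bs)
  have b: "b \<in> Basis" "bs \<in> lists Basis" "length bs < r"
    using Cons.hyps Cons.prems by simp_all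
  let ?w = "\<lambda>p. partials_within strip bs u p + c *\<^sub>R partials_within strip bs v p"
  have "partials_within strip (b # bs) (\<lambda>p. u p + c *\<^sub>R v p) p = partial_within strip b ?w p"
    unfolding foldr.simps comp_apply using Cons b by (intro partial_within_cong) auto
  also have "\<dots> = partial_within strip b (partials_within strip bs u) p
      + c *\<^sub>R partial_within strip b (partials_within strip bs v) p"
  proof (rule partial_within_eqI[OF _ _ b(1)])
    have D: "((\<lambda>t. partials_within strip bs f (p + t *\<^sub>R b)) has_vector_derivative
        partial_within strip b (partials_within strip bs f) p) (at 0 within {t. p + t *\<^sub>R b \<in> strip})"
      if "Cr_on r strip f" for f :: "real \<times> real \<Rightarrow> real \<times> real"
      using Cr_onD(1)[OF that b(2,3,1)] Cons.prems by (intro partial_has_vector_derivative) simp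
    show "((\<lambda>t. ?w (p + t *\<^sub>R b)) has_vector_derivative
        partial_within strip b (partials_within strip bs u) p
        + c *\<^sub>R partial_within strip b (partials_within strip bs v) p)
        (at 0 within {t. p + t *\<^sub>R b \<in> strip})"
      by (intro has_vector_derivative_add D u v
          bounded_linear.has_vector_derivative[OF bounded_linear_scaleR_right])
  qed (use Cons.prems in simp)
  finally show ?case by simp
qed simp

lemma Cr_on_combination:
  fixes u v :: "real \<times> real \<Rightarrow> real \<times> real"
  assumes u: "Cr_on r strip u" and v: "Cr_on r strip v"
  shows "Cr_on r strip (\<lambda>p. u p + c *\<^sub>R v p)"
  unfolding Cr_on_def
proof (intro conjI ballI impI)
  fix bs :: "(real \<times> real) list" and b p :: "real \<times> real" assume bs: "bs \<in> lists Basis" "length bs < r" "b \<in> Basis" "p \<in> strip"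
  let ?w = "\<lambda>p. partials_within strip bs u p + c *\<^sub>R partials_within strip bs v p"
  have "differentiable_along ?w b p"
    using bs by (intro differentiable_add differentiable_scaleR differentiable_const Cr_onD(1)[OF u] Cr_onD(1)[OF v])
  then show "differentiable_along (partials_within strip bs (\<lambda>p. u p + c *\<^sub>R v p)) b p"
    by (rule differentiable_along_cong[rotated 2]) (use bs partials_within_combination[OF u v] in auto)
next
  fix bs :: "(real \<times> real) list" assume bs: "bs \<in> lists Basis" "length bs \<le> r"
  have "continuous_on strip (\<lambda>p. partials_within strip bs u p + c *\<^sub>R partials_within strip bs v p)"
    using bs by (intro continuous_intros Cr_onD(2)[OF u] Cr_onD(2)[OF v])
  then show "continuous_on strip (partials_within strip bs (\<lambda>p. u p + c *\<^sub>R v p))"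
    by (rule continuous_on_eq) (use bs partials_within_combination[OF u v] in auto)
qed

lemma holder_on_combination:
  fixes u v :: "real \<times> real \<Rightarrow> real \<times> real"
  assumes "holder_on \<beta> C S u" "holder_on \<beta> D S v"
  shows "holder_on \<beta> (C + \<bar>c\<bar> * D) S (\<lambda>p. u p + c *\<^sub>R v p)"
  unfolding holder_on_def
proof (intro ballI)
  fix p q assume pq: "p \<in> S" "q \<in> S"
  have "dist (u p + c *\<^sub>R v p) (u q + c *\<^sub>R v q) \<le> dist (u p) (u q) + dist (c *\<^sub>R v p) (c *\<^sub>R v q)"
    by (rule dist_triangle_add)
  also have "dist (c *\<^sub>R v p) (c *\<^sub>R v q) = \<bar>c\<bar> * dist (v p) (v q)"
    by (simp add: dist_norm flip: scaleR_diff_right)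
  also have "dist (u p) (u q) + \<bar>c\<bar> * dist (v p) (v q) \<le> C * dist p q powr \<beta> + \<bar>c\<bar> * (D * dist p q powr \<beta>)"
    using assms pq unfolding holder_on_def by (intro add_mono mult_left_mono) auto
  finally show "dist (u p + c *\<^sub>R v p) (u q + c *\<^sub>R v q) \<le> (C + \<bar>c\<bar> * D) * dist p q powr \<beta>"
    by (simp add: algebra_simps)
qed

lemma holder_on_cong: "(\<And>p. p \<in> S \<Longrightarrow> u p = v p) \<Longrightarrow> holder_on \<beta> C S u \<longleftrightarrow> holder_on \<beta> C S v"
  by (simp add: holder_on_def)

lemma Ck_on_combination:
  fixes u v :: "real \<times> real \<Rightarrow> real \<times> real"
  assumes u: "Ck_on k strip u" and v: "Ck_on k strip v"
  shows "Ck_on k strip (\<lambda>p. u p + c *\<^sub>R v p)"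
proof -
  have r: "Cr_on (nat \<lfloor>k\<rfloor>) strip u" "Cr_on (nat \<lfloor>k\<rfloor>) strip v" using u v by (auto simp: Ck_on_def)
  have "\<exists>C. holder_on (frac k) C strip (partials_within strip bs (\<lambda>p. u p + c *\<^sub>R v p))"
    if bs: "bs \<in> lists Basis" "length bs = nat \<lfloor>k\<rfloor>" and k: "k \<notin> \<int>" for bs :: "(real \<times> real) list"
  proof -
    obtain C D where "holder_on (frac k) C strip (partials_within strip bs u)"
      "holder_on (frac k) D strip (partials_within strip bs v)"
      using u v bs k unfolding Ck_on_def by blast
    from holder_on_combination[OF this, of c] partials_within_combination[OF r bs(1), of _ c] bs(2)
    show ?thesis by (metis (mono_tags, lifting) holder_on_cong order_refl)
  qed
  then show ?thesis using Cr_on_combination[OF r] by (simp add: Ck_on_def)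
qed

lemma Ck_small_add:
  fixes u v :: "real \<times> real \<Rightarrow> real \<times> real"
  assumes r: "Cr_on (nat \<lfloor>k\<rfloor>) strip u" "Cr_on (nat \<lfloor>k\<rfloor>) strip v"
    and u: "Ck_small k \<delta> strip u" and v: "Ck_small k \<epsilon> strip v"
  shows "Ck_small k (\<delta> + \<epsilon>) strip (\<lambda>p. u p + v p)"
  unfolding Ck_small_def
proof (intro conjI ballI impI)
  have eq: "partials_within strip bs (\<lambda>p. u p + v p) p = partials_within strip bs u p + 1 *\<^sub>R partials_within strip bs v p"
    if "bs \<in> lists Basis" "length bs \<le> nat \<lfloor>k\<rfloor>" "p \<in> strip" for bs :: "(real \<times> real) list" and p
    using partials_within_combination[OF r that, of 1] by simp
  {
    fix bs :: "(real \<times> real) list" and p :: "real \<times> real" assume bs: "bs \<in> lists Basis" "length bs \<le> nat \<lfloor>k\<rfloor>" "p \<in> strip"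
    have "norm (partials_within strip bs u p) < \<delta>" "norm (partials_within strip bs v p) < \<epsilon>"
      using u v bs unfolding Ck_small_def by auto
    then show "norm (partials_within strip bs (\<lambda>p. u p + v p) p) < \<delta> + \<epsilon>"
      unfolding eq[OF bs] using norm_triangle_ineq[of "partials_within strip bs u p" "1 *\<^sub>R partials_within strip bs v p"] by simp
  next
    fix bs :: "(real \<times> real) list" assume k: "k \<notin> \<int>" and bs: "bs \<in> lists Basis" "length bs = nat \<lfloor>k\<rfloor>"
    have "holder_on (frac k) \<delta> strip (partials_within strip bs u)" "holder_on (frac k) \<epsilon> strip (partials_within strip bs v)"
      using u v bs k unfolding Ck_small_def by auto
    from holder_on_combination[OF this, of 1]
    have "holder_on (frac k) (\<delta> + \<epsilon>) strip (\<lambda>p. partials_within strip bs u p + 1 *\<^sub>R partials_within strip bs v p)" by simp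
    then show "holder_on (frac k) (\<delta> + \<epsilon>) strip (partials_within strip bs (\<lambda>p. u p + v p))"
      by (subst holder_on_cong[OF eq]) (use bs in auto)
  }
qed

lemma partials_within_const:
  fixes c :: "real \<times> real"
  assumes "bs \<in> lists Basis" "p \<in> strip"
  shows "partials_within strip bs (\<lambda>_. c) p = (if bs = [] then c else 0)"
  using assms
proof (induction bs arbitrary: p)
  case (Cons b bs)
  have "partials_within strip (b # bs) (\<lambda>_. c) p = partial_within strip b (\<lambda>_. if bs = [] then c else 0) p"
    unfolding foldr.simps comp_apply using Cons by (intro partial_within_cong) auto
  also have "\<dots> = 0" using Cons.prems Cons.hyps by (intro partial_within_eqI has_vector_derivative_const) auto
  finally show ?case by simp
qed simp

lemma Ck_on_const: "Ck_on k strip (\<lambda>_. c :: real \<times> real)"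
proof -
  have "Cr_on r strip (\<lambda>_. c)" for r
    unfolding Cr_on_def
  proof (intro conjI ballI impI)
    fix bs :: "(real \<times> real) list" and b p :: "real \<times> real" assume "bs \<in> lists Basis" "b \<in> Basis" "p \<in> strip"
    then show "differentiable_along (partials_within strip bs (\<lambda>_. c)) b p"
      by (intro differentiable_along_cong[where u = "\<lambda>_. if bs = [] then c else 0", OF _ _ differentiable_const])
        (simp_all add: partials_within_const)
  next
    fix bs :: "(real \<times> real) list" assume "bs \<in> lists Basis"
    then show "continuous_on strip (partials_within strip bs (\<lambda>_. c))"
      by (intro continuous_on_eq[where f = "\<lambda>_. if bs = [] then c else 0", OF continuous_on_const])
        (simp add: partials_within_const)
  qed
  moreover have "holder_on \<beta> 0 strip (partials_within strip bs (\<lambda>_. c))" if "bs \<in> lists Basis" for \<beta> bs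
    using that by (auto simp: holder_on_def partials_within_const)
  ultimately show ?thesis unfolding Ck_on_def by blast
qed

lemma partials_within_cong:
  assumes "\<And>q. q \<in> S \<Longrightarrow> u q = v q" "p \<in> S"
  shows "partials_within S bs u p = partials_within S bs v p"
  using assms(2)
proof (induction bs arbitrary: p)
  case (Cons b bs)
  then show ?case unfolding foldr.simps comp_apply by (intro partial_within_cong)
qed (use assms(1) in simp)

lemma Ck_smallD:
  assumes "Ck_small k \<epsilon> S u" "bs \<in> lists Basis"
  shows "length bs \<le> nat \<lfloor>k\<rfloor> \<Longrightarrow> p \<in> S \<Longrightarrow> norm (partials_within S bs u p) < \<epsilon>"
    and "k \<notin> \<int> \<Longrightarrow> length bs = nat \<lfloor>k\<rfloor> \<Longrightarrow> holder_on (frac k) \<epsilon> S (partials_within S bs u)"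
  using assms unfolding Ck_small_def by auto

lemma Ck_small_cong:
  assumes "Ck_small k \<epsilon> S u" "\<And>q. q \<in> S \<Longrightarrow> u q = v q"
  shows "Ck_small k \<epsilon> S v"
proof -
  have eq: "partials_within S bs v p = partials_within S bs u p" if "p \<in> S" for bs p
    by (rule partials_within_cong[OF assms(2)[symmetric] that])
  show ?thesis
    unfolding Ck_small_def
  proof (intro conjI ballI impI)
    show "norm (partials_within S bs v p) < \<epsilon>" if "bs \<in> lists Basis" "length bs \<le> nat \<lfloor>k\<rfloor>" "p \<in> S" for bs p
      unfolding eq[OF that(3)] by (rule Ck_smallD(1)[OF assms(1) that])
    show "holder_on (frac k) \<epsilon> S (partials_within S bs v)" if "k \<notin> \<int>" "bs \<in> lists Basis" "length bs = nat \<lfloor>k\<rfloor>" for bs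
      using Ck_smallD(2)[OF assms(1) that(2,1,3)] unfolding holder_on_def by (intro ballI) (simp only: eq)
  qed
qed

lemma Ck_small_zero:
  assumes "0 < \<epsilon>"
  shows "Ck_small k \<epsilon> strip (\<lambda>_. 0 :: real \<times> real)"
  using assms by (simp add: Ck_small_def holder_on_def partials_within_const)

section \<open>Regularity of the unperturbed map and uniqueness of lifts\<close>

text \<open>
  A class of vector fields that contains the standard lift of the unperturbed map and is closed under partial
  derivatives; after one differentiation the coefficient $b$ vanishes and the field is bounded.
\<close>

definition trig_field :: "real \<Rightarrow> real \<Rightarrow> real poly \<Rightarrow> real poly \<Rightarrow> real poly \<Rightarrow> real \<times> real \<Rightarrow> real \<times> real" where
  "trig_field a b p q r = (\<lambda>(x, z). (a + b * x,
    poly p z + poly q z * cos (2 * pi * x) + poly r z * sin (2 * pi * x)))"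

lemma trig_field_partial_x:
  "((\<lambda>t. trig_field a b p q r (w + t *\<^sub>R (1, 0))) has_vector_derivative
    trig_field b 0 0 (smult (2 * pi) r) (smult (- 2 * pi) q) w) (at 0 within T)"
proof -
  obtain x z where w: "w = (x, z)" by fastforce
  have "((\<lambda>t. (a + b * (x + t), poly p z + poly q z * cos (2 * pi * (x + t)) + poly r z * sin (2 * pi * (x + t))))
      has_vector_derivative (b, poly r z * (2 * pi * cos (2 * pi * x)) - poly q z * (2 * pi * sin (2 * pi * x)))) (at 0 within T)"
    by (intro has_vector_derivative_Pair; unfold has_real_derivative_iff_has_vector_derivative[symmetric])
       (auto intro!: derivative_eq_intros simp: algebra_simps)
  then show ?thesis by (simp add: w trig_field_def algebra_simps)
qed

lemma trig_field_partial_z: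
  "((\<lambda>t. trig_field a b p q r (w + t *\<^sub>R (0, 1))) has_vector_derivative
    trig_field 0 0 (pderiv p) (pderiv q) (pderiv r) w) (at 0 within T)"
proof -
  obtain x z where w: "w = (x, z)" by fastforce
  have p: "((\<lambda>t. poly p (z + t)) has_real_derivative poly (pderiv p) z) (at 0 within T)" for p
    using DERIV_shift[of "poly p" "poly (pderiv p) z" 0 z] poly_DERIV[of p z]
    by (simp add: add.commute has_field_derivative_at_within)
  have "((\<lambda>t. (a + b * x, poly p (z + t) + poly q (z + t) * cos (2 * pi * x) + poly r (z + t) * sin (2 * pi * x)))
      has_vector_derivative (0, poly (pderiv p) z + poly (pderiv q) z * cos (2 * pi * x) + poly (pderiv r) z * sin (2 * pi * x))) (at 0 within T)"
    by (intro has_vector_derivative_Pair has_vector_derivative_const; unfold has_real_derivative_iff_has_vector_derivative[symmetric])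
       (intro DERIV_add DERIV_cmult_right p)
  then show ?thesis by (simp add: w trig_field_def)
qed

lemma trig_field_partials:
  assumes "bs \<in> lists Basis"
  shows "\<exists>a' b' p' q' r'. (bs \<noteq> [] \<longrightarrow> b' = 0) \<and>
    (\<forall>w\<in>strip. partials_within strip bs (trig_field a b p q r) w = trig_field a' b' p' q' r' w)"
  using assms
proof (induction bs)
  case Nil
  show ?case by (intro exI[of _ a] exI[of _ b] exI[of _ p] exI[of _ q] exI[of _ r]) simp
next
  case (Cons d bs)
  then obtain a' b' p' q' r' where IH: "(bs \<noteq> [] \<longrightarrow> b' = 0)"
    "\<And>w. w \<in> strip \<Longrightarrow> partials_within strip bs (trig_field a b p q r) w = trig_field a' b' p' q' r' w" by blast
  have eq: "partials_within strip (d # bs) (trig_field a b p q r) w = partial_within strip d (trig_field a' b' p' q' r') w"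
    if "w \<in> strip" for w
    unfolding foldr.simps comp_apply by (rule partial_within_cong[OF IH(2) that])
  consider "d = (1, 0)" | "d = (0, 1)" using Cons.hyps by (auto simp: strip_directions)
  then show ?case
  proof cases
    case 1
    have "partial_within strip d (trig_field a' b' p' q' r') w
        = trig_field b' 0 0 (smult (2 * pi) r') (smult (- 2 * pi) q') w" if "w \<in> strip" for w
      unfolding 1 by (intro partial_within_eqI trig_field_partial_x that) (simp add: strip_directions)
    with eq show ?thesis by (metis list.distinct(1))
  next
    case 2
    have "partial_within strip d (trig_field a' b' p' q' r') w
        = trig_field 0 0 (pderiv p') (pderiv q') (pderiv r') w" if "w \<in> strip" for w
      unfolding 2 by (intro partial_within_eqI trig_field_partial_z that) (simp add: strip_directions)
    with eq show ?thesis by (metis list.distinct(1))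
  qed
qed

text \<open>
  Closed under sums and products, and implying a Hoelder condition with every exponent in $[0, 1]$.
\<close>

definition bounded_lipschitz :: "(real \<times> real \<Rightarrow> real) \<Rightarrow> bool" where
  "bounded_lipschitz h \<longleftrightarrow> (\<exists>B. \<forall>v\<in>strip. \<forall>w\<in>strip. \<bar>h v\<bar> \<le> B \<and> \<bar>h v - h w\<bar> \<le> B * dist v w)"

lemma bounded_lipschitz_const: "bounded_lipschitz (\<lambda>_. c)"
  unfolding bounded_lipschitz_def by (intro exI[of _ "\<bar>c\<bar>"]) auto

lemma bounded_lipschitz_add:
  assumes "bounded_lipschitz h" "bounded_lipschitz k"
  shows "bounded_lipschitz (\<lambda>w. h w + k w)"
proof -
  obtain B C where B: "\<And>v w. v \<in> strip \<Longrightarrow> w \<in> strip \<Longrightarrow> \<bar>h v\<bar> \<le> B \<and> \<bar>h v - h w\<bar> \<le> B * dist v w"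
    and C: "\<And>v w. v \<in> strip \<Longrightarrow> w \<in> strip \<Longrightarrow> \<bar>k v\<bar> \<le> C \<and> \<bar>k v - k w\<bar> \<le> C * dist v w"
    using assms unfolding bounded_lipschitz_def by blast
  have "\<bar>h v + k v\<bar> \<le> B + C \<and> \<bar>h v + k v - (h w + k w)\<bar> \<le> (B + C) * dist v w"
    if "v \<in> strip" "w \<in> strip" for v w
    using B[OF that] C[OF that] unfolding distrib_right by argo
  then show ?thesis unfolding bounded_lipschitz_def by blast
qed

lemma bounded_lipschitz_mult:
  assumes "bounded_lipschitz h" "bounded_lipschitz k"
  shows "bounded_lipschitz (\<lambda>w. h w * k w)"
proof -
  obtain B C where B: "\<And>v w. v \<in> strip \<Longrightarrow> w \<in> strip \<Longrightarrow> \<bar>h v\<bar> \<le> B \<and> \<bar>h v - h w\<bar> \<le> B * dist v w"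
    and C: "\<And>v w. v \<in> strip \<Longrightarrow> w \<in> strip \<Longrightarrow> \<bar>k v\<bar> \<le> C \<and> \<bar>k v - k w\<bar> \<le> C * dist v w"
    using assms unfolding bounded_lipschitz_def by blast
  have "\<bar>h v * k v\<bar> \<le> B * C + B * C \<and> \<bar>h v * k v - h w * k w\<bar> \<le> (B * C + B * C) * dist v w"
    if vw: "v \<in> strip" "w \<in> strip" for v w
  proof -
    have BC: "0 \<le> B" "0 \<le> C" using B[OF vw] C[OF vw] by (auto intro: order_trans[OF abs_ge_zero])
    have "\<bar>h v * k v\<bar> \<le> B * C" unfolding abs_mult using B[OF vw] C[OF vw] BC by (intro mult_mono) auto
    moreover have "0 \<le> B * C" using BC by simp
    moreover have eq: "h v * k v - h w * k w = h v * (k v - k w) + (h v - h w) * k w" by (simp add: algebra_simps)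
    moreover have "\<bar>h v * (k v - k w)\<bar> \<le> B * (C * dist v w)"
      unfolding abs_mult using B[OF vw] C[OF vw] BC by (intro mult_mono) auto
    moreover have "\<bar>(h v - h w) * k w\<bar> \<le> (B * dist v w) * C"
      unfolding abs_mult using B[OF vw] C[OF vw(2,2)] BC by (intro mult_mono) auto
    moreover have "(B * C + B * C) * dist v w = B * (C * dist v w) + (B * dist v w) * C" by (simp add: algebra_simps)
    ultimately show ?thesis
      unfolding eq using abs_triangle_ineq[of "h v * (k v - k w)" "(h v - h w) * k w"] by linarith
  qed
  then show ?thesis unfolding bounded_lipschitz_def by blast
qed

lemma bounded_lipschitz_poly: "bounded_lipschitz (\<lambda>w. poly p (snd w))"
proof (induction p)
  case (pCons c p)
  have "bounded_lipschitz snd"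
    unfolding bounded_lipschitz_def
  proof (intro exI[of _ 1] ballI conjI)
    fix v w :: "real \<times> real" assume "v \<in> strip" "w \<in> strip"
    then show "\<bar>snd v\<bar> \<le> 1" by (auto simp: strip_def)
    show "\<bar>snd v - snd w\<bar> \<le> 1 * dist v w" using dist_snd_le[of v w] by (simp add: dist_real_def)
  qed
  from bounded_lipschitz_add[OF bounded_lipschitz_const bounded_lipschitz_mult[OF this pCons(2)]]
  show ?case by simp
qed (simp add: bounded_lipschitz_const)

lemma bounded_lipschitz_trig:
  "bounded_lipschitz (\<lambda>w. cos (2 * pi * fst w))" "bounded_lipschitz (\<lambda>w. sin (2 * pi * fst w))"
proof -
  have trig: "bounded_lipschitz (\<lambda>w. f (2 * pi * fst w))"
    if f: "\<And>x. (f has_real_derivative f' x) (at x)" "\<And>x. \<bar>f' x\<bar> \<le> 1" "\<And>x. \<bar>f x\<bar> \<le> 1" for f f'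
    unfolding bounded_lipschitz_def
  proof (intro exI[of _ "2 * pi"] ballI conjI)
    fix v w :: "real \<times> real"
    show "\<bar>f (2 * pi * fst v)\<bar> \<le> 2 * pi" using f(3)[of "2 * pi * fst v"] pi_gt3 by linarith
    have "\<bar>f (2 * pi * fst v) - f (2 * pi * fst w)\<bar> \<le> 1 * \<bar>2 * pi * fst v - 2 * pi * fst w\<bar>"
      using field_differentiable_bound[of UNIV f f' 1 "2 * pi * fst v" "2 * pi * fst w"] f by simp
    also have "2 * pi * fst v - 2 * pi * fst w = 2 * pi * (fst v - fst w)" by (simp add: algebra_simps)
    also have "1 * \<bar>2 * pi * (fst v - fst w)\<bar> \<le> 2 * pi * dist v w"
      using dist_fst_le[of v w] by (simp add: abs_mult dist_real_def)
    finally show "\<bar>f (2 * pi * fst v) - f (2 * pi * fst w)\<bar> \<le> 2 * pi * dist v w" .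
  qed
  show "bounded_lipschitz (\<lambda>w. cos (2 * pi * fst w))" by (rule trig[where f' = "\<lambda>x. - sin x"]) (auto intro: DERIV_cos)
  show "bounded_lipschitz (\<lambda>w. sin (2 * pi * fst w))" by (rule trig[where f' = cos]) (auto intro: DERIV_sin)
qed

lemma trig_field_holder:
  assumes "0 \<le> \<beta>" "\<beta> \<le> 1"
  shows "\<exists>C. holder_on \<beta> C strip (trig_field a 0 p q r)"
proof -
  define h where "h w = poly p (snd w) + poly q (snd w) * cos (2 * pi * fst w) + poly r (snd w) * sin (2 * pi * fst w)" for w :: "real \<times> real"
  have "bounded_lipschitz h"
    unfolding h_def
    by (intro bounded_lipschitz_add bounded_lipschitz_mult bounded_lipschitz_poly bounded_lipschitz_trig)
  then obtain B where B: "\<And>v w. v \<in> strip \<Longrightarrow> w \<in> strip \<Longrightarrow> \<bar>h v\<bar> \<le> B \<and> \<bar>h v - h w\<bar> \<le> B * dist v w"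
    unfolding bounded_lipschitz_def by blast
  have "dist (trig_field a 0 p q r v) (trig_field a 0 p q r w) \<le> 2 * B * dist v w powr \<beta>"
    if vw: "v \<in> strip" "w \<in> strip" for v w
  proof -
    have eq: "trig_field a 0 p q r w = (a, h w)" for w by (simp add: trig_field_def h_def split_def)
    have d: "dist (trig_field a 0 p q r v) (trig_field a 0 p q r w) = \<bar>h v - h w\<bar>"
      by (simp add: eq dist_prod_def dist_real_def)
    have B0: "0 \<le> B" using B[OF vw] by (auto intro: order_trans[OF abs_ge_zero])
    show ?thesis
    proof (cases "dist v w \<le> 1")
      case True
      have "\<bar>h v - h w\<bar> \<le> B * dist v w" using B[OF vw] by simp
      also have "\<dots> \<le> B * dist v w powr \<beta>"
      proof (rule mult_left_mono[OF _ B0])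
        show "dist v w \<le> dist v w powr \<beta>"
          using powr_mono'[of \<beta> 1 "dist v w"] True assms by (cases "v = w") auto
      qed
      also have "\<dots> \<le> 2 * B * dist v w powr \<beta>" using B0 by (intro mult_right_mono) auto
      finally show ?thesis by (simp add: d)
    next
      case False
      have "\<bar>h v - h w\<bar> \<le> 2 * B * 1" using B[OF vw] B[OF vw(2,1)] by argo
      also have "\<dots> \<le> 2 * B * dist v w powr \<beta>"
        using False assms B0 by (intro mult_left_mono ge_one_powr_ge_zero) auto
      finally show ?thesis by (simp add: d)
    qed
  qed
  then show ?thesis unfolding holder_on_def by blast
qed

lemma trig_field_continuous: "continuous_on T (trig_field a b p q r)"
  unfolding trig_field_def split_def by (intro continuous_intros)

lemma trig_field_Ck:
  assumes "1 \<le> k"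
  shows "Ck_on k strip (trig_field a b p q r)"
proof -
  have "Cr_on n strip (trig_field a b p q r)" for n
    unfolding Cr_on_def
  proof (intro conjI ballI impI)
    fix bs :: "(real \<times> real) list" and d w :: "real \<times> real"
    assume bs: "bs \<in> lists Basis" "d \<in> Basis" "w \<in> strip"
    obtain a' b' p' q' r' where eq: "\<And>w. w \<in> strip \<Longrightarrow> partials_within strip bs (trig_field a b p q r) w = trig_field a' b' p' q' r' w"
      using trig_field_partials[OF bs(1), of a b p q r] by blast
    have "differentiable_along (trig_field a' b' p' q' r') d w"
    proof -
      consider "d = (1, 0)" | "d = (0, 1)" using bs(2) by (auto simp: strip_directions)
      then show ?thesis
        by cases (simp_all only: differentiableI_vector[OF trig_field_partial_x] differentiableI_vector[OF trig_field_partial_z])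
    qed
    then show "differentiable_along (partials_within strip bs (trig_field a b p q r)) d w"
      by (rule differentiable_along_cong[rotated 2]) (use eq bs in auto)
  next
    fix bs :: "(real \<times> real) list" assume bs: "bs \<in> lists Basis"
    obtain a' b' p' q' r' where eq: "\<And>w. w \<in> strip \<Longrightarrow> partials_within strip bs (trig_field a b p q r) w = trig_field a' b' p' q' r' w"
      using trig_field_partials[OF bs(1), of a b p q r] by blast
    show "continuous_on strip (partials_within strip bs (trig_field a b p q r))"
      by (rule continuous_on_eq[OF trig_field_continuous eq[symmetric]])
  qed
  moreover have "\<exists>C. holder_on (frac k) C strip (partials_within strip bs (trig_field a b p q r))"
    if bs: "bs \<in> lists Basis" "length bs = nat \<lfloor>k\<rfloor>" for bs
  proof -
    have "bs \<noteq> []" using bs(2) assms by auto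
    then obtain a' p' q' r' where eq: "\<And>w. w \<in> strip \<Longrightarrow> partials_within strip bs (trig_field a b p q r) w = trig_field a' 0 p' q' r' w"
      using trig_field_partials[OF bs(1), of a b p q r] by blast
    obtain C where "holder_on (frac k) C strip (trig_field a' 0 p' q' r')"
      using trig_field_holder[of "frac k" a' p' q' r'] frac_lt_1[of k] by (auto simp: less_imp_le)
    then have "holder_on (frac k) C strip (partials_within strip bs (trig_field a b p q r))"
      unfolding holder_on_def by (intro ballI) (simp only: eq)
    then show ?thesis by (rule exI)
  qed
  ultimately show ?thesis by (simp add: Ck_on_def)
qed

definition kan_cover :: "real \<times> real \<Rightarrow> real \<times> real" where
  "kan_cover = trig_field 0 3 [:0, 1:] [:0, 1/32, - 1/32:] 0"

lemma kan_cover_eq: "kan_cover (x, z) = (3 * x, z + cos (2 * pi * x) * (z * (1 - z) / 32))"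
  by (simp add: kan_cover_def trig_field_def field_simps)

lemma kan_cover_lift:
  assumes "1 \<le> k" shows "Ck_lift k kan_map kan_cover"
  unfolding Ck_lift_def
proof (intro conjI ballI)
  show "Ck_on k strip kan_cover" unfolding kan_cover_def by (rule trig_field_Ck[OF assms])
  fix w :: "real \<times> real"
  obtain x z where w: "w = (x, z)" by fastforce
  show "covering (kan_cover w) = kan_map (covering w)"
    by (simp add: w kan_cover_eq covering_def kan_map_def triple.abs_eq cos_circle.abs_eq)
qed

lemma kan_map_Ck:
  assumes "1 \<le> k" shows "kan_map \<in> Ck_maps k"
proof -
  have "z + cos_circle \<xi> * (z / 32) * (1 - z) \<in> {0..1}" if "z \<in> {0..1}" for \<xi> z
  proof -
    have c: "\<bar>cos_circle \<xi>\<bar> \<le> 1" by (transfer, simp)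
    have "\<bar>cos_circle \<xi> * (z / 32 * (1 - z))\<bar> \<le> 1 * (z / 32 * (1 - z))"
      unfolding abs_mult using c that by (intro mult_mono) auto
    moreover have "z / 32 * (1 - z) \<le> z / 32 * 1" "z / 32 * (1 - z) \<le> 1 / 32 * (1 - z)"
      using that by (intro mult_left_mono mult_right_mono; simp)+
    moreover have "z + cos_circle \<xi> * (z / 32) * (1 - z) = z + cos_circle \<xi> * (z / 32 * (1 - z))" by simp
    ultimately have "0 \<le> z + cos_circle \<xi> * (z / 32) * (1 - z)" "z + cos_circle \<xi> * (z / 32) * (1 - z) \<le> 1"
      using that unfolding atLeastAtMost_iff by argo+
    then show ?thesis by simp
  qed
  then have "kan_map ` annulus \<subseteq> annulus"
    unfolding kan_map_def annulus_def by (intro image_subsetI) (simp add: mem_Times_iff split_def del: atLeastAtMost_iff)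
  moreover have "kan_map ` annulus_boundary \<subseteq> annulus_boundary"
    by (auto simp: kan_map_def annulus_boundary_def)
  ultimately show ?thesis using kan_cover_lift[OF assms] by (auto simp: Ck_maps_def)
qed

text \<open>
  The difference of two lifts is continuous and integer valued on a connected set.
\<close>

lemma lift_unique:
  assumes G: "Ck_lift k g G" and G': "Ck_lift k g G'"
  shows "\<exists>p::int. \<forall>w\<in>strip. G' w = G w + (of_int p, 0)"
proof -
  have cont: "continuous_on strip H" if "Ck_lift k g H" for H
    using that Cr_onD(2)[of "nat \<lfloor>k\<rfloor>" H "[]"] by (auto simp: Ck_lift_def Ck_on_def)
  have int: "fst (G' w) - fst (G w) \<in> \<int>" "snd (G' w) = snd (G w)" if "w \<in> strip" for w
  proof -
    have "covering (G' w) = covering (G w)" using G G' that by (simp add: Ck_lift_def)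
    then have "to_circle (fst (G' w)) = to_circle (fst (G w))" "snd (G' w) = snd (G w)"
      by (simp_all add: covering_def split_def)
    then show "fst (G' w) - fst (G w) \<in> \<int>" "snd (G' w) = snd (G w)"
      by (simp_all add: circle.abs_eq_iff)
  qed
  have "(\<lambda>w. fst (G' w) - fst (G w)) constant_on strip"
  proof (rule continuous_discrete_range_constant)
    show "connected strip" unfolding strip_def by (intro connected_Times connected_UNIV connected_Icc)
    show "continuous_on strip (\<lambda>w. fst (G' w) - fst (G w))"
      by (intro continuous_intros cont[OF G] cont[OF G'])
    fix v assume v: "v \<in> strip"
    show "\<exists>e>0. \<forall>w. w \<in> strip \<and> fst (G' w) - fst (G w) \<noteq> fst (G' v) - fst (G v) \<longrightarrow>
        e \<le> norm (fst (G' w) - fst (G w) - (fst (G' v) - fst (G v)))"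
    proof (intro exI[of _ 1] conjI allI impI)
      fix w assume w: "w \<in> strip \<and> fst (G' w) - fst (G w) \<noteq> fst (G' v) - fst (G v)"
      then have "fst (G' w) - fst (G w) - (fst (G' v) - fst (G v)) \<in> \<int>"
        using w v by (intro Ints_diff[OF int(1) int(1)]) auto
      with w show "1 \<le> norm (fst (G' w) - fst (G w) - (fst (G' v) - fst (G v)))"
        using Ints_nonzero_abs_ge1[of "fst (G' w) - fst (G w) - (fst (G' v) - fst (G v))"] by simp
    qed simp
  qed
  then obtain c where c: "\<And>w. w \<in> strip \<Longrightarrow> fst (G' w) - fst (G w) = c" by (auto simp: constant_on_def)
  have "(0, 0) \<in> strip" by (simp add: strip_def)
  then have "c \<in> \<int>" using int(1) c by metis
  then obtain p :: int where "c = of_int p" by (rule Ints_cases)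
  then have "G' w = G w + (of_int p, 0)" if "w \<in> strip" for w
    using c[OF that] int(2)[OF that] by (simp add: prod_eq_iff)
  then show ?thesis by blast
qed

section \<open>The neighborhood\<close>

text \<open>
  For $k \ge 2$ the first derivatives are Lipschitz, and for $1 < k < 2$ they are Hoelder with exponent
  $k - 1$.
\<close>

definition holder_exponent :: "real \<Rightarrow> real" where
  "holder_exponent k = (if \<lfloor>k\<rfloor> = 1 then frac k else 1)"

lemma holder_exponent_range:
  assumes "1 < k" shows "0 < holder_exponent k" "holder_exponent k \<le> 1"
  using assms frac_lt_1[of k] by (auto simp: holder_exponent_def frac_def)

lemma max_perturbation_pos:
  assumes "0 < \<beta>" shows "0 < max_perturbation \<beta>"
proof -
  have "0 < holder_gain \<beta>" using assms powr_less_mono[of 0 \<beta> "29/10"] by (simp add: holder_gain_def)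
  moreover have "0 < real (drift_steps \<beta>)" by (simp add: drift_steps_def)
  moreover have "0 < drift_exponent \<beta>" using calculation(2) by (simp add: drift_exponent_def)
  moreover have "0 < 1 + (3::real) ^ drift_steps \<beta>" by (simp add: add_pos_pos)
  ultimately show ?thesis unfolding max_perturbation_def by (auto intro!: mult_pos_pos divide_pos_pos)
qed

lemma component_derivative:
  assumes L: "bounded_linear (L :: real \<times> real \<Rightarrow> real)" and z: "z \<in> {0..1}"
  shows "differentiable_along u (1, 0) (x, z) \<Longrightarrow>
      ((\<lambda>x. L (u (x, z))) has_real_derivative L (partial_within strip (1, 0) u (x, z))) (at x)"
    and "differentiable_along u (0, 1) (x, z) \<Longrightarrow>
      ((\<lambda>z. L (u (x, z))) has_real_derivative L (partial_within strip (0, 1) u (x, z))) (at z within {0..1})"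
proof -
  assume d: "differentiable_along u (1, 0) (x, z)"
  have "{t. (x, z) + t *\<^sub>R (1, 0) \<in> strip} = UNIV" using z by (auto simp: strip_def)
  with partial_has_vector_derivative[OF d]
  have "((\<lambda>t. u (x + t, z)) has_vector_derivative partial_within strip (1, 0) u (x, z)) (at 0)" by simp
  from bounded_linear.has_vector_derivative[OF L this]
  have "((\<lambda>t. L (u (x + t, z))) has_real_derivative L (partial_within strip (1, 0) u (x, z))) (at 0)"
    by (simp add: has_real_derivative_iff_has_vector_derivative)
  then show "((\<lambda>x. L (u (x, z))) has_real_derivative L (partial_within strip (1, 0) u (x, z))) (at x)"
    using DERIV_shift[of "\<lambda>x. L (u (x, z))" _ 0 x] by (simp add: add.commute)
next
  assume d: "differentiable_along u (0, 1) (x, z)"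
  have "{t. (x, z) + t *\<^sub>R (0, 1) \<in> strip} = (\<lambda>s. s - z) ` {0..1}"
    by (auto simp: strip_def image_iff intro!: bexI[where x = "_ + z"])
  with partial_has_vector_derivative[OF d]
  have "((\<lambda>t. u (x, z + t)) has_vector_derivative partial_within strip (0, 1) u (x, z)) (at 0 within (\<lambda>s. s - z) ` {0..1})"
    by simp
  from bounded_linear.has_vector_derivative[OF L this]
  have "((\<lambda>t. L (u (x, z + t))) has_real_derivative L (partial_within strip (0, 1) u (x, z))) (at (z - z) within (\<lambda>s. s - z) ` {0..1})"
    by (simp add: has_real_derivative_iff_has_vector_derivative)
  moreover have "((\<lambda>s. s - z) has_real_derivative 1) (at z within {0..1})"
    by (auto intro!: derivative_eq_intros)
  ultimately show "((\<lambda>z. L (u (x, z))) has_real_derivative L (partial_within strip (0, 1) u (x, z))) (at z within {0..1})"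
    using DERIV_image_chain[of "\<lambda>t. L (u (x, z + t))" _ "\<lambda>s. s - z" z "{0..1}" 1] by (simp add: comp_def)
qed

text \<open>
  For $k \ge 2$ the second derivatives are small, and the mean value theorem is applied along
  a horizontal and then a vertical segment.
\<close>

lemma first_partials_holder:
  fixes u :: "real \<times> real \<Rightarrow> real \<times> real"
  assumes k: "1 < k" and r: "Cr_on (nat \<lfloor>k\<rfloor>) strip u" and small: "Ck_small k \<epsilon> strip u" and b: "b \<in> Basis"
    and L: "bounded_linear L" "\<And>y. \<bar>L y\<bar> \<le> norm y" and strip: "z \<in> {0..1}" "z' \<in> {0..1}"
  shows "\<bar>L (partial_within strip b u (x, z)) - L (partial_within strip b u (x', z'))\<bar>
    \<le> \<epsilon> * (\<bar>x - x'\<bar> + \<bar>z - z'\<bar>) powr holder_exponent k"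
proof -
  have in_strip: "(x, z) \<in> strip" "(x', z') \<in> strip" using strip by (auto simp: strip_def)
  have "norm (partials_within strip [] u (x, z)) < \<epsilon>"
    by (rule Ck_smallD(1)[OF small]) (use in_strip in auto)
  then have \<epsilon>: "0 < \<epsilon>" using norm_ge_zero less_le_trans by (metis le_less_trans)
  show ?thesis
  proof (cases "\<lfloor>k\<rfloor> = 1")
    case True
    then have "k \<notin> \<int>" using k by (auto elim!: Ints_cases)
    then have "holder_on (frac k) \<epsilon> strip (partials_within strip [b] u)"
      using b True by (intro Ck_smallD(2)[OF small]) auto
    then have h: "dist (partial_within strip b u (x, z)) (partial_within strip b u (x', z')) \<le> \<epsilon> * dist (x, z) (x', z') powr frac k"
      using in_strip unfolding holder_on_def by simp
    have "\<bar>L (partial_within strip b u (x, z)) - L (partial_within strip b u (x', z'))\<bar>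
        = \<bar>L (partial_within strip b u (x, z) - partial_within strip b u (x', z'))\<bar>"
      using L(1) by (simp add: linear_simps)
    also have "\<dots> \<le> dist (partial_within strip b u (x, z)) (partial_within strip b u (x', z'))"
      using L(2) by (simp add: dist_norm)
    also have "\<dots> \<le> \<epsilon> * dist (x, z) (x', z') powr frac k" by (rule h)
    also have "dist (x, z) (x', z') \<le> \<bar>x - x'\<bar> + \<bar>z - z'\<bar>"
      using sqrt_sum_squares_le_sum_abs[of "x - x'" "z - z'"] by (simp add: dist_prod_def dist_real_def)
    then have "\<epsilon> * dist (x, z) (x', z') powr frac k \<le> \<epsilon> * (\<bar>x - x'\<bar> + \<bar>z - z'\<bar>) powr frac k"
      using \<epsilon> by (intro mult_left_mono powr_mono2) auto
    finally show ?thesis using True by (simp add: holder_exponent_def)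
  next
    case False
    then have "2 \<le> \<lfloor>k\<rfloor>" using k by linarith
    then have k2: "2 \<le> nat \<lfloor>k\<rfloor>" by linarith
    let ?v = "partials_within strip [b] u"
    have second: "\<bar>L (partial_within strip d ?v (y, s))\<bar> \<le> \<epsilon>" if "d \<in> Basis" "s \<in> {0..1}" for d y s
    proof -
      have "norm (partials_within strip [d, b] u (y, s)) < \<epsilon>"
        by (rule Ck_smallD(1)[OF small]) (use that b k2 in \<open>auto simp: strip_def\<close>)
      then show ?thesis using L(2)[of "partial_within strip d ?v (y, s)"] by simp
    qed
    have diff: "differentiable_along ?v d (y, s)" if "d \<in> Basis" "s \<in> {0..1}" for d y s
    proof (rule Cr_onD(1)[OF r])
      show "[b] \<in> lists Basis" "d \<in> Basis" "(y, s) \<in> strip" using b that by (auto simp: strip_def)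
      show "length [b] < nat \<lfloor>k\<rfloor>" unfolding list.size using k2 by linarith
    qed
    have e: "(1, 0) \<in> (Basis :: (real \<times> real) set)" "(0, 1) \<in> (Basis :: (real \<times> real) set)"
      by (simp_all add: strip_directions)
    have "\<bar>L (?v (x, z)) - L (?v (x', z))\<bar> \<le> \<epsilon> * \<bar>x - x'\<bar>"
      using field_differentiable_bound[of UNIV "\<lambda>x. L (?v (x, z))" "\<lambda>x. L (partial_within strip (1, 0) ?v (x, z))" \<epsilon> x x']
        component_derivative(1)[OF L(1) strip(1) diff[OF e(1) strip(1)]] second[OF e(1) strip(1)] by simp
    moreover have "\<bar>L (?v (x', z)) - L (?v (x', z'))\<bar> \<le> \<epsilon> * \<bar>z - z'\<bar>"
      using field_differentiable_bound[of "{0..1}" "\<lambda>z. L (?v (x', z))" "\<lambda>z. L (partial_within strip (0, 1) ?v (x', z))" \<epsilon> z z']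
        component_derivative(2)[OF L(1) _ diff[OF e(2)]] second[OF e(2)] strip by simp
    ultimately have "\<bar>L (?v (x, z)) - L (?v (x', z'))\<bar> \<le> \<epsilon> * (\<bar>x - x'\<bar> + \<bar>z - z'\<bar>)"
      unfolding distrib_left by argo
    then show ?thesis using False by (simp add: holder_exponent_def)
  qed
qed

lemma sum_le_powr:
  fixes d :: real assumes "0 \<le> d" "d \<le> 8" "0 < \<beta>" "\<beta> \<le> 1"
  shows "d \<le> 8 * d powr \<beta>"
proof (cases "d = 0")
  case False
  have "d / 8 \<le> (d / 8) powr \<beta>" using powr_mono'[of \<beta> 1 "d / 8"] False assms by simp
  also have "\<dots> \<le> d powr \<beta>" using assms by (intro powr_mono2) auto
  finally show ?thesis by simp
qed simp

lemma kan_partials_lipschitz: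
  fixes x z x' z' :: real
  assumes "z \<in> {0..1}" "z' \<in> {0..1}"
  shows "\<bar>2 * pi * sin (2 * pi * x) * (z * (1 - z) / 32) - 2 * pi * sin (2 * pi * x') * (z' * (1 - z') / 32)\<bar> \<le> \<bar>x - x'\<bar> + \<bar>z - z'\<bar>"
    and "\<bar>cos (2 * pi * x) * ((1 - 2 * z) / 32) - cos (2 * pi * x') * ((1 - 2 * z') / 32)\<bar> \<le> \<bar>x - x'\<bar> + \<bar>z - z'\<bar>"
proof -
  have pi: "2 * pi \<le> 7" using pi_approx by simp
  have ang: "\<bar>2 * pi * x - 2 * pi * x'\<bar> \<le> 7 * \<bar>x - x'\<bar>"
    using mult_right_mono[OF pi, of "\<bar>x - x'\<bar>"] by (simp add: abs_mult flip: right_diff_distrib)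
  have s: "\<bar>sin (2 * pi * x) - sin (2 * pi * x')\<bar> \<le> 7 * \<bar>x - x'\<bar>"
    using field_differentiable_bound[of UNIV sin cos 1 "2 * pi * x" "2 * pi * x'"] ang by (simp add: DERIV_sin)
  have c: "\<bar>cos (2 * pi * x) - cos (2 * pi * x')\<bar> \<le> 7 * \<bar>x - x'\<bar>"
    using field_differentiable_bound[of UNIV cos "\<lambda>x. - sin x" 1 "2 * pi * x" "2 * pi * x'"] ang by (simp add: DERIV_cos)
  have zz: "\<bar>z * (1 - z)\<bar> \<le> 1/4" using zero_le_power2[of "z - 1/2"] mult_nonneg_nonneg[of z "1 - z"] assms
    by (simp add: power2_eq_square algebra_simps)
  have zd: "\<bar>z * (1 - z) - z' * (1 - z')\<bar> \<le> \<bar>z - z'\<bar> * 1"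
  proof -
    have "z * (1 - z) - z' * (1 - z') = (z - z') * (1 - z - z')" by (simp add: algebra_simps)
    moreover have "\<bar>1 - z - z'\<bar> \<le> 1" using assms by (auto simp: abs_le_iff)
    ultimately show ?thesis by (simp only: abs_mult) (intro mult_left_mono, auto)
  qed
  let ?S = "\<lambda>x. sin (2 * pi * x)"
  have eq: "?S x * (z * (1 - z)) - ?S x' * (z' * (1 - z')) = (?S x - ?S x') * (z * (1 - z)) + ?S x' * (z * (1 - z) - z' * (1 - z'))"
    by (simp add: algebra_simps)
  have "\<bar>(?S x - ?S x') * (z * (1 - z))\<bar> \<le> 7 * \<bar>x - x'\<bar> * (1/4)"
    unfolding abs_mult[of _ "z * (1 - z)"] using s zz by (intro mult_mono) auto
  moreover have "\<bar>?S x' * (z * (1 - z) - z' * (1 - z'))\<bar> \<le> 1 * (\<bar>z - z'\<bar> * 1)"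
    unfolding abs_mult[of "?S x'"] using zd by (intro mult_mono) auto
  ultimately have S: "\<bar>?S x * (z * (1 - z)) - ?S x' * (z' * (1 - z'))\<bar> \<le> 2 * (\<bar>x - x'\<bar> + \<bar>z - z'\<bar>)"
    unfolding eq
    using abs_triangle_ineq[of "(?S x - ?S x') * (z * (1 - z))" "?S x' * (z * (1 - z) - z' * (1 - z'))"]
      abs_ge_zero[of "x - x'"] abs_ge_zero[of "z - z'"] unfolding distrib_left by linarith
  have "2 * pi * ?S x * (z * (1 - z) / 32) - 2 * pi * ?S x' * (z' * (1 - z') / 32)
      = 2 * pi / 32 * (?S x * (z * (1 - z)) - ?S x' * (z' * (1 - z')))" by (simp add: field_simps)
  then have "\<bar>2 * pi * ?S x * (z * (1 - z) / 32) - 2 * pi * ?S x' * (z' * (1 - z') / 32)\<bar>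
      \<le> 7 / 32 * (2 * (\<bar>x - x'\<bar> + \<bar>z - z'\<bar>))"
    using S pi by (simp only: abs_mult[of "2 * pi / 32"]) (intro mult_mono, auto)
  also have "\<dots> \<le> \<bar>x - x'\<bar> + \<bar>z - z'\<bar>" by simp
  finally show "\<bar>2 * pi * ?S x * (z * (1 - z) / 32) - 2 * pi * ?S x' * (z' * (1 - z') / 32)\<bar> \<le> \<bar>x - x'\<bar> + \<bar>z - z'\<bar>" .
  let ?C = "\<lambda>x. cos (2 * pi * x)"
  have "?C x * ((1 - 2 * z) / 32) - ?C x' * ((1 - 2 * z') / 32) = (?C x - ?C x') * ((1 - 2 * z) / 32) + ?C x' * ((z' - z) / 16)"
    by (simp add: field_simps)
  moreover have "\<bar>(?C x - ?C x') * ((1 - 2 * z) / 32)\<bar> \<le> 7 * \<bar>x - x'\<bar> * (1/32)"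
    unfolding abs_mult[of _ "(1 - 2 * z) / 32"] using c assms by (intro mult_mono) auto
  moreover have "\<bar>?C x' * ((z' - z) / 16)\<bar> \<le> 1 * (\<bar>z - z'\<bar> / 16)"
    unfolding abs_mult[of "?C x'"] by (intro mult_mono) (auto simp: abs_minus_commute)
  ultimately show "\<bar>?C x * ((1 - 2 * z) / 32) - ?C x' * ((1 - 2 * z') / 32)\<bar> \<le> \<bar>x - x'\<bar> + \<bar>z - z'\<bar>" by argo
qed

lemma perturbation_is_kan_lift:
  assumes k: "1 < k" and g: "g \<in> Ck_maps k" and close: "Ck_close k \<delta> kan_map g"
    and \<delta>: "\<delta> \<le> max_perturbation (holder_exponent k)"
  shows "\<exists>P Q Px Pz Qx Qz p. kan_lift P Q Px Pz Qx Qz (holder_exponent k) (max_perturbation (holder_exponent k)) p g"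
proof -
  let ?\<beta> = "holder_exponent k" and ?\<epsilon> = "max_perturbation (holder_exponent k)"
  obtain F G where F: "Ck_lift k kan_map F" and G: "Ck_lift k g G" and "Ck_small k \<delta> strip (\<lambda>w. F w - G w)"
    using close unfolding Ck_close_def by blast
  then have small: "Ck_small k ?\<epsilon> strip (\<lambda>w. F w - G w)" using \<delta> by (blast intro: Ck_small_mono)
  have rF: "Cr_on (nat \<lfloor>k\<rfloor>) strip F" and rG: "Cr_on (nat \<lfloor>k\<rfloor>) strip G"
    using F G by (auto simp: Ck_lift_def Ck_on_def)
  have r: "Cr_on (nat \<lfloor>k\<rfloor>) strip (\<lambda>w. F w - G w)" using Cr_on_combination[OF rF rG, of "-1"] by simp
  have k1: "1 \<le> nat \<lfloor>k\<rfloor>" using k by (simp add: le_nat_iff le_floor_iff)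
  obtain p :: int where p: "\<And>w. w \<in> strip \<Longrightarrow> F w = kan_cover w + (of_int p, 0)"
    using lift_unique[OF kan_cover_lift F] k by auto
  have e: "(1, 0) \<in> (Basis :: (real \<times> real) set)" "(0, 1) \<in> (Basis :: (real \<times> real) set)"
    by (simp_all add: strip_directions)
  have F_eq: "F w = trig_field (of_int p) 3 [:0, 1:] [:0, 1/32, - 1/32:] 0 w" if "w \<in> strip" for w
    using p[OF that] by (cases w) (simp add: kan_cover_def trig_field_def)
  have in_strip: "(x, z) \<in> strip" if "z \<in> {0..1}" for x z :: real using that by (simp add: strip_def)
  have Fx: "partial_within strip (1, 0) F (x, z) = (3, - (2 * pi * sin (2 * pi * x) * (z * (1 - z) / 32)))"
    if "z \<in> {0..1}" for x z
  proof -
    have "partial_within strip (1, 0) F (x, z) = partial_within strip (1, 0) (trig_field (of_int p) 3 [:0, 1:] [:0, 1/32, - 1/32:] 0) (x, z)"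
      by (rule partial_within_cong[OF F_eq in_strip[OF that]])
    also have "\<dots> = trig_field 3 0 0 (smult (2 * pi) 0) (smult (- 2 * pi) [:0, 1/32, - 1/32:]) (x, z)"
      by (rule partial_within_eqI[OF trig_field_partial_x in_strip[OF that] e(1)])
    finally show ?thesis by (simp add: trig_field_def field_simps)
  qed
  have Fz: "partial_within strip (0, 1) F (x, z) = (0, 1 + cos (2 * pi * x) * ((1 - 2 * z) / 32))"
    if "z \<in> {0..1}" for x z
  proof -
    have "partial_within strip (0, 1) F (x, z) = partial_within strip (0, 1) (trig_field (of_int p) 3 [:0, 1:] [:0, 1/32, - 1/32:] 0) (x, z)"
      by (rule partial_within_cong[OF F_eq in_strip[OF that]])
    also have "\<dots> = trig_field 0 0 (pderiv [:0, 1:]) (pderiv [:0, 1/32, - 1/32:]) (pderiv 0) (x, z)"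
      by (rule partial_within_eqI[OF trig_field_partial_z in_strip[OF that] e(2)])
    finally show ?thesis by (simp add: trig_field_def pderiv_pCons field_simps)
  qed
  have diff_eq: "partial_within strip b (\<lambda>w. F w - G w) w = partial_within strip b F w - partial_within strip b G w"
    if "b \<in> Basis" "w \<in> strip" for b w
    using partials_within_combination[OF rF rG, of "[b]" w "-1"] that k1 by simp
  have bound: "norm (partial_within strip b F w - partial_within strip b G w) < ?\<epsilon>" if "b \<in> Basis" "w \<in> strip" for b w
  proof -
    have "norm (partials_within strip [b] (\<lambda>w. F w - G w) w) < ?\<epsilon>"
      by (rule Ck_smallD(1)[OF small]) (use that k1 in auto)
    then show ?thesis using diff_eq[OF that] by simp
  qed
  have bound0: "norm (F w - G w) < ?\<epsilon>" if "w \<in> strip" for w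
  proof -
    have "norm (partials_within strip [] (\<lambda>w. F w - G w) w) < ?\<epsilon>"
      by (rule Ck_smallD(1)[OF small]) (use that in auto)
    then show ?thesis by simp
  qed
  have fst_le: "\<bar>fst y\<bar> \<le> norm y" and snd_le: "\<bar>snd y\<bar> \<le> norm y" for y :: "real \<times> real"
    using norm_fst_le[of "fst y" "snd y"] norm_snd_le[of "snd y" "fst y"] by auto
  have holder: "\<bar>L (partial_within strip b F (x, z) - partial_within strip b G (x, z))
      - L (partial_within strip b F (x', z') - partial_within strip b G (x', z'))\<bar>
      \<le> ?\<epsilon> * (\<bar>x - x'\<bar> + \<bar>z - z'\<bar>) powr ?\<beta>"
    if "b \<in> Basis" "bounded_linear L" "\<And>y. \<bar>L y\<bar> \<le> norm y" "z \<in> {0..1}" "z' \<in> {0..1}" for b L x z x' z'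
    using first_partials_holder[OF k r small that, of x x'] that diff_eq[OF that(1) in_strip] by simp
  have \<beta>: "0 < ?\<beta>" "?\<beta> \<le> 1" by (rule holder_exponent_range[OF k])+
  have \<epsilon>: "0 < ?\<epsilon>" "?\<epsilon> \<le> 1" "?\<epsilon> < 1"
    using max_perturbation_pos[OF \<beta>(1)] by (auto simp: max_perturbation_def)
  have diffG: "differentiable_along G b w" if "b \<in> Basis" "w \<in> strip" for b w
  proof -
    have "length ([] :: (real \<times> real) list) < nat \<lfloor>k\<rfloor>" unfolding list.size using k1 by linarith
    from Cr_onD(1)[OF rG lists.Nil this that] show ?thesis unfolding foldr.simps id_apply .
  qed
  note deriv = component_derivative[where u = G]
  have boundary: "snd (G (x, z)) = z" if z: "z \<in> {0, 1}" for x z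
  proof -
    have s: "(x, z) \<in> strip" using z by (auto simp: strip_def)
    then have "covering (G (x, z)) = g (covering (x, z))" using G by (simp add: Ck_lift_def)
    moreover have "covering (x, z) \<in> annulus_boundary" using z by (auto simp: covering_def annulus_boundary_def)
    ultimately have "covering (G (x, z)) \<in> annulus_boundary" using g by (auto simp: Ck_maps_def)
    then have "snd (G (x, z)) \<in> {0, 1}" by (auto simp: covering_def annulus_boundary_def split_def)
    moreover have "\<bar>snd (F (x, z) - G (x, z))\<bar> < 1" using snd_le bound0[OF s] \<epsilon>(2) by (meson le_less_trans less_le_trans)
    moreover have "snd (F (x, z)) = z" using p[OF s] z by (auto simp: kan_cover_eq)
    ultimately show ?thesis using z by auto
  qed
  have "kan_lift (\<lambda>x z. fst (G (x, z))) (\<lambda>x z. snd (G (x, z)))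
      (\<lambda>x z. fst (partial_within strip (1, 0) G (x, z))) (\<lambda>x z. fst (partial_within strip (0, 1) G (x, z)))
      (\<lambda>x z. snd (partial_within strip (1, 0) G (x, z))) (\<lambda>x z. snd (partial_within strip (0, 1) G (x, z)))
      ?\<beta> ?\<epsilon> p g"
  proof (intro kan_lift.intro kan_lift_axioms.intro)
    show "kan_perturbation (\<lambda>x z. fst (G (x, z))) (\<lambda>x z. snd (G (x, z)))
      (\<lambda>x z. fst (partial_within strip (1, 0) G (x, z))) (\<lambda>x z. fst (partial_within strip (0, 1) G (x, z)))
      (\<lambda>x z. snd (partial_within strip (1, 0) G (x, z))) (\<lambda>x z. snd (partial_within strip (0, 1) G (x, z)))
      ?\<beta> ?\<epsilon> p"
    proof
      fix x z :: real assume z: "z \<in> {0..1}"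
      note s = in_strip[OF z]
      note dx = diffG[OF e(1) s] and dz = diffG[OF e(2) s]
      show "((\<lambda>x. fst (G (x, z))) has_real_derivative fst (partial_within strip (1, 0) G (x, z))) (at x)"
        by (rule deriv(1)[OF bounded_linear_fst z dx])
      show "((\<lambda>z. fst (G (x, z))) has_real_derivative fst (partial_within strip (0, 1) G (x, z))) (at z within {0..1})"
        by (rule deriv(2)[OF bounded_linear_fst z dz])
      show "((\<lambda>x. snd (G (x, z))) has_real_derivative snd (partial_within strip (1, 0) G (x, z))) (at x)"
        by (rule deriv(1)[OF bounded_linear_snd z dx])
      show "((\<lambda>z. snd (G (x, z))) has_real_derivative snd (partial_within strip (0, 1) G (x, z))) (at z within {0..1})"
        by (rule deriv(2)[OF bounded_linear_snd z dz])
      have "\<bar>fst (F (x, z) - G (x, z))\<bar> < ?\<epsilon>" using fst_le bound0[OF s] by (rule le_less_trans)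
      then show "\<bar>fst (G (x, z)) - (3 * x + p)\<bar> \<le> ?\<epsilon>" using p[OF s] by (simp add: kan_cover_eq)
      have bx: "\<bar>L (partial_within strip (1, 0) F (x, z) - partial_within strip (1, 0) G (x, z))\<bar> \<le> ?\<epsilon>"
        and bz: "\<bar>L (partial_within strip (0, 1) F (x, z) - partial_within strip (0, 1) G (x, z))\<bar> \<le> ?\<epsilon>"
        if "\<And>y. \<bar>L y\<bar> \<le> norm y" for L
        using that bound[OF e(1) s] bound[OF e(2) s] by (meson less_imp_le order_trans)+
      show "\<bar>fst (partial_within strip (1, 0) G (x, z)) - 3\<bar> \<le> ?\<epsilon>"
        using bx[OF fst_le] by (simp add: Fx[OF z])
      show "\<bar>fst (partial_within strip (0, 1) G (x, z))\<bar> \<le> ?\<epsilon>"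
        using bz[OF fst_le] by (simp add: Fz[OF z])
      show "\<bar>snd (partial_within strip (1, 0) G (x, z)) + 2 * pi * sin (2 * pi * x) * (z * (1 - z) / 32)\<bar> \<le> ?\<epsilon>"
        using bx[OF snd_le] unfolding Fx[OF z] snd_diff snd_conv by argo
      show "\<bar>snd (partial_within strip (0, 1) G (x, z)) - (1 + cos (2 * pi * x) * ((1 - 2 * z) / 32))\<bar> \<le> ?\<epsilon>"
        using bz[OF snd_le] unfolding Fz[OF z] snd_diff snd_conv by argo
    next
      fix x z x' z' :: real assume z: "z \<in> {0..1}" "z' \<in> {0..1}"
      let ?d = "\<bar>x - x'\<bar> + \<bar>z - z'\<bar>"
      note h1 = holder[OF e(1) bounded_linear_fst fst_le z, of x x'] and h2 = holder[OF e(2) bounded_linear_fst fst_le z, of x x']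
        and h3 = holder[OF e(1) bounded_linear_snd snd_le z, of x x'] and h4 = holder[OF e(2) bounded_linear_snd snd_le z, of x x']
      show "\<bar>fst (partial_within strip (1, 0) G (x, z)) - fst (partial_within strip (1, 0) G (x', z'))\<bar> \<le> ?\<epsilon> * ?d powr ?\<beta>"
        using h1 unfolding Fx[OF z(1)] Fx[OF z(2)] fst_diff fst_conv by argo
      show "\<bar>fst (partial_within strip (0, 1) G (x, z)) - fst (partial_within strip (0, 1) G (x', z'))\<bar> \<le> ?\<epsilon> * ?d powr ?\<beta>"
        using h2 unfolding Fz[OF z(1)] Fz[OF z(2)] fst_diff fst_conv by argo
      assume "?d \<le> 8"
      then have d: "?d \<le> 8 * ?d powr ?\<beta>" using \<beta> by (intro sum_le_powr) auto
      have e: "?\<epsilon> * ?d powr ?\<beta> \<le> 1 * ?d powr ?\<beta>" using \<epsilon> by (intro mult_right_mono) auto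
      show "\<bar>snd (partial_within strip (1, 0) G (x, z)) - snd (partial_within strip (1, 0) G (x', z'))\<bar> \<le> 9 * ?d powr ?\<beta>"
        using h3 d e kan_partials_lipschitz(1)[OF z, of x x'] unfolding Fx[OF z(1)] Fx[OF z(2)] snd_diff snd_conv by argo
      show "\<bar>snd (partial_within strip (0, 1) G (x, z)) - snd (partial_within strip (0, 1) G (x', z'))\<bar> \<le> 9 * ?d powr ?\<beta>"
        using h4 d e kan_partials_lipschitz(2)[OF z, of x x'] unfolding Fz[OF z(1)] Fz[OF z(2)] snd_diff snd_conv by argo
    qed (use \<beta> \<epsilon> boundary in auto)
    then interpret kan_perturbation "\<lambda>x z. fst (G (x, z))" "\<lambda>x z. snd (G (x, z))"
      "\<lambda>x z. fst (partial_within strip (1, 0) G (x, z))" "\<lambda>x z. fst (partial_within strip (0, 1) G (x, z))"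
      "\<lambda>x z. snd (partial_within strip (1, 0) G (x, z))" "\<lambda>x z. snd (partial_within strip (0, 1) G (x, z))"
      ?\<beta> ?\<epsilon> p .
    show "covering (kan_perturbation.G (\<lambda>x z. fst (G (x, z))) (\<lambda>x z. snd (G (x, z))) w) = g (covering w)" if "w \<in> strip" for w
      using G that unfolding G_def by (simp add: Ck_lift_def split_def)
  qed
  then show ?thesis by blast
qed

definition kan_neighborhood :: "real \<Rightarrow> (circle \<times> real \<Rightarrow> circle \<times> real) set" where
  "kan_neighborhood k = {g \<in> Ck_maps k. \<exists>\<delta> < max_perturbation (holder_exponent k). Ck_close k \<delta> kan_map g}"

text \<open>
  The strict inequality leaves room $\eta$.  Closeness of $h$ to $g$ is expressed by a lift of $g$ that
  may differ from the one used for closeness to $f$ by an integer translation, so the lift of $h$ is translated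
  accordingly before the triangle inequality is applied.
\<close>

lemma kan_neighborhood_open: "openin (Ck_topology k) (kan_neighborhood k)"
  unfolding openin_Ck_topology
proof (intro conjI ballI)
  fix g assume "g \<in> kan_neighborhood k"
  then obtain \<delta> F G where \<delta>: "\<delta> < max_perturbation (holder_exponent k)" and F: "Ck_lift k kan_map F" and G: "Ck_lift k g G"
    and FG: "Ck_small k \<delta> strip (\<lambda>w. F w - G w)"
    by (auto simp: kan_neighborhood_def Ck_close_def)
  define \<eta> where "\<eta> = (max_perturbation (holder_exponent k) - \<delta>) / 2"
  have "h \<in> kan_neighborhood k" if h: "h \<in> Ck_maps k" "Ck_close k \<eta> g h" for h
  proof -
    obtain G' H where G': "Ck_lift k g G'" and H: "Ck_lift k h H" and GH: "Ck_small k \<eta> strip (\<lambda>w. G' w - H w)"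
      using h(2) by (auto simp: Ck_close_def)
    obtain p :: int where p: "\<And>w. w \<in> strip \<Longrightarrow> G w = G' w + (of_int p, 0)"
      using lift_unique[OF G' G] by blast
    define H' where "H' w = H w + 1 *\<^sub>R (real_of_int p, 0)" for w
    have H': "Ck_lift k h H'"
      unfolding Ck_lift_def
    proof (intro conjI ballI)
      show "Ck_on k strip H'" unfolding H'_def
        using H by (intro Ck_on_combination Ck_on_const) (simp add: Ck_lift_def)
      fix w :: "real \<times> real" assume "w \<in> strip"
      then have "covering (H w) = h (covering w)" using H by (simp add: Ck_lift_def)
      moreover have "covering (H' w) = covering (H w)"
        by (simp add: H'_def covering_def split_def circle.abs_eq_iff)
      ultimately show "covering (H' w) = h (covering w)" by simp
    qed
    have cr: "Cr_on (nat \<lfloor>k\<rfloor>) strip K" if "Ck_lift k f K" for f K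
      using that by (auto simp: Ck_lift_def Ck_on_def)
    have "Ck_small k (\<delta> + \<eta>) strip (\<lambda>w. (F w - G w) + (G' w - H w))"
      using Cr_on_combination[OF cr[OF F] cr[OF G], of "-1"] Cr_on_combination[OF cr[OF G'] cr[OF H], of "-1"]
      by (intro Ck_small_add FG GH) simp_all
    then have "Ck_small k (\<delta> + \<eta>) strip (\<lambda>w. F w - H' w)"
      by (rule Ck_small_cong) (simp add: p H'_def algebra_simps)
    then have "Ck_close k (\<delta> + \<eta>) kan_map h" using F H' by (auto simp: Ck_close_def)
    moreover have "\<delta> + \<eta> < max_perturbation (holder_exponent k)" using \<delta> by (simp add: \<eta>_def field_simps)
    ultimately show ?thesis using h(1) by (auto simp: kan_neighborhood_def)
  qed
  moreover have "0 < \<eta>" using \<delta> by (simp add: \<eta>_def)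
  ultimately show "\<exists>\<epsilon>>0. \<forall>h\<in>Ck_maps k. Ck_close k \<epsilon> g h \<longrightarrow> h \<in> kan_neighborhood k" by blast
qed (auto simp: kan_neighborhood_def)

lemma kan_map_in_neighborhood:
  assumes "1 < k" shows "kan_map \<in> kan_neighborhood k"
proof -
  have "0 < max_perturbation (holder_exponent k)"
    by (rule max_perturbation_pos[OF holder_exponent_range(1)[OF assms]])
  moreover from this have "Ck_small k (max_perturbation (holder_exponent k) / 2) strip (\<lambda>w. kan_cover w - kan_cover w)"
    using Ck_small_zero by simp
  then have "Ck_close k (max_perturbation (holder_exponent k) / 2) kan_map kan_map"
    using kan_cover_lift[of k] assms unfolding Ck_close_def by force
  ultimately show ?thesis
    using kan_map_Ck[of k] assms unfolding kan_neighborhood_def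
    by (intro CollectI conjI exI[of _ "max_perturbation (holder_exponent k) / 2"]) auto
qed

theorem mainTheorem4:
  fixes \<alpha> k :: real
  assumes "\<alpha> > 0" and "k \<ge> 1 + \<alpha>"
  shows "\<exists>U. openin (Ck_topology k) U \<and> kan_map \<in> U \<and>
    (\<forall>g\<in>U.
      attractor annulus_lebesgue annulus g (UNIV \<times> {0}) \<and>
      attractor annulus_lebesgue annulus g (UNIV \<times> {1}) \<and>
      annulus - (basin annulus g (UNIV \<times> {0}) \<union> basin annulus g (UNIV \<times> {1}))
        \<in> null_sets annulus_lebesgue \<and>
      intermingled annulus_lebesgue
        {basin annulus g (UNIV \<times> {0}), basin annulus g (UNIV \<times> {1})})"
proof -
  have k: "1 < k" using assms by simp
  have "attractor annulus_lebesgue annulus g (UNIV \<times> {0}) \<and>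
      attractor annulus_lebesgue annulus g (UNIV \<times> {1}) \<and>
      annulus - (basin annulus g (UNIV \<times> {0}) \<union> basin annulus g (UNIV \<times> {1}))
        \<in> null_sets annulus_lebesgue \<and>
      intermingled annulus_lebesgue
        {basin annulus g (UNIV \<times> {0}), basin annulus g (UNIV \<times> {1})}"
    if "g \<in> kan_neighborhood k" for g
  proof -
    from that obtain \<delta> where "g \<in> Ck_maps k" "Ck_close k \<delta> kan_map g" "\<delta> \<le> max_perturbation (holder_exponent k)"
      by (auto simp: kan_neighborhood_def)
    from perturbation_is_kan_lift[OF k this]
    obtain P Q Px Pz Qx Qz p where "kan_lift P Q Px Pz Qx Qz (holder_exponent k) (max_perturbation (holder_exponent k)) p g"
      by blast
    then interpret kan_lift P Q Px Pz Qx Qz "holder_exponent k" "max_perturbation (holder_exponent k)" p g .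
    show ?thesis by (intro conjI attractor_boundary basins_full basins_intermingled) auto
  qed
  then show ?thesis
    using kan_neighborhood_open kan_map_in_neighborhood[OF k] by blast
qed

end
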